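(* Consider the product probability space $(\Omega,\mathcal A,\mathbb P)=(\mathbb R^{\mathbb Z^2},\mathcal B^{\mathbb Z^2},P^{\mathbb Z^2})$ with shifts $\{T_{i,j}\}$, natural filtration $\{\mathcal F_{i,j}\}$ and rectangles $\{V_n\}_{n\in\mathbb N}$ as described in the context. Suppose $f\in\mathcal L_0^2$ and $f$ is $\mathcal F_{0,0}$-measurable. If $\{f\circ T_{i,j}\}_{(i,j)\in\mathbb N^2}$ are 2-parameter orthomartingale differences, i.e. $$\mathbb E(f\circ T_{i+1,j}\mid\mathcal F_{i,\infty})=\mathbb E(f\circ T_{i,j+1}\mid\mathcal F_{\infty,j})=0\quad\text{almost surely, for all }(i,j)\in\mathbb N^2,$$ then $\sigma^2=\lim_{n\to\infty}\mathbb E(S_n(f)^2)/|V_n|<\infty$ exists, and $$\frac{S_n(f)}{|V_n|^{1/2}}\Rightarrow\sigma\,\mathcal N(0,1).$$ In addition, if $f\in\mathcal L_0^p$ for some $p>2$, then the invariance principle $$\frac{B_{n,\cdot}(f)}{|V_n|^{1/2}}\Rightarrow\sigma\,\mathbb B(\cdot)$$ holds in $C[0,1]^2$.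
   Context: $\mathbb N=\{1,2,\dots\}$. $P$ is a probability measure on $(\mathbb R,\mathcal B)$, $\mathcal B$ the Borel $\sigma$-field; $\epsilon_{i,j}(\omega)=\omega_{i,j}$, so $\{\epsilon_{i,j}\}_{(i,j)\in\mathbb Z^2}$ are i.i.d. with distribution $P$. The natural filtration is $\mathcal F_{k,l}=\sigma(\epsilon_{i,j}:i\le k,\ j\le l)$; $\mathcal F_{i,\infty}=\bigvee_{j\ge0}\mathcal F_{i,j}$, $\mathcal F_{\infty,j}=\bigvee_{i\ge0}\mathcal F_{i,j}$, $\mathcal F_{\infty,\infty}=\sigma(\epsilon_{i,j}:(i,j)\in\mathbb Z^2)$. The shifts are $(T_{k,l}\,\omega)_{i,j}=\omega_{i+k,j+l}$. For $p\ge2$, $\mathcal L_0^p=\{f\in L^p(\mathcal F_{\infty,\infty}):\mathbb Ef=0\}$. $V_n=\{1,\dots,m_1^{(n)}\}\times\{1,\dots,m_2^{(n)}\}$ with $m_i^{(n)}$ increasing to infinity as $n\to\infty$, $i=1,2$; $S_n(f)=\sum_{k\in V_n}f\circ T_k$. For $t\in[0,1]^2$, $V_n(t)=[0,m_1^{(n)}t_1]\times[0,m_2^{(n)}t_2]$, $R_k=(k_1-1,k_1]\times(k_2-1,k_2]$, and $B_{n,t}(f)=\sum_{k\in\mathbb N^2}\lambda(V_n(t)\cap R_k)\,f\circ T_k$ with $\lambda$ Lebesgue measure on $\mathbb R^2$. $\Rightarrow$ denotes convergence in distribution, respectively weak convergence of laws on $C[0,1]^2$ (continuous real functions on $[0,1]^2$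 with the uniform metric). $\mathbb B$ is the standard Brownian sheet on $[0,1]^2$: the mean-zero continuous Gaussian field with covariance $\mathbb E(\mathbb B(s)\mathbb B(t))=\min(s_1,t_1)\min(s_2,t_2)$. $\sigma\,\mathcal N(0,1)$ is the law of $\sigma$ times a standard normal variable. *)

theory Defs
  imports "HOL-Probability.Probability"
begin

section \<open>The product space, its filtration and shifts\<close>

type_synonym config = "int \<times> int \<Rightarrow> real"

definition prodspace :: "real measure \<Rightarrow> config measure" where
  "prodspace P = Pi\<^sub>M UNIV (\<lambda>_. P)"

definition coord :: "int \<Rightarrow> int \<Rightarrow> config \<Rightarrow> real" where
  "coord i j \<omega> = \<omega> (i, j)"

definition coord_sigma :: "(int \<times> int) set \<Rightarrow> config measure" where
  "coord_sigma I = sigma UNIV (\<Union>(i, j)\<in>I. {coord i j -` A | A. A \<in> sets borel})"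

definition filt :: "int \<Rightarrow> int \<Rightarrow> config measure" where
  "filt k l = coord_sigma {(i, j). i \<le> k \<and> j \<le> l}"

definition filt_row :: "int \<Rightarrow> config measure" where \<comment> \<open>the join of all \<open>filt i j\<close> over \<open>j\<close>\<close>
  "filt_row i = sigma UNIV (\<Union>j\<in>{0..}. sets (filt i j))"

definition filt_col :: "int \<Rightarrow> config measure" where \<comment> \<open>the join of all \<open>filt i j\<close> over \<open>i\<close>\<close>
  "filt_col j = sigma UNIV (\<Union>i\<in>{0..}. sets (filt i j))"

definition filt_all :: "config measure" where
  "filt_all = coord_sigma UNIV"

definition shift :: "int \<Rightarrow> int \<Rightarrow> config \<Rightarrow> config" where
  "shift k l \<omega> = (\<lambda>(i, j). \<omega> (i + k, j + l))"

definition L0 :: "real measure \<Rightarrow> real \<Rightarrow> (config \<Rightarrow> real) set" where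
  "L0 P p = {f. f \<in> borel_measurable filt_all \<and>
                integrable (prodspace P) (\<lambda>\<omega>. \<bar>f \<omega>\<bar> powr p) \<and>
                integral\<^sup>L (prodspace P) f = 0}"

definition orthomartingale_differences :: "real measure \<Rightarrow> (config \<Rightarrow> real) \<Rightarrow> bool" where
  "orthomartingale_differences P f \<longleftrightarrow>
     (\<forall>i\<ge>1. \<forall>j\<ge>1.
        (AE \<omega> in prodspace P. real_cond_exp (prodspace P) (filt_row i) (f \<circ> shift (i + 1) j) \<omega> = 0) \<and>
        (AE \<omega> in prodspace P. real_cond_exp (prodspace P) (filt_col j) (f \<circ> shift i (j + 1)) \<omega> = 0))"


section \<open>Partial sums and the smoothed partial-sum process\<close>

text \<open>The side lengths of the rectangles are sequences \<open>m1, m2\<close>; the functions below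
  take their values \<open>a = m1 n\<close> and \<open>b = m2 n\<close> at a given \<open>n\<close>.\<close>

definition rect :: "nat \<Rightarrow> nat \<Rightarrow> (int \<times> int) set" where
  "rect a b = {1..int a} \<times> {1..int b}"

definition partial_sum :: "nat \<Rightarrow> nat \<Rightarrow> (config \<Rightarrow> real) \<Rightarrow> config \<Rightarrow> real" where
  "partial_sum a b f \<omega> = (\<Sum>(k, l)\<in>rect a b. f (shift k l \<omega>))"

definition rect_upto :: "nat \<Rightarrow> nat \<Rightarrow> real \<times> real \<Rightarrow> (real \<times> real) set" where
  "rect_upto a b t = {0..real a * fst t} \<times> {0..real b * snd t}"

definition unit_cell :: "int \<Rightarrow> int \<Rightarrow> (real \<times> real) set" where
  "unit_cell k l = {real_of_int k - 1<..real_of_int k} \<times> {real_of_int l - 1<..real_of_int l}"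

text \<open>The index set is infinite, hence \<^const>\<open>infsum\<close>; for each \<open>t\<close> only finitely many terms
  are nonzero.\<close>

definition smooth_sum :: "nat \<Rightarrow> nat \<Rightarrow> (config \<Rightarrow> real) \<Rightarrow> real \<times> real \<Rightarrow> config \<Rightarrow> real" where
  "smooth_sum a b f t \<omega> =
     (\<Sum>\<^sub>\<infinity>(k, l)\<in>{1..} \<times> {1..}.
        measure lborel (rect_upto a b t \<inter> unit_cell k l) * f (shift k l \<omega>))"


section \<open>Weak convergence on the space of continuous functions on the unit square\<close>

definition borel_of_top :: "'a topology \<Rightarrow> 'a measure" where
  "borel_of_top T = sigma (topspace T) {U. openin T U}"

definition weak_conv_top :: "'a topology \<Rightarrow> (nat \<Rightarrow> 'a measure) \<Rightarrow> 'a measure \<Rightarrow> bool" where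
  "weak_conv_top T \<mu>s \<mu> \<longleftrightarrow>
     (\<forall>n. prob_space (\<mu>s n) \<and> sets (\<mu>s n) = sets (borel_of_top T)) \<and>
     prob_space \<mu> \<and> sets \<mu> = sets (borel_of_top T) \<and>
     (\<forall>F. continuous_map T euclideanreal F \<and> bounded (F ` topspace T) \<longrightarrow>
        (\<lambda>n. integral\<^sup>L (\<mu>s n) F) \<longlonglongrightarrow> integral\<^sup>L \<mu> F)"

definition unit_square :: "(real \<times> real) set" where
  "unit_square = {0..1} \<times> {0..1}"

text \<open>The points of the metric space \<^term>\<open>cfunspace X m\<close> are extensional functions, so paths
  have to be restricted to the unit square; its metric is the supremum metric.\<close>

definition C_square :: "(real \<times> real \<Rightarrow> real) topology" where
  "C_square = mtopology_of (cfunspace (top_of_set unit_square) euclidean_metric)"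

definition path_law :: "'w measure \<Rightarrow> ('w \<Rightarrow> real \<times> real \<Rightarrow> real) \<Rightarrow> (real \<times> real \<Rightarrow> real) measure" where
  "path_law M X = distr M (borel_of_top C_square) (\<lambda>\<omega>. restrict (X \<omega>) unit_square)"


section \<open>The Brownian sheet\<close>

definition gaussian_rv :: "'w measure \<Rightarrow> ('w \<Rightarrow> real) \<Rightarrow> bool" where \<comment> \<open>degenerate laws allowed\<close>
  "gaussian_rv M X \<longleftrightarrow> X \<in> borel_measurable M \<and>
     (\<exists>\<mu> \<sigma>. distr M borel X = distr std_normal_distribution borel (\<lambda>x. \<mu> + \<sigma> * x))"

definition brownian_sheet_law :: "(real \<times> real \<Rightarrow> real) measure \<Rightarrow> bool" where
  "brownian_sheet_law W \<longleftrightarrow>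
     prob_space W \<and> sets W = sets (borel_of_top C_square) \<and>
     (\<forall>I c. finite I \<and> I \<subseteq> unit_square \<longrightarrow> gaussian_rv W (\<lambda>w. \<Sum>t\<in>I. c t * w t)) \<and>
     (\<forall>t\<in>unit_square. integral\<^sup>L W (\<lambda>w. w t) = 0) \<and>
     (\<forall>s\<in>unit_square. \<forall>t\<in>unit_square.
        integral\<^sup>L W (\<lambda>w. w s * w t) = min (fst s) (fst t) * min (snd s) (snd t))"

end

theory Submission
  imports Defs
begin

text \<open>
  For orthomartingale differences the summands \<open>f \<circ> T\<^sub>k\<close> are orthogonal, so \<open>E S\<^sub>n(f)\<^sup>2 = |V\<^sub>n| E f\<^sup>2\<close>, and
  Cairoli's maximal inequality (Doob's inequality once in each direction) controls
  \<open>max |S\<^sub>k(f - g)|\<close> by \<open>\<parallel>f - g\<parallel>\<^sub>2\<close>. Since conditional expectations on coordinate sets commute,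
  \<open>f\<close> can be approximated in \<open>L\<^sup>2\<close> by bounded \<open>g\<close> which depend on finitely many coordinates and
  are again orthomartingale differences. For such \<open>g\<close>, Stein's method in Tikhomirov's form gives a
  differential inequality \<open>\<phi>' = - v u \<phi> + O(u\<^sup>2 |V\<^sub>n|\<^sup>-\<^sup>1\<^sup>/\<^sup>2)\<close> for the characteristic function of any
  weighted sum, hence the central limit theorem and the convergence of the finite-dimensional
  distributions of \<open>B\<^sub>n\<close>. Fourth moments of maxima over thin strips bound the distance of \<open>B\<^sub>n\<close> to
  its interpolation from a grid, so that testing with bounded Lipschitz functions reduces
  weak convergence on \<open>C[0,1]\<^sup>2\<close> to finitely many coordinates.
\<close>

section \<open>Martingale differences and maximal inequalities\<close>

text \<open>Orthomartingale differences alone do not force a Gaussian limit: products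
  \<open>X\<^sub>i Y\<^sub>j\<close> of two independent centred sequences are such differences, and
  their normalized sums converge to a product of two normal variables. What helps here is that
  \<open>f\<close> is a function of i.i.d. coordinates indexed by Z^2: for a \<open>g\<close>
  depending on finitely many of them, each summand shares coordinates with boundedly many others,
  whatever the size of the rectangle. The order of choices shapes the estimates: \<eta> and with it
  \<open>g\<close> come before the mesh \<open>1 / N\<close>, and \<open>N\<close> before
  \<open>n\<close>. The bound \<open>K\<close> of \<open>g\<close> is not controlled by \<eta>, so
  it may enter only terms that vanish as \<open>N\<close> or \<open>|V\<^sub>n|\<close> grows.
  Second moments of \<open>g\<close> over \<open>N\<close> strips, each of order
  \<open>1 / N\<close>, would add up to a constant; fourth moments, each of order
  \<open>1 / N\<^sup>2\<close>, leave \<open>1 / N\<close>. The remainder \<open>f - g\<close> has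
  second moments only and is bounded by its maximum over the whole rectangle, without strips. The
  limit is given as a law on continuous paths, so its grid interpolants converge to it path by
  path.\<close>

definition null_on :: "'a measure \<Rightarrow> 'a measure \<Rightarrow> ('a \<Rightarrow> real) \<Rightarrow> bool" where
  "null_on M F D \<longleftrightarrow> integrable M D \<and>
     (\<forall>h\<in>borel_measurable F. bounded (range h) \<longrightarrow> (\<integral>x. h x * D x \<partial>M) = 0)"

lemma integrable_mult_bounded:
  fixes h D :: "'a \<Rightarrow> real"
  assumes "integrable M D" "h \<in> borel_measurable M" "bounded (range h)"
  shows "integrable M (\<lambda>x. h x * D x)"
proof -
  obtain B where B: "\<And>x. \<bar>h x\<bar> \<le> B"
    using assms(3) by (auto simp: bounded_iff)
  show ?thesis
    apply (rule Bochner_Integration.integrable_bound[of _ "\<lambda>x. B * D x"])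
    using assms B by (auto simp: abs_mult intro!: mult_mono order_trans[OF B abs_ge_self] AE_I2)
qed

lemma null_on_sum:
  assumes "subalgebra M F" "\<And>i. i \<in> I \<Longrightarrow> null_on M F (D i)"
  shows "null_on M F (\<lambda>x. \<Sum>i\<in>I. D i x)"
  unfolding null_on_def
proof (intro conjI ballI impI)
  show "integrable M (\<lambda>x. \<Sum>i\<in>I. D i x)"
    using assms by (auto simp: null_on_def)
  fix h :: "'a \<Rightarrow> real" assume h: "h \<in> borel_measurable F" "bounded (range h)"
  have hM: "h \<in> borel_measurable M"
    using h assms by (auto intro: measurable_from_subalg)
  have "(\<integral>x. h x * (\<Sum>i\<in>I. D i x) \<partial>M) = (\<Sum>i\<in>I. \<integral>x. h x * D i x \<partial>M)"
    unfolding sum_distrib_left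
    by (rule Bochner_Integration.integral_sum)
       (use assms hM h in \<open>auto simp: null_on_def intro: integrable_mult_bounded\<close>)
  also have "\<dots> = 0"
    using assms h by (auto simp: null_on_def)
  finally show "(\<integral>x. h x * (\<Sum>i\<in>I. D i x) \<partial>M) = 0" .
qed

lemma null_on_diff:
  assumes "subalgebra M F" "null_on M F D" "null_on M F E"
  shows "null_on M F (\<lambda>x. D x - E x)"
  unfolding null_on_def
proof (intro conjI ballI impI)
  show "integrable M (\<lambda>x. D x - E x)"
    using assms by (auto simp: null_on_def)
  fix h :: "'a \<Rightarrow> real" assume h: "h \<in> borel_measurable F" "bounded (range h)"
  have hM: "h \<in> borel_measurable M"
    using h assms by (auto intro: measurable_from_subalg)
  have "(\<integral>x. h x * (D x - E x) \<partial>M) = (\<integral>x. h x * D x \<partial>M) - (\<integral>x. h x * E x \<partial>M)"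
    unfolding right_diff_distrib
    by (rule Bochner_Integration.integral_diff)
       (use assms hM h in \<open>auto simp: null_on_def intro: integrable_mult_bounded\<close>)
  also have "\<dots> = 0"
    using assms h by (auto simp: null_on_def)
  finally show "(\<integral>x. h x * (D x - E x) \<partial>M) = 0" .
qed

text \<open>\<open>null_on M F D\<close> is \<open>E(D | F) = 0\<close> in tested form, so that no
  version of a conditional expectation has to be chosen. Bounded tests do not cover the weights of
  the maximal inequality, which are running maxima; setting \<open>h\<close> to zero where it
  exceeds \<open>n\<close> keeps \<open>\<bar>h D\<bar>\<close> as a dominating function.\<close>

lemma null_onD:
  assumes "subalgebra M F" "null_on M F D" and h: "h \<in> borel_measurable F"
    and int: "integrable M (\<lambda>x. h x * D x)"
  shows "(\<integral>x. h x * D x \<partial>M) = 0"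
proof -
  define hn where "hn n x = (if \<bar>h x\<bar> \<le> real n then h x else 0)" for n x
  have [measurable]: "h \<in> borel_measurable M" "D \<in> borel_measurable M"
    using assms by (auto intro: measurable_from_subalg simp: null_on_def)
  have hn: "hn n \<in> borel_measurable F" for n
    using h unfolding hn_def by measurable
  have [measurable]: "hn n \<in> borel_measurable M" for n
    unfolding hn_def by measurable
  have "(\<lambda>n. \<integral>x. hn n x * D x \<partial>M) \<longlonglongrightarrow> (\<integral>x. h x * D x \<partial>M)"
  proof (rule integral_dominated_convergence[where w="\<lambda>x. \<bar>h x * D x\<bar>"])
    show "AE x in M. (\<lambda>n. hn n x * D x) \<longlonglongrightarrow> h x * D x"
    proof (rule AE_I2)
      fix x
      obtain N where "\<bar>h x\<bar> \<le> real N" using real_arch_simple by blast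
      then have "eventually (\<lambda>n. hn n x * D x = h x * D x) sequentially"
        by (intro eventually_sequentiallyI[of N]) (auto simp: hn_def)
      then show "(\<lambda>n. hn n x * D x) \<longlonglongrightarrow> h x * D x" by (rule tendsto_eventually)
    qed
  qed (use int in \<open>auto simp: hn_def\<close>)
  moreover have "(\<integral>x. hn n x * D x \<partial>M) = 0" for n
  proof -
    have "bounded (range (hn n))"
      by (auto simp: bounded_iff hn_def intro!: exI[of _ "real n"])
    then show ?thesis using assms(2) hn by (auto simp: null_on_def)
  qed
  ultimately show ?thesis using LIMSEQ_unique[of "\<lambda>n. 0::real"] by simp
qed

section \<open>One-parameter martingale inequalities\<close>

text \<open>The deterministic core of Doob's inequality in L2. For a nonnegative submartingale the
  sum is a stochastic integral of its running maximum and has nonnegative expectation, so taking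
  expectations gives the factor 4.\<close>

lemma running_max_pathwise:
  fixes x :: "nat \<Rightarrow> real"
  shows "(Max (x ` {..n}))\<^sup>2 + 4 * (\<Sum>i<n. Max (x ` {..i}) * (x (Suc i) - x i)) \<le> 4 * (x n)\<^sup>2"
proof -
  define y where "y n = Max (x ` {..n})" for n
  have y_Suc: "y (Suc n) = max (x (Suc n)) (y n)" for n
    by (simp add: y_def atMost_Suc)
  \<comment> \<open>Summation by parts: the running maximum \<open>y\<close> grows only at times
    when it equals \<open>x\<close>, so there \<open>x dy\<close> is \<open>y dy\<close>, which
    produces the term \<open>y\<^sup>2 / 2\<close>.\<close>
  have "(\<Sum>i<n. y i * (x (Suc i) - x i)) \<le> y n * x n - (y n)\<^sup>2 / 2" for n
  proof (induction n)
    case 0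
    then show ?case by (simp add: y_def power2_eq_square)
  next
    case (Suc n)
    have "(\<Sum>i<Suc n. y i * (x (Suc i) - x i)) \<le> y n * x (Suc n) - (y n)\<^sup>2 / 2"
      using Suc by (simp add: algebra_simps)
    also have "\<dots> \<le> y (Suc n) * x (Suc n) - (y (Suc n))\<^sup>2 / 2"
    proof (cases "x (Suc n) \<le> y n")
      case False
      then have "y (Suc n) = x (Suc n)" by (simp add: y_Suc)
      moreover have "0 \<le> (y n - x (Suc n))\<^sup>2" by simp
      ultimately show ?thesis by (simp add: power2_eq_square algebra_simps)
    qed (simp add: y_Suc)
    finally show ?case .
  qed
  from this[of n] have "(y n)\<^sup>2 + 4 * (\<Sum>i<n. y i * (x (Suc i) - x i)) \<le> 4 * y n * x n - (y n)\<^sup>2"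
    by simp
  also have "\<dots> \<le> 4 * (x n)\<^sup>2"
    using zero_le_power2[of "y n - 2 * x n"] by (simp add: power2_eq_square algebra_simps)
  finally show ?thesis by (simp add: y_def)
qed

lemma integrable_mult_L2:
  fixes f g :: "'a \<Rightarrow> real"
  assumes [measurable]: "f \<in> borel_measurable M" "g \<in> borel_measurable M"
    and "integrable M (\<lambda>x. (f x)\<^sup>2)" "integrable M (\<lambda>x. (g x)\<^sup>2)"
  shows "integrable M (\<lambda>x. f x * g x)"
proof (rule Bochner_Integration.integrable_bound[of _ "\<lambda>x. (f x)\<^sup>2 + (g x)\<^sup>2"])
  have "\<bar>a * b\<bar> \<le> a\<^sup>2 + b\<^sup>2" for a b :: real
    using sum_squares_bound[of "\<bar>a\<bar>" "\<bar>b\<bar>"] mult_nonneg_nonneg[OF abs_ge_zero[of a] abs_ge_zero[of b]]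
    unfolding abs_mult power2_abs by linarith
  then show "AE x in M. norm (f x * g x) \<le> norm ((f x)\<^sup>2 + (g x)\<^sup>2)"
    by (intro AE_I2) (simp del: power2_abs)
qed (use assms in auto)

lemma sum_squares_bound_Max:
  fixes f :: "nat \<Rightarrow> real"
  shows "(Max (f ` {..m}))\<^sup>2 \<le> (\<Sum>i\<le>m. (f i)\<^sup>2)"
proof -
  have "Max (f ` {..m}) \<in> f ` {..m}" by (rule Max_in) auto
  then obtain i where i: "i \<le> m" "Max (f ` {..m}) = f i" by (metis imageE atMost_iff)
  have "(f i)\<^sup>2 \<le> (\<Sum>i\<le>m. (f i)\<^sup>2)"
    by (rule member_le_sum) (use i in auto)
  then show ?thesis using i by simp
qed

lemma integrable_Max_L2:
  fixes f :: "nat \<Rightarrow> 'a \<Rightarrow> real"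
  assumes [measurable]: "\<And>i. i \<le> m \<Longrightarrow> f i \<in> borel_measurable M"
    and "\<And>i. i \<le> m \<Longrightarrow> integrable M (\<lambda>x. (f i x)\<^sup>2)"
  shows "integrable M (\<lambda>x. (Max ((\<lambda>i. f i x) ` {..m}))\<^sup>2)"
proof (rule Bochner_Integration.integrable_bound[of _ "\<lambda>x. \<Sum>i\<le>m. (f i x)\<^sup>2"])
  show "(\<lambda>x. (Max ((\<lambda>i. f i x) ` {..m}))\<^sup>2) \<in> borel_measurable M"
    by (intro borel_measurable_power borel_measurable_Max) auto
  show "AE x in M. norm ((Max ((\<lambda>i. f i x) ` {..m}))\<^sup>2) \<le> norm (\<Sum>i\<le>m. (f i x)\<^sup>2)"
    using sum_squares_bound_Max[of "\<lambda>i. f i _" m] by (intro AE_I2) (simp add: sum_nonneg)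
qed (use assms in auto)

text \<open>The maximum over \<open>i\<close> of convex functions of martingales is a submartingale
  in \<open>j\<close>. This enters through subgradients: at the index attaining the maximum,
  \<open>\<psi>\<close> times the next increment bounds the growth of the maximum from below and
  integrates to zero against the past. A family in \<open>i\<close> is allowed because in two
  parameters the maximum over the first index is taken before Doob's inequality acts along the
  second.\<close>

lemma doob_max_family:
  fixes S :: "nat \<Rightarrow> nat \<Rightarrow> 'a \<Rightarrow> real" and \<phi> \<psi> :: "real \<Rightarrow> real"
  assumes sub: "\<And>j. subalgebra M (F j)"
    and [measurable]: "\<phi> \<in> borel_measurable borel" "\<psi> \<in> borel_measurable borel"
    and nonneg: "\<And>a. 0 \<le> \<phi> a" and convex: "\<And>a b. \<phi> a + \<psi> a * (b - a) \<le> \<phi> b"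
    and meas: "\<And>i j k. j \<le> k \<Longrightarrow> S i j \<in> borel_measurable (F k)"
    and null: "\<And>i j. null_on M (F j) (\<lambda>x. S i (Suc j) x - S i j x)"
    and L2: "\<And>i j. integrable M (\<lambda>x. (\<phi> (S i j x))\<^sup>2)"
    and L2': "\<And>i j. integrable M (\<lambda>x. (\<psi> (S i j x) * (S i (Suc j) x - S i j x))\<^sup>2)"
  shows "(\<integral>x. (Max ((\<lambda>j. Max ((\<lambda>i. \<phi> (S i j x)) ` {..m})) ` {..n}))\<^sup>2 \<partial>M)
    \<le> 4 * (\<integral>x. (Max ((\<lambda>i. \<phi> (S i n x)) ` {..m}))\<^sup>2 \<partial>M)"
proof -
  define X where "X j x = Max ((\<lambda>i. \<phi> (S i j x)) ` {..m})" for j x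
  define Y where "Y j x = Max ((\<lambda>j. X j x) ` {..j})" for j x
  have SM [measurable]: "S i j \<in> borel_measurable M" for i j
    using measurable_from_subalg[OF sub meas[of j j]] by simp
  have XF: "X j \<in> borel_measurable (F k)" if "j \<le> k" for j k
    unfolding X_def using that
    by (intro borel_measurable_Max) (auto intro!: measurable_compose[OF meas])
  have YF: "Y j \<in> borel_measurable (F j)" for j
    unfolding Y_def by (intro borel_measurable_Max) (auto intro: XF)
  have [measurable]: "X j \<in> borel_measurable M" "Y j \<in> borel_measurable M" for j
    using measurable_from_subalg[OF sub XF[of j j]] measurable_from_subalg[OF sub YF] by simp_all
  have X2: "integrable M (\<lambda>x. (X j x)\<^sup>2)" for j
    unfolding X_def by (rule integrable_Max_L2) (use L2 in auto)
  have Y2: "integrable M (\<lambda>x. (Y j x)\<^sup>2)" for j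
    unfolding Y_def by (rule integrable_Max_L2) (use X2 in auto)
  have Xge: "\<phi> (S i j x) \<le> X j x" if "i \<le> m" for i j x
    unfolding X_def using that by (intro Max_ge) auto
  have X0: "0 \<le> X j x" for j x
    using Xge[of 0 j x] nonneg[of "S 0 j x"] by linarith
  have Y0: "0 \<le> Y j x" for j x
    unfolding Y_def by (rule order_trans[OF X0[of 0 x] Max_ge]) auto
  \<comment> \<open>Indicator that \<open>i\<close> is the least index attaining the maximum at time
    \<open>j\<close>. Taking the least one makes the indicators sum to 1, and they remain measurable
    for \<open>F j\<close>.\<close>
  define e where "e i j x = (if \<phi> (S i j x) = X j x \<and> (\<forall>i'<i. \<phi> (S i' j x) \<noteq> X j x) then 1 else 0 :: real)"
    for i j x
  have eF: "e i j \<in> borel_measurable (F j)" for i j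
  proof -
    note [measurable] = XF[OF order_refl, of j] measurable_compose[OF meas[OF order_refl, of _ j], of \<phi> borel, simplified]
    show ?thesis unfolding e_def by measurable
  qed
  have [measurable]: "e i j \<in> borel_measurable M" for i j
    using measurable_from_subalg[OF sub eF] .
  have e1: "(\<Sum>i\<le>m. e i j x) = 1" for j x
  proof -
    have "X j x \<in> (\<lambda>i. \<phi> (S i j x)) ` {..m}" unfolding X_def by (rule Max_in) auto
    then obtain i0 where i0: "i0 \<le> m" "\<phi> (S i0 j x) = X j x" by (metis (no_types, lifting) imageE atMost_iff)
    define i1 where "i1 = (LEAST i. \<phi> (S i j x) = X j x)"
    have i1: "\<phi> (S i1 j x) = X j x" "i1 \<le> m"
      unfolding i1_def using i0 by (auto intro: LeastI Least_le order_trans)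
    have "e i j x = (if i = i1 then 1 else 0)" for i
      using i1(1) not_less_Least[of _ "\<lambda>i. \<phi> (S i j x) = X j x", folded i1_def]
      unfolding e_def by (cases i i1 rule: linorder_cases) auto
    then show ?thesis using i1(2) by simp
  qed
  \<comment> \<open>A minorant of \<open>Y j (X (Suc j) - X j)\<close> with mean zero: the
    submartingale property in the form that fits \<open>running_max_pathwise\<close>.\<close>
  define Z where "Z j x = (\<Sum>i\<le>m. (Y j x * e i j x * \<psi> (S i j x)) * (S i (Suc j) x - S i j x))" for j x
  have Zint: "integrable M (\<lambda>x. (Y j x * e i j x * \<psi> (S i j x)) * (S i (Suc j) x - S i j x))" for i j
  proof -
    have "integrable M (\<lambda>x. (Y j x * e i j x)\<^sup>2)"
      by (rule Bochner_Integration.integrable_bound[OF Y2[of j]])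
         (auto simp: e_def intro!: AE_I2)
    then have "integrable M (\<lambda>x. (Y j x * e i j x) * (\<psi> (S i j x) * (S i (Suc j) x - S i j x)))"
      by (intro integrable_mult_L2 L2') auto
    then show ?thesis by (simp add: mult.assoc)
  qed
  have Z0: "(\<integral>x. Z j x \<partial>M) = 0" for j
  proof -
    note [measurable] = YF eF meas[OF order_refl]
    have "(\<integral>x. (Y j x * e i j x * \<psi> (S i j x)) * (S i (Suc j) x - S i j x) \<partial>M) = 0" for i
      by (rule null_onD[OF sub null _ Zint]) measurable
    then show ?thesis unfolding Z_def by (subst Bochner_Integration.integral_sum) (auto intro: Zint)
  qed
  have Zle: "Z j x \<le> Y j x * (X (Suc j) x - X j x)" for j x
  proof -
    have "e i j x * (\<psi> (S i j x) * (S i (Suc j) x - S i j x)) \<le> e i j x * (X (Suc j) x - X j x)"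
      if "i \<le> m" for i
      using convex[of "S i j x" "S i (Suc j) x"] Xge[OF that, of "Suc j" x]
      by (auto simp: e_def)
    then have "(\<Sum>i\<le>m. e i j x * (\<psi> (S i j x) * (S i (Suc j) x - S i j x)))
        \<le> (\<Sum>i\<le>m. e i j x * (X (Suc j) x - X j x))"
      by (intro sum_mono) auto
    also have "\<dots> = X (Suc j) x - X j x"
      by (simp add: e1 flip: sum_distrib_right)
    finally have "Y j x * (\<Sum>i\<le>m. e i j x * (\<psi> (S i j x) * (S i (Suc j) x - S i j x)))
        \<le> Y j x * (X (Suc j) x - X j x)"
      using Y0 by (rule mult_left_mono)
    then show ?thesis by (simp add: Z_def sum_distrib_left mult.assoc)
  qed
  have Zi: "integrable M (Z j)" for j
    unfolding Z_def by (intro Bochner_Integration.integrable_sum Zint)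
  have "(\<integral>x. (Y n x)\<^sup>2 \<partial>M) = (\<integral>x. (Y n x)\<^sup>2 + 4 * (\<Sum>j<n. Z j x) \<partial>M)"
    using Y2 Zi Z0 by (subst Bochner_Integration.integral_add) auto
  also have "\<dots> \<le> (\<integral>x. 4 * (X n x)\<^sup>2 \<partial>M)"
  proof (rule integral_mono)
    fix x
    have "(Y n x)\<^sup>2 + 4 * (\<Sum>j<n. Z j x) \<le> (Y n x)\<^sup>2 + 4 * (\<Sum>j<n. Y j x * (X (Suc j) x - X j x))"
      using Zle by (auto intro: sum_mono)
    also have "\<dots> \<le> 4 * (X n x)\<^sup>2"
      using running_max_pathwise[of "\<lambda>j. X j x" n] by (simp add: Y_def)
    finally show "(Y n x)\<^sup>2 + 4 * (\<Sum>j<n. Z j x) \<le> 4 * (X n x)\<^sup>2" .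
  qed (use Y2 Zi X2 in auto)
  finally show ?thesis by (simp add: X_def Y_def)
qed

text \<open>Induction on \<open>n\<close> through a pointwise bound for the fourth power of a sum.
  The term \<open>a\<^sup>3 b\<close> integrates to zero by the martingale property;
  \<open>a\<^sup>2 b\<^sup>2\<close> and \<open>a b\<^sup>3\<close> are absorbed into
  \<open>a\<^sup>4\<close> and \<open>b\<^sup>4\<close>, so only fourth moments of single
  differences enter and no conditional variances.\<close>

lemma fourth_moment_martingale:
  fixes D :: "nat \<Rightarrow> 'a \<Rightarrow> real"
  assumes "prob_space M" and sub: "\<And>i. subalgebra M (F i)"
    and meas: "\<And>i k. i < k \<Longrightarrow> D i \<in> borel_measurable (F k)"
    and null: "\<And>i. null_on M (F i) (D i)"
    and bdd: "\<And>i x. \<bar>D i x\<bar> \<le> K"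
    and d: "\<And>i. (\<integral>x. (D i x)^4 \<partial>M) \<le> d"
  shows "(\<integral>x. (\<Sum>i<n. D i x)^4 \<partial>M) \<le> 16 * (real n)\<^sup>2 * d"
proof (induction n)
  case (Suc n)
  interpret prob_space M by fact
  define T where "T n x = (\<Sum>i<n. D i x)" for n x
  have [measurable]: "D i \<in> borel_measurable M" for i
    using measurable_from_subalg[OF sub meas[of i "Suc i"]] by simp
  have TF: "T n \<in> borel_measurable (F n)" for n
    unfolding T_def by (intro borel_measurable_sum meas) auto
  have [measurable]: "T n \<in> borel_measurable M" for n
    unfolding T_def by simp
  have Tb: "\<bar>T n x\<bar> \<le> real n * K" for n x
  proof -
    have "\<bar>T n x\<bar> \<le> (\<Sum>i<n. \<bar>D i x\<bar>)" unfolding T_def by (rule sum_abs)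
    also have "\<dots> \<le> (\<Sum>i<n. K)" by (intro sum_mono bdd)
    finally show ?thesis by simp
  qed
  have pw_abs: "\<bar>y ^ k\<bar> \<le> c ^ k" if "\<bar>y\<bar> \<le> c" for y c :: real and k
    unfolding power_abs by (rule power_mono[OF that abs_ge_zero])
  have bint: "integrable M g" if "g \<in> borel_measurable M" "\<And>x. \<bar>g x\<bar> \<le> B" for g :: "'a \<Rightarrow> real" and B
    by (rule integrable_const_bound[where B=B]) (use that in auto)
  have i4: "integrable M (\<lambda>x. (T n x)^4)"
    by (rule bint[OF _ pw_abs[OF Tb]]) simp
  have i4': "integrable M (\<lambda>x. (D n x)^4)"
    by (rule bint[OF _ pw_abs[OF bdd]]) simp
  have i3: "integrable M (\<lambda>x. (T n x)^3 * D n x)"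
  proof (rule bint)
    show "\<bar>(T n x)^3 * D n x\<bar> \<le> (real n * K)^3 * K" for x
      unfolding abs_mult
      by (intro mult_mono pw_abs Tb bdd abs_ge_zero order_trans[OF abs_ge_zero pw_abs[OF Tb]])
  qed simp
  have n3: "(\<integral>x. (T n x)^3 * D n x \<partial>M) = 0"
    by (rule null_onD[OF sub null _ i3]) (use TF in simp)
  have d0: "0 \<le> d" by (rule order_trans[OF Bochner_Integration.integral_nonneg d[of 0]]) auto
  show ?case
  proof (cases "n = 0")
    case True
    then show ?thesis using d[of 0] d0 by simp
  next
    case False
    have n: "real n > 0" using False by simp
    \<comment> \<open>The weight \<open>1 + 1 / n\<close> turns \<open>16 n\<^sup>2\<close> into
      \<open>16 n\<^sup>2 + 16 n\<close>; adding \<open>16 n + 3\<close> stays below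
      \<open>16 (n + 1)\<^sup>2\<close>, which closes the induction. The step from
      \<open>n = 0\<close>, where \<open>1 / n\<close> makes no sense, is treated apart.\<close>
    have pw: "(a + b)^4 \<le> (1 + 1 / real n) * a^4 + 4 * (a^3 * b) + (16 * real n + 3) * b^4" for a b :: real
    proof -
      have "0 \<le> (a * a / sqrt n - 4 * sqrt n * (b * b))\<^sup>2" by simp
      also have "\<dots> = a^4 / n - 8 * a\<^sup>2 * b\<^sup>2 + 16 * real n * b^4"
        using n by (simp add: power2_diff power_mult_distrib power_divide power2_eq_square power4_eq_xxxx field_simps)
      finally have 1: "8 * a\<^sup>2 * b\<^sup>2 \<le> a^4 / n + 16 * real n * b^4" by simp
      have "0 \<le> 2 * (a * b - b * b)\<^sup>2" by simp
      then have 2: "4 * (a * b^3) \<le> 2 * (a\<^sup>2 * b\<^sup>2) + 2 * b^4"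
        by (simp add: power2_eq_square power3_eq_cube power4_eq_xxxx algebra_simps)
      have "(a + b)^4 = a^4 + 4 * (a^3 * b) + 6 * (a\<^sup>2 * b\<^sup>2) + 4 * (a * b^3) + b^4"
        by (simp add: power2_eq_square power3_eq_cube power4_eq_xxxx algebra_simps)
      with 1 2 show ?thesis by (simp add: algebra_simps)
    qed
    have "(\<integral>x. (T (Suc n) x)^4 \<partial>M)
      \<le> (\<integral>x. (1 + 1 / real n) * (T n x)^4 + 4 * ((T n x)^3 * D n x) + (16 * real n + 3) * (D n x)^4 \<partial>M)"
    proof (rule integral_mono)
      show "integrable M (\<lambda>x. (T (Suc n) x)^4)"
        by (rule bint[OF _ pw_abs[OF Tb]]) simp
    qed (use i4 i4' i3 pw in \<open>auto simp: T_def\<close>)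
    also have "\<dots> = (1 + 1 / real n) * (\<integral>x. (T n x)^4 \<partial>M) + (16 * real n + 3) * (\<integral>x. (D n x)^4 \<partial>M)"
      using i4 i4' i3 n3 by simp
    also have "\<dots> \<le> (1 + 1 / real n) * (16 * (real n)\<^sup>2 * d) + (16 * real n + 3) * d"
      using Suc d n d0 by (intro add_mono mult_left_mono) (auto simp: T_def)
    also have "\<dots> = (16 * (real n)\<^sup>2 + 32 * real n + 3) * d"
      using n by (simp add: field_simps power2_eq_square)
    also have "\<dots> \<le> (16 * (real (Suc n))\<^sup>2) * d"
      using d0 by (intro mult_right_mono) (auto simp: power2_eq_square algebra_simps)
    finally show ?thesis by (simp add: T_def)
  qed
qed simp

section \<open>Two-parameter fields and Cairoli's inequality\<close>

text \<open>Indices start at 0, and \<open>F i\<close>, \<open>G j\<close> are the pasts strictly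
  before row \<open>i\<close> and column \<open>j\<close>: a summand becomes visible one step later
  and is centred given the past. No condition links the two filtrations; each serves a one-parameter
  argument in which the other index is frozen.\<close>

locale orthofield = prob_space M for M :: "'a measure" +
  fixes F G :: "nat \<Rightarrow> 'a measure" and X :: "nat \<Rightarrow> nat \<Rightarrow> 'a \<Rightarrow> real"
  assumes subF: "subalgebra M (F i)" and subG: "subalgebra M (G j)"
    and XF: "i < k \<Longrightarrow> X i j \<in> borel_measurable (F k)"
    and XG: "j < k \<Longrightarrow> X i j \<in> borel_measurable (G k)"
    and nullF: "null_on M (F i) (X i j)" and nullG: "null_on M (G j) (X i j)"
    and L2: "integrable M (\<lambda>x. (X i j x)\<^sup>2)"
begin

definition S :: "nat \<Rightarrow> nat \<Rightarrow> 'a \<Rightarrow> real" where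
  "S i j x = (\<Sum>i'<i. \<Sum>j'<j. X i' j' x)"

lemma X_meas [measurable]: "X i j \<in> borel_measurable M"
  using measurable_from_subalg[OF subF XF[of i "Suc i"]] by simp

lemma S_meas [measurable]: "S i j \<in> borel_measurable M"
  unfolding S_def by measurable

lemma S_F: "i \<le> k \<Longrightarrow> S i j \<in> borel_measurable (F k)"
  unfolding S_def by (intro borel_measurable_sum XF) auto

lemma S_G: "j \<le> k \<Longrightarrow> S i j \<in> borel_measurable (G k)"
  unfolding S_def by (intro borel_measurable_sum XG) auto

lemma S_diff_F: "S (Suc i) j x - S i j x = (\<Sum>j'<j. X i j' x)"
  by (simp add: S_def)

lemma S_diff_G: "S i (Suc j) x - S i j x = (\<Sum>i'<i. X i' j x)"
  by (simp add: S_def sum.distrib)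

lemma sum_L2:
  assumes "finite I" "\<And>i. i \<in> I \<Longrightarrow> Y i \<in> borel_measurable M"
    "\<And>i. i \<in> I \<Longrightarrow> integrable M (\<lambda>x. (Y i x :: real)\<^sup>2)"
  shows "integrable M (\<lambda>x. (\<Sum>i\<in>I. Y i x)\<^sup>2)"
proof -
  have "integrable M (\<lambda>x. \<Sum>i\<in>I. \<Sum>j\<in>I. Y i x * Y j x)"
    using assms by (intro Bochner_Integration.integrable_sum integrable_mult_L2) auto
  then show ?thesis by (simp add: power2_eq_square sum_product)
qed

lemma S_L2: "integrable M (\<lambda>x. (S i j x)\<^sup>2)"
  unfolding S_def by (intro sum_L2) (auto intro!: L2 sum_L2)

lemma null_diff_F: "null_on M (F i) (\<lambda>x. S (Suc i) j x - S i j x)"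
  unfolding S_diff_F by (intro null_on_sum subF nullF)

lemma null_diff_G: "null_on M (G j) (\<lambda>x. S i (Suc j) x - S i j x)"
  unfolding S_diff_G by (intro null_on_sum subG nullG)

text \<open>Two applications of Doob's inequality: \<open>16 = 4 \<cdot> 4\<close>. The first treats
  the partial sums with second index \<open>n\<close> alone, as a family that does not depend on its
  index; the second runs over \<open>j\<close> for the maxima over \<open>i\<close>. The convex
  function stays general because both the absolute value and the square are used.\<close>

lemma doob_max_convex:
  fixes \<phi> \<psi> :: "real \<Rightarrow> real"
  assumes "\<phi> \<in> borel_measurable borel" "\<psi> \<in> borel_measurable borel"
    and "\<And>a. 0 \<le> \<phi> a" "\<And>a b. \<phi> a + \<psi> a * (b - a) \<le> \<phi> b"
    and L2: "\<And>i j. integrable M (\<lambda>x. (\<phi> (S i j x))\<^sup>2)"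
    and L2G: "\<And>i j. integrable M (\<lambda>x. (\<psi> (S i j x) * (S i (Suc j) x - S i j x))\<^sup>2)"
    and L2F: "\<And>i j. integrable M (\<lambda>x. (\<psi> (S i j x) * (S (Suc i) j x - S i j x))\<^sup>2)"
  shows "expectation (\<lambda>x. (Max ((\<lambda>j. Max ((\<lambda>i. \<phi> (S i j x)) ` {..m})) ` {..n}))\<^sup>2)
    \<le> 16 * expectation (\<lambda>x. (\<phi> (S m n x))\<^sup>2)"
proof -
  have "expectation (\<lambda>x. (Max ((\<lambda>i. \<phi> (S i n x)) ` {..m}))\<^sup>2) \<le> 4 * expectation (\<lambda>x. (\<phi> (S m n x))\<^sup>2)"
    using doob_max_family[where F=F and S="\<lambda>_ i. S i n" and m=0 and n=m, OF subF assms(1-4) _ null_diff_F L2 L2F]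
    by (simp add: S_F)
  moreover have "expectation (\<lambda>x. (Max ((\<lambda>j. Max ((\<lambda>i. \<phi> (S i j x)) ` {..m})) ` {..n}))\<^sup>2)
      \<le> 4 * expectation (\<lambda>x. (Max ((\<lambda>i. \<phi> (S i n x)) ` {..m}))\<^sup>2)"
    by (rule doob_max_family[where F=G and S=S, OF subG assms(1-4) _ null_diff_G L2 L2G]) (simp add: S_G)
  ultimately show ?thesis by linarith
qed

lemma max_S_L2:
  "expectation (\<lambda>x. (Max ((\<lambda>j. Max ((\<lambda>i. \<bar>S i j x\<bar>) ` {..m})) ` {..n}))\<^sup>2)
    \<le> 16 * expectation (\<lambda>x. (S m n x)\<^sup>2)"
proof -
  have b: "(sgn a * b)\<^sup>2 \<le> b\<^sup>2" for a b :: real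
    by (auto simp: sgn_if)
  have L2': "integrable M (\<lambda>x. (sgn (S i j x) * (S i' j' x - S i j x))\<^sup>2)" for i j i' j'
  proof (rule Bochner_Integration.integrable_bound[of _ "\<lambda>x. (S i' j' x - S i j x)\<^sup>2"])
    have "integrable M (\<lambda>x. (S i' j' x)\<^sup>2 - 2 * (S i' j' x * S i j x) + (S i j x)\<^sup>2)"
      by (intro Bochner_Integration.integrable_add Bochner_Integration.integrable_diff S_L2
         integrable_mult_right integrable_mult_L2) auto
    then show "integrable M (\<lambda>x. (S i' j' x - S i j x)\<^sup>2)"
      by (simp add: power2_diff algebra_simps)
  qed (use b in auto)
  have conv: "\<bar>a\<bar> + sgn a * (b - a) \<le> \<bar>b\<bar>" for a b :: real
    by (auto simp: sgn_if abs_if)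
  have "expectation (\<lambda>x. (Max ((\<lambda>j. Max ((\<lambda>i. \<bar>S i j x\<bar>) ` {..m})) ` {..n}))\<^sup>2)
    \<le> 16 * expectation (\<lambda>x. (\<bar>S m n x\<bar>)\<^sup>2)"
    by (rule doob_max_convex[of abs sgn, OF _ _ _ conv _ L2' L2']) (auto simp: S_L2)
  then show ?thesis by simp
qed

end

text \<open>Boundedness makes all powers of partial sums integrable, so the integrability conditions
  of \<open>doob_max_convex\<close> also hold for the square.\<close>

locale bounded_orthofield = prob_space M for M :: "'a measure" +
  fixes F G :: "nat \<Rightarrow> 'a measure" and X :: "nat \<Rightarrow> nat \<Rightarrow> 'a \<Rightarrow> real" and K :: real
  assumes subF: "subalgebra M (F i)" and subG: "subalgebra M (G j)"
    and XF: "i < k \<Longrightarrow> X i j \<in> borel_measurable (F k)"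
    and XG: "j < k \<Longrightarrow> X i j \<in> borel_measurable (G k)"
    and nullF: "null_on M (F i) (X i j)" and nullG: "null_on M (G j) (X i j)"
    and bdd: "\<bar>X i j x\<bar> \<le> K"
begin

lemma integrable_bdd:
  "g \<in> borel_measurable M \<Longrightarrow> (\<And>x. \<bar>g x\<bar> \<le> B) \<Longrightarrow> integrable M g" for g :: "'a \<Rightarrow> real"
  by (rule integrable_const_bound[where B=B]) auto

lemma pow_abs_le: "\<bar>y\<bar> \<le> c \<Longrightarrow> \<bar>y ^ k\<bar> \<le> c ^ k" for y c :: real
  unfolding power_abs by (rule power_mono[OF _ abs_ge_zero])

sublocale orthofield M F G X
proof
  have [measurable]: "X i j \<in> borel_measurable M" for i j
    using measurable_from_subalg[OF subF XF[of i "Suc i"]] by simp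
  show "integrable M (\<lambda>x. (X i j x)\<^sup>2)" for i j
    by (rule integrable_bdd[OF _ pow_abs_le[OF bdd]]) simp
qed (fact subF subG XF XG nullF nullG)+

lemma K_nonneg: "0 \<le> K"
  using bdd[of 0 0 undefined] by linarith

lemma sum_X_bound: "\<bar>\<Sum>j<n. X i j x\<bar> \<le> real n * K"
proof -
  have "\<bar>\<Sum>j<n. X i j x\<bar> \<le> (\<Sum>j<n. K)"
    by (intro order_trans[OF sum_abs] sum_mono bdd)
  then show ?thesis by simp
qed

lemma S_bound: "\<bar>S m n x\<bar> \<le> real m * (real n * K)"
proof -
  have "\<bar>S m n x\<bar> \<le> (\<Sum>i<m. real n * K)"
    unfolding S_def by (intro order_trans[OF sum_abs] sum_mono sum_X_bound)
  then show ?thesis by simp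
qed

text \<open>\<open>256 = 16 \<cdot> 16\<close>: the one-parameter bound is applied along each row
  and then to the row sums, which are martingale differences for \<open>F\<close> whose fourth
  moments the first application controls.\<close>

lemma fourth_moment_S: "expectation (\<lambda>x. (S m n x)^4) \<le> 256 * (real m * real n)\<^sup>2 * K^4"
proof -
  have row: "expectation (\<lambda>x. (\<Sum>j<n. X i j x)^4) \<le> 16 * (real n)\<^sup>2 * K^4" for i
  proof (rule fourth_moment_martingale[OF prob_space_axioms subG])
    show "expectation (\<lambda>x. (X i j x)^4) \<le> K^4" for j
    proof -
      have "expectation (\<lambda>x. (X i j x)^4) \<le> expectation (\<lambda>x. K^4)"
        by (intro integral_mono integrable_bdd[OF _ pow_abs_le[OF bdd]]
           abs_le_D1[OF pow_abs_le[OF bdd]]) auto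
      then show ?thesis by (simp add: prob_space)
    qed
  qed (auto intro: XG nullG bdd)
  have "expectation (\<lambda>x. (\<Sum>i<m. \<Sum>j<n. X i j x)^4) \<le> 16 * (real m)\<^sup>2 * (16 * (real n)\<^sup>2 * K^4)"
    by (rule fourth_moment_martingale[OF prob_space_axioms subF _ _ sum_X_bound row])
       (auto intro!: XF null_on_sum subF nullF borel_measurable_sum)
  then show ?thesis by (simp add: S_def power_mult_distrib mult.assoc)
qed

text \<open>With the square as convex function, the factor 16 falls on fourth powers:
  \<open>4096 = 16 \<cdot> 256\<close>.\<close>

lemma max_S_L4:
  "expectation (\<lambda>x. (Max ((\<lambda>j. Max ((\<lambda>i. (S i j x)\<^sup>2) ` {..m})) ` {..n}))\<^sup>2)
    \<le> 4096 * (real m * real n)\<^sup>2 * K^4"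
proof -
  have 1: "integrable M (\<lambda>x. ((S i j x)\<^sup>2)\<^sup>2)" for i j
    by (rule integrable_bdd[OF _ pow_abs_le[OF pow_abs_le[OF S_bound]]]) simp
  have 2: "integrable M (\<lambda>x. (2 * S i j x * (S i' j' x - S i j x))\<^sup>2)" for i j i' j'
  proof (rule integrable_bdd[OF _ pow_abs_le])
    show "\<bar>2 * S i j x * (S i' j' x - S i j x)\<bar>
       \<le> 2 * (real i * (real j * K)) * (real i' * (real j' * K) + real i * (real j * K))" for x
      unfolding abs_mult
      using S_bound[of i j x] S_bound[of i' j' x] K_nonneg
      by (intro mult_mono) auto
  qed simp
  have conv: "a\<^sup>2 + 2 * a * (b - a) \<le> b\<^sup>2" for a b :: real
    using zero_le_power2[of "b - a"] by (simp add: power2_eq_square algebra_simps)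
  have "expectation (\<lambda>x. (Max ((\<lambda>j. Max ((\<lambda>i. (S i j x)\<^sup>2) ` {..m})) ` {..n}))\<^sup>2)
      \<le> 16 * expectation (\<lambda>x. ((S m n x)\<^sup>2)\<^sup>2)"
    by (rule doob_max_convex[of "\<lambda>a. a\<^sup>2" "\<lambda>a. 2 * a", OF _ _ _ conv 1 2 2]) auto
  also have "\<dots> \<le> 16 * (256 * (real m * real n)\<^sup>2 * K^4)"
    using fourth_moment_S by (intro mult_left_mono) (auto simp flip: power_mult)
  finally show ?thesis by simp
qed

end

section \<open>The product space\<close>

definition dep :: "(int \<times> int) set \<Rightarrow> (config \<Rightarrow> 'b) \<Rightarrow> bool" where
  "dep J h \<longleftrightarrow> (\<forall>\<omega> \<omega>'. (\<forall>k\<in>J. \<omega> k = \<omega>' k) \<longrightarrow> h \<omega> = h \<omega>')"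

text \<open>Two configurations glued along \<open>B\<close>. With independent arguments this
  resamples the coordinates outside \<open>B\<close>.\<close>

definition mrg :: "(int \<times> int) set \<Rightarrow> config \<Rightarrow> config \<Rightarrow> config" where
  "mrg B \<omega> \<omega>' = (\<lambda>k. if k \<in> B then \<omega> k else \<omega>' k)"

lemma dep_mono: "dep J h \<Longrightarrow> J \<subseteq> K \<Longrightarrow> dep K h"
  unfolding dep_def by blast

lemma depD: "dep J h \<Longrightarrow> (\<And>k. k \<in> J \<Longrightarrow> \<omega> k = \<omega>' k) \<Longrightarrow> h \<omega> = h \<omega>'"
  unfolding dep_def by blast

lemma dep_comp2: "dep J g \<Longrightarrow> dep J h \<Longrightarrow> dep J (\<lambda>\<omega>. F (g \<omega>) (h \<omega>))"
  unfolding dep_def by metis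

lemma space_coord_sigma [simp]: "space (coord_sigma I) = UNIV"
  by (simp add: coord_sigma_def space_measure_of_conv)

lemma sets_coord_sigma:
  "sets (coord_sigma I) = sigma_sets UNIV (\<Union>(i, j)\<in>I. {coord i j -` A | A. A \<in> sets borel})"
  by (simp add: coord_sigma_def sets_measure_of_conv)

lemma measurable_coord_sigma:
  assumes "k \<in> I"
  shows "(\<lambda>\<omega>. \<omega> k) \<in> borel_measurable (coord_sigma I)"
proof (rule measurableI)
  fix A :: "real set" assume "A \<in> sets borel"
  then show "(\<lambda>\<omega>. \<omega> k) -` A \<inter> space (coord_sigma I) \<in> sets (coord_sigma I)"
    unfolding sets_coord_sigma
    by (intro sigma_sets.Basic UN_I[OF assms]) (cases k, force simp: coord_def vimage_def)
qed auto

lemma dep_coord_sigma_set: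
  assumes "A \<in> sets (coord_sigma I)" "\<And>k. k \<in> I \<Longrightarrow> \<omega> k = \<omega>' k"
  shows "\<omega> \<in> A \<longleftrightarrow> \<omega>' \<in> A"
  using assms(1)[unfolded sets_coord_sigma]
proof (induction rule: sigma_sets.induct)
  case (Basic a)
  then show ?case using assms(2) by (auto simp: coord_def)
qed auto

lemma dep_coord_sigma:
  fixes h :: "config \<Rightarrow> 'b :: t1_space"
  assumes "h \<in> borel_measurable (coord_sigma I)"
  shows "dep I h"
  unfolding dep_def
proof safe
  fix \<omega> \<omega>' :: config assume eq: "\<forall>k\<in>I. \<omega> k = \<omega>' k"
  have "h -` {h \<omega>} \<inter> space (coord_sigma I) \<in> sets (coord_sigma I)"
    using assms by (rule measurable_sets) simp
  from dep_coord_sigma_set[OF this, of \<omega> \<omega>'] eq show "h \<omega> = h \<omega>'" by auto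
qed

lemma measurable_coord_sigma_comp:
  assumes "\<And>k. k \<in> J \<Longrightarrow> k + s \<in> I"
  shows "(\<lambda>\<omega>. \<lambda>k. if k \<in> J then \<omega> (k + s) else c k) \<in> measurable (coord_sigma I) (Pi\<^sub>M UNIV (\<lambda>_. borel))"
proof (rule measurable_PiM_single')
  fix k
  show "(\<lambda>\<omega>. if k \<in> J then \<omega> (k + s) else c k) \<in> borel_measurable (coord_sigma I)"
    using measurable_coord_sigma[OF assms[of k]] by (cases "k \<in> J") auto
qed auto

lemma subset_coord_sigma:
  assumes "I \<subseteq> J"
  shows "sets (coord_sigma I) \<subseteq> sets (coord_sigma J)"
  unfolding sets_coord_sigma using assms by (intro sigma_sets_mono') (auto split: prod.splits)

lemma sigma_sets_Union_coord_sigma: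
  assumes "(\<Union>a\<in>A. J a) = I"
  shows "sigma_sets UNIV (\<Union>a\<in>A. sets (coord_sigma (J a))) = sets (coord_sigma I)"
proof (rule antisym)
  have "(\<Union>a\<in>A. sets (coord_sigma (J a))) \<subseteq> sets (coord_sigma I)"
    by (intro UN_least subset_coord_sigma) (use assms in blast)
  then show "sigma_sets UNIV (\<Union>a\<in>A. sets (coord_sigma (J a))) \<subseteq> sets (coord_sigma I)"
    using sets.sigma_sets_subset[of _ "coord_sigma I"] by simp
  have "{coord i j -` B | B. B \<in> sets borel} \<subseteq> (\<Union>a\<in>A. sets (coord_sigma (J a)))" if "(i, j) \<in> I" for i j
  proof -
    from that assms obtain a where "a \<in> A" "(i, j) \<in> J a" by auto
    then show ?thesis
      unfolding sets_coord_sigma by (auto intro!: bexI[of _ a] sigma_sets.Basic)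
  qed
  then show "sets (coord_sigma I) \<subseteq> sigma_sets UNIV (\<Union>a\<in>A. sets (coord_sigma (J a)))"
    unfolding sets_coord_sigma[of I] by (intro sigma_sets_mono' UN_least) (simp split: prod.split, blast)
qed

lemma sets_filt_row: "sets (filt_row i) = sets (coord_sigma {(a, b). a \<le> i})"
proof -
  \<comment> \<open>The join runs over \<open>j \<ge> 0\<close> only; since \<open>filt i j\<close>
    grows with \<open>j\<close>, a coordinate with negative second index is already caught at
    \<open>j = 0\<close>.\<close>
  have "(a, b) \<in> (\<Union>j\<in>{0..}. {(a, b). a \<le> i \<and> b \<le> j}) \<longleftrightarrow> a \<le> i" for a b :: int
    by (auto intro!: bexI[of _ "max 0 b"])
  then have "(\<Union>j\<in>{0..}. {(a, b). a \<le> i \<and> b \<le> j}) = {(a, b :: int). a \<le> i}"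
    by blast
  from sigma_sets_Union_coord_sigma[OF this] show ?thesis
    by (simp add: filt_row_def filt_def sets_measure_of_conv)
qed

lemma sets_filt_col: "sets (filt_col j) = sets (coord_sigma {(a, b). b \<le> j})"
proof -
  have "(a, b) \<in> (\<Union>i\<in>{0..}. {(a, b). a \<le> i \<and> b \<le> j}) \<longleftrightarrow> b \<le> j" for a b :: int
    by (auto intro!: bexI[of _ "max 0 a"])
  then have "(\<Union>i\<in>{0..}. {(a, b). a \<le> i \<and> b \<le> j}) = {(a :: int, b). b \<le> j}"
    by blast
  from sigma_sets_Union_coord_sigma[OF this] show ?thesis
    by (simp add: filt_col_def filt_def sets_measure_of_conv)
qed

section \<open>Shifts and resampling of the i.i.d. field\<close>

locale iid_field =
  fixes P :: "real measure"
  assumes prob_P: "prob_space P" and sets_P: "sets P = sets borel"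
begin

abbreviation "\<Omega> \<equiv> prodspace P"

lemma space_P: "space P = UNIV"
  using sets_eq_imp_space_eq[OF sets_P] by simp

lemma space_Omega [simp]: "space \<Omega> = UNIV"
  by (simp add: prodspace_def space_PiM space_P)

lemma sets_Omega: "sets \<Omega> = sets (Pi\<^sub>M UNIV (\<lambda>_. borel))"
  unfolding prodspace_def by (intro sets_PiM_cong) (auto simp: sets_P)

sublocale prob_space \<Omega>
  unfolding prodspace_def by (rule prob_space_PiM) (rule prob_P)

lemma prob_UNIV [simp]: "measure \<Omega> UNIV = 1"
  using prob_space by simp

lemma coord_measurable [measurable]: "(\<lambda>\<omega>. \<omega> k) \<in> borel_measurable \<Omega>"
  unfolding measurable_cong_sets[OF sets_Omega refl] by measurable

lemma measurable_OmegaI: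
  assumes "\<And>k. (\<lambda>x. f x k) \<in> borel_measurable M"
  shows "f \<in> measurable M \<Omega>"
  unfolding measurable_cong_sets[OF refl sets_Omega]
  using assms by (intro measurable_PiM_single') auto

lemma subalgebra_coord_sigma: "subalgebra \<Omega> (coord_sigma I)"
proof -
  have "(\<Union>(i, j)\<in>I. {coord i j -` A | A. A \<in> sets borel}) \<subseteq> sets \<Omega>"
    using measurable_sets[OF coord_measurable]
    by (fastforce simp: coord_def[abs_def])
  from sets.sigma_sets_subset[OF this] show ?thesis
    by (simp add: subalgebra_def sets_coord_sigma)
qed

text \<open>A function of the coordinates in \<open>J\<close> equals its composition with the map
  that resets all other coordinates to 0, and that map is measurable for
  \<open>coord_sigma J\<close>. Measurability for a coordinate sigma-field thus splits into plain
  measurability and a pointwise condition.\<close>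

lemma coord_sigma_measurable_iff:
  fixes h :: "config \<Rightarrow> 'b :: t1_space"
  shows "h \<in> borel_measurable (coord_sigma J) \<longleftrightarrow> h \<in> borel_measurable \<Omega> \<and> dep J h"
proof safe
  assume "h \<in> borel_measurable (coord_sigma J)"
  then show "h \<in> borel_measurable \<Omega>" "dep J h"
    by (auto intro: measurable_from_subalg[OF subalgebra_coord_sigma] dep_coord_sigma)
next
  assume h: "h \<in> borel_measurable \<Omega>" "dep J h"
  have "(\<lambda>\<omega>. \<lambda>k. if k \<in> J then \<omega> (k + 0) else 0) \<in> measurable (coord_sigma J) \<Omega>"
    unfolding measurable_cong_sets[OF refl sets_Omega] by (rule measurable_coord_sigma_comp) simp
  from measurable_compose[OF this h(1)]
  have "(\<lambda>\<omega>. h (\<lambda>k. if k \<in> J then \<omega> (k + 0) else 0)) \<in> borel_measurable (coord_sigma J)" .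
  also have "(\<lambda>\<omega>. h (\<lambda>k. if k \<in> J then \<omega> (k + 0) else 0)) = h"
    by (intro ext depD[OF h(2)]) simp
  finally show "h \<in> borel_measurable (coord_sigma J)" .
qed

lemma mrg_measurable [measurable]:
  "(\<lambda>(\<omega>, \<omega>'). mrg B \<omega> \<omega>') \<in> measurable (\<Omega> \<Otimes>\<^sub>M \<Omega>) \<Omega>"
proof (rule measurable_OmegaI)
  fix k
  show "(\<lambda>x. (case x of (\<omega>, \<omega>') \<Rightarrow> mrg B \<omega> \<omega>') k) \<in> borel_measurable (\<Omega> \<Otimes>\<^sub>M \<Omega>)"
    by (cases "k \<in> B") (auto simp: mrg_def split_beta)
qed

lemma shift_measurable [measurable]: "shift k l \<in> measurable \<Omega> \<Omega>"
  by (rule measurable_OmegaI) (auto simp: shift_def split: prod.splits)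

lemma cyl_sets:
  assumes "finite J" "\<And>j. j \<in> J \<Longrightarrow> A j \<in> sets P"
  shows "{\<omega>. \<forall>j\<in>J. \<omega> j \<in> A j} \<in> sets \<Omega>"
proof -
  have "prod_emb UNIV (\<lambda>_. P) J (Pi\<^sub>E J A) = {\<omega>. \<forall>j\<in>J. \<omega> j \<in> A j}"
    by (auto simp: prod_emb_def space_P PiE_iff)
  then show ?thesis
    using sets_PiM_I[of J UNIV A "\<lambda>_. P"] assms by (simp add: prodspace_def)
qed

lemma emeasure_cyl:
  assumes "finite J" "\<And>j. j \<in> J \<Longrightarrow> A j \<in> sets P"
  shows "emeasure \<Omega> {\<omega>. \<forall>j\<in>J. \<omega> j \<in> A j} = (\<Prod>j\<in>J. emeasure P (A j))"
proof -
  have "prod_emb UNIV (\<lambda>_. P) J (Pi\<^sub>E J A) = {\<omega>. \<forall>j\<in>J. \<omega> j \<in> A j}"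
    by (auto simp: prod_emb_def space_P PiE_iff)
  then show ?thesis
    using emeasure_PiM_emb[of UNIV "\<lambda>_. P" J A] assms prob_P by (simp add: prodspace_def)
qed

text \<open>The source of all independence statements below: two independent copies glued along
  \<open>B\<close> form a copy again. The laws are compared on cylinders, where the product over
  \<open>J\<close> splits into \<open>J \<inter> B\<close> and \<open>J - B\<close>.\<close>

lemma distr_mrg: "distr (\<Omega> \<Otimes>\<^sub>M \<Omega>) \<Omega> (\<lambda>(\<omega>, \<omega>'). mrg B \<omega> \<omega>') = \<Omega>" (is "?D = _")
proof -
  interpret pair: pair_prob_space \<Omega> \<Omega> ..
  interpret PP: product_prob_space "\<lambda>_ :: int \<times> int. P" UNIV
    by (intro product_prob_space.intro product_sigma_finite.intro product_prob_space_axioms.intro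
      prob_space_imp_sigma_finite prob_P)
  have "?D = Pi\<^sub>M UNIV (\<lambda>_. P)"
  proof (rule PP.PiM_eq)
    fix J :: "(int \<times> int) set" and A assume J: "finite J" "\<And>j. j \<in> J \<Longrightarrow> A j \<in> sets P"
    have m: "{\<omega>. \<forall>j\<in>K. \<omega> j \<in> A j} \<in> sets \<Omega>" if "K \<subseteq> J" for K
      by (rule cyl_sets[OF finite_subset[OF that J(1)] J(2)[OF subsetD[OF that]]])
    have e: "emeasure \<Omega> {\<omega>. \<forall>j\<in>K. \<omega> j \<in> A j} = (\<Prod>j\<in>K. emeasure P (A j))" if "K \<subseteq> J" for K
      by (rule emeasure_cyl[OF finite_subset[OF that J(1)] J(2)[OF subsetD[OF that]]])
    have "prod_emb UNIV (\<lambda>_. P) J (Pi\<^sub>E J A) = {\<omega>. \<forall>j\<in>J. \<omega> j \<in> A j}"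
      by (auto simp: prod_emb_def space_P PiE_iff)
    then have "emeasure ?D (prod_emb UNIV (\<lambda>_. P) J (Pi\<^sub>E J A)) = emeasure ?D {\<omega>. \<forall>j\<in>J. \<omega> j \<in> A j}"
      by simp
    also have "\<dots> = emeasure (\<Omega> \<Otimes>\<^sub>M \<Omega>) ((\<lambda>(\<omega>, \<omega>'). mrg B \<omega> \<omega>') -` {\<omega>. \<forall>j\<in>J. \<omega> j \<in> A j} \<inter> space (\<Omega> \<Otimes>\<^sub>M \<Omega>))"
      by (rule emeasure_distr[OF mrg_measurable m]) simp
    also have "(\<lambda>(\<omega>, \<omega>'). mrg B \<omega> \<omega>') -` {\<omega>. \<forall>j\<in>J. \<omega> j \<in> A j} \<inter> space (\<Omega> \<Otimes>\<^sub>M \<Omega>)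
       = {\<omega>. \<forall>j\<in>J \<inter> B. \<omega> j \<in> A j} \<times> {\<omega>. \<forall>j\<in>J - B. \<omega> j \<in> A j}"
      by (auto simp: mrg_def space_pair_measure)
    also have "emeasure (\<Omega> \<Otimes>\<^sub>M \<Omega>) \<dots> = (\<Prod>j\<in>J \<inter> B. emeasure P (A j)) * (\<Prod>j\<in>J - B. emeasure P (A j))"
      using m[of "J \<inter> B"] m[of "J - B"] e[of "J \<inter> B"] e[of "J - B"]
      by (subst emeasure_pair_measure_Times) auto
    also have "\<dots> = (\<Prod>j\<in>J. emeasure P (A j))"
      by (rule prod.Int_Diff[OF J(1), symmetric])
    finally show "emeasure ?D (prod_emb UNIV (\<lambda>_. P) J (Pi\<^sub>E J A)) = (\<Prod>j\<in>J. emeasure P (A j))" .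
  qed (simp add: prodspace_def)
  then show ?thesis by (simp add: prodspace_def)
qed

lemma distr_shift: "distr \<Omega> \<Omega> (shift k l) = \<Omega>"
proof -
  have "shift k l = (\<lambda>\<omega>. \<lambda>n\<in>UNIV. \<omega> ((\<lambda>(i, j). (i + k, j + l)) n))"
    by (auto simp: shift_def fun_eq_iff)
  moreover have "distr (Pi\<^sub>M UNIV (\<lambda>_. P)) (Pi\<^sub>M UNIV (\<lambda>_. P)) (\<lambda>\<omega>. \<lambda>n\<in>UNIV. \<omega> ((\<lambda>(i, j). (i + k, j + l)) n))
     = Pi\<^sub>M UNIV (\<lambda>_. P)"
    by (rule distr_PiM_reindex[of UNIV "\<lambda>_. P" "\<lambda>(i, j). (i + k, j + l)" UNIV]) (auto simp: inj_on_def prob_P)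
  ultimately show ?thesis by (simp add: prodspace_def)
qed

lemma integral_shift:
  fixes g :: "config \<Rightarrow> 'b :: {banach, second_countable_topology}"
  assumes "g \<in> borel_measurable \<Omega>"
  shows "(\<integral>\<omega>. g (shift k l \<omega>) \<partial>\<Omega>) = (\<integral>\<omega>. g \<omega> \<partial>\<Omega>)"
  using integral_distr[OF shift_measurable assms] by (simp add: distr_shift)

lemma integrable_shift:
  fixes g :: "config \<Rightarrow> 'b :: {banach, second_countable_topology}"
  assumes "integrable \<Omega> g"
  shows "integrable \<Omega> (\<lambda>\<omega>. g (shift k l \<omega>))"
  using integrable_distr[OF shift_measurable] assms by (simp add: distr_shift)

lemma shift_shift: "shift a b (shift k l \<omega>) = shift (a + k) (b + l) \<omega>"
  by (auto simp: shift_def algebra_simps)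

lemma shift_0: "shift 0 0 \<omega> = \<omega>"
  by (auto simp: shift_def)

lemma integral_mrg:
  fixes g :: "config \<Rightarrow> 'b :: {banach, second_countable_topology}"
  assumes "integrable \<Omega> g"
  shows "(\<integral>\<omega>. g \<omega> \<partial>\<Omega>) = (\<integral>\<omega>. (\<integral>\<omega>'. g (mrg B \<omega> \<omega>') \<partial>\<Omega>) \<partial>\<Omega>)"
proof -
  interpret pair: pair_prob_space \<Omega> \<Omega> ..
  have [measurable]: "g \<in> borel_measurable \<Omega>" using assms by auto
  have "integrable (\<Omega> \<Otimes>\<^sub>M \<Omega>) (\<lambda>x. g (case x of (\<omega>, \<omega>') \<Rightarrow> mrg B \<omega> \<omega>'))"
    by (subst integrable_distr_eq[OF mrg_measurable, symmetric]) (simp_all add: distr_mrg assms)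
  then have "integrable (\<Omega> \<Otimes>\<^sub>M \<Omega>) (\<lambda>(\<omega>, \<omega>'). g (mrg B \<omega> \<omega>'))"
    by (simp add: case_prod_unfold)
  from pair.integral_fst'[OF this]
  have "(\<integral>\<omega>. (\<integral>\<omega>'. g (mrg B \<omega> \<omega>') \<partial>\<Omega>) \<partial>\<Omega>) = (\<integral>x. g (case x of (\<omega>, \<omega>') \<Rightarrow> mrg B \<omega> \<omega>') \<partial>(\<Omega> \<Otimes>\<^sub>M \<Omega>))"
    by (simp add: case_prod_unfold)
  also have "\<dots> = (\<integral>\<omega>. g \<omega> \<partial>\<Omega>)"
    using integral_distr[OF mrg_measurable, of g B] by (simp add: distr_mrg)
  finally show ?thesis by simp
qed

text \<open>After gluing along \<open>J\<close>, \<open>g\<close> sees only the first copy and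
  \<open>h\<close> only the second.\<close>

lemma integral_mult_indep:
  fixes g h :: "config \<Rightarrow> 'b :: {real_normed_field, banach, second_countable_topology}"
  assumes "integrable \<Omega> (\<lambda>\<omega>. g \<omega> * h \<omega>)" "dep J g" "dep K h" "J \<inter> K = {}"
  shows "(\<integral>\<omega>. g \<omega> * h \<omega> \<partial>\<Omega>) = (\<integral>\<omega>. g \<omega> \<partial>\<Omega>) * (\<integral>\<omega>. h \<omega> \<partial>\<Omega>)"
proof -
  have "g (mrg J \<omega> \<omega>') = g \<omega>" for \<omega> \<omega>'
    by (rule depD[OF assms(2)]) (simp add: mrg_def)
  moreover have "h (mrg J \<omega> \<omega>') = h \<omega>'" for \<omega> \<omega>'
    by (rule depD[OF assms(3)]) (use assms(4) in \<open>auto simp: mrg_def\<close>)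
  ultimately show ?thesis
    by (simp add: integral_mrg[OF assms(1), of J])
qed

section \<open>Conditional expectations on coordinate sets\<close>

text \<open>For bounded measurable \<open>h\<close> this is an explicit version of the conditional
  expectation given \<open>coord_sigma B\<close>, obtained by integrating out the coordinates
  outside \<open>B\<close>. It is defined at every configuration, so its identities and its
  dependence on coordinates hold pointwise.\<close>

definition cexp :: "(int \<times> int) set \<Rightarrow> (config \<Rightarrow> real) \<Rightarrow> config \<Rightarrow> real" where
  "cexp B h \<omega> = (\<integral>\<omega>'. h (mrg B \<omega> \<omega>') \<partial>\<Omega>)"

definition bdd_meas :: "real \<Rightarrow> (config \<Rightarrow> real) \<Rightarrow> bool" where
  "bdd_meas K h \<longleftrightarrow> h \<in> borel_measurable \<Omega> \<and> (\<forall>\<omega>. \<bar>h \<omega>\<bar> \<le> K)"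

lemma mrg_measurable1 [measurable]: "mrg B \<omega> \<in> measurable \<Omega> \<Omega>"
  using measurable_Pair2[OF mrg_measurable, of \<omega> B] by simp

lemma bdd_meas_add: "bdd_meas K g \<Longrightarrow> bdd_meas L h \<Longrightarrow> bdd_meas (K + L) (\<lambda>\<omega>. g \<omega> + h \<omega>)"
  unfolding bdd_meas_def by (auto intro!: order_trans[OF abs_triangle_ineq] add_mono)

lemma bdd_meas_diff: "bdd_meas K g \<Longrightarrow> bdd_meas L h \<Longrightarrow> bdd_meas (K + L) (\<lambda>\<omega>. g \<omega> - h \<omega>)"
  unfolding bdd_meas_def by (auto intro!: order_trans[OF abs_triangle_ineq4] add_mono)

lemma bdd_meas_integrable: "bdd_meas K h \<Longrightarrow> integrable \<Omega> h"
  by (rule integrable_const_bound[where B=K]) (auto simp: bdd_meas_def)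

lemma bdd_meas_mrg: "bdd_meas K h \<Longrightarrow> bdd_meas K (\<lambda>\<omega>'. h (mrg B \<omega> \<omega>'))"
  by (auto simp: bdd_meas_def)

lemma cexp_bdd_meas:
  assumes "bdd_meas K h"
  shows "bdd_meas K (cexp B h)"
proof -
  have [measurable]: "h \<in> borel_measurable \<Omega>" using assms by (auto simp: bdd_meas_def)
  have "(\<lambda>\<omega>. \<integral>\<omega>'. (\<lambda>(\<omega>, \<omega>'). h (mrg B \<omega> \<omega>')) (\<omega>, \<omega>') \<partial>\<Omega>) \<in> borel_measurable \<Omega>"
  proof (rule borel_measurable_lebesgue_integral)
    have "(\<lambda>x. h (case x of (\<omega>, \<omega>') \<Rightarrow> mrg B \<omega> \<omega>')) \<in> borel_measurable (\<Omega> \<Otimes>\<^sub>M \<Omega>)"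
      by measurable
    then show "(\<lambda>(x, y). (case (x, y) of (\<omega>, \<omega>') \<Rightarrow> h (mrg B \<omega> \<omega>'))) \<in> borel_measurable (\<Omega> \<Otimes>\<^sub>M \<Omega>)"
      by (simp add: split_beta)
  qed
  moreover have "\<bar>cexp B h \<omega>\<bar> \<le> K" for \<omega>
  proof -
    have "\<bar>cexp B h \<omega>\<bar> \<le> (\<integral>\<omega>'. \<bar>h (mrg B \<omega> \<omega>')\<bar> \<partial>\<Omega>)"
      unfolding cexp_def by (rule integral_abs_bound)
    also have "\<dots> \<le> (\<integral>\<omega>'. K \<partial>\<Omega>)"
      using bdd_meas_integrable[OF bdd_meas_mrg[OF assms]] assms
      by (intro integral_mono) (auto simp: bdd_meas_def)
    finally show ?thesis by simp
  qed
  ultimately show ?thesis by (simp add: bdd_meas_def cexp_def[abs_def])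
qed

lemma cexp_dep:
  assumes "dep J h"
  shows "dep (J \<inter> B) (cexp B h)"
  unfolding dep_def
proof safe
  fix \<omega>1 \<omega>2 :: config assume eq: "\<forall>k\<in>J \<inter> B. \<omega>1 k = \<omega>2 k"
  have "h (mrg B \<omega>1 \<omega>') = h (mrg B \<omega>2 \<omega>')" for \<omega>'
    by (rule depD[OF assms]) (use eq in \<open>auto simp: mrg_def\<close>)
  then show "cexp B h \<omega>1 = cexp B h \<omega>2" by (simp add: cexp_def)
qed

lemma mrg_mrg: "mrg B (mrg A \<omega> \<omega>') \<omega>'' = mrg (A \<inter> B) \<omega> (mrg B \<omega>' \<omega>'')"
  by (auto simp: mrg_def fun_eq_iff)

text \<open>By \<open>mrg_mrg\<close> the two fresh copies occur only glued to each other, and that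
  is one fresh copy. Hence conditional expectations on coordinate sets commute. Sigma-fields in
  general lack this property, and it is what makes centring in both directions at once
  possible.\<close>

lemma cexp_cexp:
  assumes "bdd_meas K h"
  shows "cexp A (cexp B h) = cexp (A \<inter> B) h"
  unfolding cexp_def mrg_mrg
  by (intro ext integral_mrg[OF bdd_meas_integrable[OF bdd_meas_mrg[OF assms]], symmetric])

lemma cexp_diff:
  assumes "bdd_meas K g" "bdd_meas L h"
  shows "cexp A (\<lambda>\<omega>. g \<omega> - h \<omega>) = (\<lambda>\<omega>. cexp A g \<omega> - cexp A h \<omega>)"
  unfolding cexp_def using bdd_meas_integrable[OF bdd_meas_mrg] assms by auto

lemma integral_mult_cexp:
  assumes "dep B k" "integrable \<Omega> (\<lambda>\<omega>. k \<omega> * h \<omega>)"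
  shows "(\<integral>\<omega>. k \<omega> * h \<omega> \<partial>\<Omega>) = (\<integral>\<omega>. k \<omega> * cexp B h \<omega> \<partial>\<Omega>)"
proof -
  have "k (mrg B \<omega> \<omega>') = k \<omega>" for \<omega> \<omega>'
    by (rule depD[OF assms(1)]) (simp add: mrg_def)
  then show ?thesis
    by (simp add: integral_mrg[OF assms(2), of B] cexp_def)
qed

lemma null_on_cexp_0:
  assumes "bdd_meas K h" "\<And>\<omega>. cexp B h \<omega> = 0"
  shows "null_on \<Omega> (coord_sigma B) h"
  unfolding null_on_def
proof (intro conjI ballI impI)
  show "integrable \<Omega> h" by (rule bdd_meas_integrable) fact
  fix k :: "config \<Rightarrow> real" assume k: "k \<in> borel_measurable (coord_sigma B)" "bounded (range k)"
  then have "integrable \<Omega> (\<lambda>\<omega>. k \<omega> * h \<omega>)"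
    by (intro integrable_mult_bounded bdd_meas_integrable[OF assms(1)])
       (auto simp: coord_sigma_measurable_iff)
  with k show "(\<integral>\<omega>. k \<omega> * h \<omega> \<partial>\<Omega>) = 0"
    by (subst integral_mult_cexp[of B]) (auto simp: coord_sigma_measurable_iff assms(2))
qed

lemma dep_shift:
  assumes "dep J h" "\<And>i j. (i, j) \<in> J \<Longrightarrow> (i + k, j + l) \<in> I"
  shows "dep I (\<lambda>\<omega>. h (shift k l \<omega>))"
  unfolding dep_def using assms(2) by (auto intro!: depD[OF assms(1)] simp: shift_def)

lemma null_on_shift:
  assumes null: "null_on \<Omega> (coord_sigma J) D"
    and I: "\<And>i j. (i, j) \<in> I \<Longrightarrow> (i - k, j - l) \<in> J"
  shows "null_on \<Omega> (coord_sigma I) (\<lambda>\<omega>. D (shift k l \<omega>))"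
  unfolding null_on_def
proof (intro conjI ballI impI)
  have D: "integrable \<Omega> D" using null by (simp add: null_on_def)
  then show "integrable \<Omega> (\<lambda>\<omega>. D (shift k l \<omega>))" by (rule integrable_shift)
  fix h :: "config \<Rightarrow> real" assume h: "h \<in> borel_measurable (coord_sigma I)" "bounded (range h)"
  define h' where "h' \<omega> = h (shift (-k) (-l) \<omega>)" for \<omega>
  have hM [measurable]: "h \<in> borel_measurable \<Omega>" and "dep I h"
    using h by (auto simp: coord_sigma_measurable_iff)
  have "dep J h'"
    unfolding h'_def using I by (intro dep_shift[OF \<open>dep I h\<close>]) auto
  moreover have "h' \<in> borel_measurable \<Omega>" unfolding h'_def by measurable
  moreover have "bounded (range h')" unfolding h'_def using h(2) by (rule bounded_subset) auto
  ultimately have "(\<integral>\<omega>. h' \<omega> * D \<omega> \<partial>\<Omega>) = 0"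
    using null by (auto simp: null_on_def coord_sigma_measurable_iff)
  also have "(\<integral>\<omega>. h' \<omega> * D \<omega> \<partial>\<Omega>) = (\<integral>\<omega>. h' (shift k l \<omega>) * D (shift k l \<omega>) \<partial>\<Omega>)"
    using D \<open>h' \<in> borel_measurable \<Omega>\<close> by (intro integral_shift[symmetric]) auto
  also have "\<dots> = (\<integral>\<omega>. h \<omega> * D (shift k l \<omega>) \<partial>\<Omega>)"
    by (simp add: h'_def shift_shift shift_0)
  finally show "(\<integral>\<omega>. h \<omega> * D (shift k l \<omega>) \<partial>\<Omega>) = 0" .
qed

section \<open>The hypotheses on \<open>f\<close> in tested form\<close>

lemma L0_2D:
  assumes "f \<in> L0 P 2"
  shows "f \<in> borel_measurable \<Omega>" "integrable \<Omega> (\<lambda>\<omega>. (f \<omega>)\<^sup>2)" "integrable \<Omega> f"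
proof -
  show [measurable]: "f \<in> borel_measurable \<Omega>"
    using assms coord_sigma_measurable_iff[of f UNIV] by (simp add: L0_def filt_all_def)
  have "\<bar>f \<omega>\<bar> powr 2 = (f \<omega>)\<^sup>2" for \<omega>
    by (simp add: powr_numeral)
  then show f2: "integrable \<Omega> (\<lambda>\<omega>. (f \<omega>)\<^sup>2)"
    using assms by (simp add: L0_def)
  then show "integrable \<Omega> f"
    using integrable_mult_L2[of "\<lambda>_. 1" \<Omega> f] by simp
qed

lemma null_on_of_real_cond_exp:
  assumes "sets F = sets (coord_sigma J)" "space F = UNIV" "integrable \<Omega> D"
    and zero: "AE \<omega> in \<Omega>. real_cond_exp \<Omega> F D \<omega> = 0"
  shows "null_on \<Omega> (coord_sigma J) D"
  unfolding null_on_def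
proof (intro conjI ballI impI assms)
  have sub: "subalgebra \<Omega> F"
    using subalgebra_coord_sigma[of J] assms by (simp add: subalgebra_def)
  then interpret S: finite_measure_subalgebra \<Omega> F
    by unfold_locales
  fix h :: "config \<Rightarrow> real" assume h: "h \<in> borel_measurable (coord_sigma J)" "bounded (range h)"
  have hF [measurable]: "h \<in> borel_measurable F"
    using h(1) by (simp cong: measurable_cong_sets add: assms(1))
  have hM: "h \<in> borel_measurable \<Omega>"
    using h(1) by (simp add: coord_sigma_measurable_iff)
  have "(\<integral>\<omega>. h \<omega> * D \<omega> \<partial>\<Omega>) = (\<integral>\<omega>. h \<omega> * real_cond_exp \<Omega> F D \<omega> \<partial>\<Omega>)"
    using assms(3) hM h by (intro S.real_cond_exp_intg(2)[symmetric] integrable_mult_bounded hF) auto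
  also have "\<dots> = (\<integral>\<omega>. 0 \<partial>\<Omega>)"
    using zero by (intro integral_cong_AE) (use hM in auto)
  finally show "(\<integral>\<omega>. h \<omega> * D \<omega> \<partial>\<Omega>) = 0" by simp
qed

lemma orthomartingale_null_on:
  assumes f: "f \<in> L0 P 2" and "orthomartingale_differences P f"
  shows "null_on \<Omega> (coord_sigma {(a, b). a \<le> -1}) f"
    and "null_on \<Omega> (coord_sigma {(a, b). b \<le> -1}) f"
proof -
  note F = L0_2D[OF f]
  have i: "integrable \<Omega> (f \<circ> shift k l)" for k l
    using integrable_shift[OF F(3), of k l] by (simp add: comp_def)
  \<comment> \<open>The hypothesis at \<open>i = j = 1\<close>. Shifting back by
    \<open>(2, 1)\<close> turns the past \<open>a \<le> 1\<close> into \<open>a \<le> -1\<close>,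
    the strict past of the origin; likewise in the other direction.\<close>
  have AE: "AE \<omega> in \<Omega>. real_cond_exp \<Omega> (filt_row 1) (f \<circ> shift 2 1) \<omega> = 0"
     "AE \<omega> in \<Omega>. real_cond_exp \<Omega> (filt_col 1) (f \<circ> shift 1 2) \<omega> = 0"
    using assms(2) unfolding orthomartingale_differences_def by force+
  have sp: "space (filt_row i) = UNIV" "space (filt_col i) = UNIV" for i
    by (simp_all add: filt_row_def filt_col_def space_measure_of_conv)
  have "null_on \<Omega> (coord_sigma {(a, b). a \<le> 1}) (f \<circ> shift 2 1)"
    by (rule null_on_of_real_cond_exp[OF sets_filt_row sp(1) i AE(1)])
  then have "null_on \<Omega> (coord_sigma {(a, b). a \<le> -1}) (\<lambda>\<omega>. (f \<circ> shift 2 1) (shift (-2) (-1) \<omega>))"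
    by (rule null_on_shift) auto
  then show "null_on \<Omega> (coord_sigma {(a, b). a \<le> -1}) f"
    by (simp add: shift_shift shift_0)
  have "null_on \<Omega> (coord_sigma {(a, b). b \<le> 1}) (f \<circ> shift 1 2)"
    by (rule null_on_of_real_cond_exp[OF sets_filt_col sp(2) i AE(2)])
  then have "null_on \<Omega> (coord_sigma {(a, b). b \<le> -1}) (\<lambda>\<omega>. (f \<circ> shift 1 2) (shift (-1) (-2) \<omega>))"
    by (rule null_on_shift) auto
  then show "null_on \<Omega> (coord_sigma {(a, b). b \<le> -1}) f"
    by (simp add: shift_shift shift_0)
qed

section \<open>Approximation by functions of finitely many coordinates\<close>

lemma coord_sigma_sets_events: "A \<in> sets (coord_sigma J) \<Longrightarrow> A \<in> sets \<Omega>"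
  using subalgebra_coord_sigma[of J] by (auto simp: subalgebra_def)

text \<open>The approximable sets contain the generators and are closed under complements and
  countable unions. A union is first cut at a finite stage, which costs \<open>e / 2\<close>; the
  remaining \<open>n\<close> sets share the other half, with \<open>n + 1\<close> in the denominator
  to admit \<open>n = 0\<close>.\<close>

lemma cylinder_approx_set:
  assumes "A \<in> sets (coord_sigma Q)" "0 < e"
  shows "\<exists>J B. finite J \<and> J \<subseteq> Q \<and> B \<in> sets (coord_sigma J) \<and> prob (A - B \<union> (B - A)) < e"
  using assms[unfolded sets_coord_sigma[of Q]]
proof (induction arbitrary: e rule: sigma_sets.induct)
  case (Basic A)
  then obtain i j S where "(i, j) \<in> Q" "S \<in> sets borel" "A = coord i j -` S" by auto
  moreover have "coord i j -` S \<in> sets (coord_sigma {(i, j)})"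
    unfolding sets_coord_sigma using \<open>S \<in> sets borel\<close> by (intro sigma_sets.Basic) auto
  ultimately show ?case
    using Basic by (intro exI[of _ "{(i, j)}"] exI[of _ A]) auto
next
  case Empty
  then show ?case by (intro exI[of _ "{}"] exI[of _ "{}"]) auto
next
  case (Compl A)
  obtain J B where *: "finite J" "J \<subseteq> Q" "B \<in> sets (coord_sigma J)" "prob (A - B \<union> (B - A)) < e"
    using Compl.IH[OF Compl.prems] by blast
  have "UNIV - A - (UNIV - B) \<union> (UNIV - B - (UNIV - A)) = A - B \<union> (B - A)" by auto
  moreover have "UNIV - B \<in> sets (coord_sigma J)"
    using sets.compl_sets[OF *(3)] by simp
  ultimately show ?case
    using * by (intro exI[of _ J] exI[of _ "UNIV - B"]) auto
next
  case (Union A)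
  have Am: "A i \<in> sets \<Omega>" for i
    using Union.hyps by (intro coord_sigma_sets_events[of _ Q]) (simp add: sets_coord_sigma)
  let ?U = "\<Union>i. A i"
  have "(\<lambda>n. prob (\<Union>i<n. A i)) \<longlonglongrightarrow> prob (\<Union>n. \<Union>i<n. A i)"
    using Am by (intro finite_Lim_measure_incseq) (auto simp: incseq_def, force)
  moreover have "(\<Union>n. \<Union>i<n. A i) = ?U" by auto
  ultimately have "eventually (\<lambda>n. prob ?U - e / 2 < prob (\<Union>i<n. A i)) sequentially"
    using Union.prems by (intro order_tendstoD) auto
  then obtain n where n: "prob ?U - e / 2 < prob (\<Union>i<n. A i)"
    by (auto simp: eventually_sequentially)
  have n': "prob (?U - (\<Union>i<n. A i)) < e / 2"
    using n Am by (subst finite_measure_Diff) auto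
  have "\<exists>J B. finite J \<and> J \<subseteq> Q \<and> B \<in> sets (coord_sigma J) \<and>
      prob (A i - B \<union> (B - A i)) < e / (2 * (real n + 1))" for i
    using Union.IH[of "e / (2 * (real n + 1))" i] Union.prems by simp
  then obtain J B where JB: "\<And>i. finite (J i)" "\<And>i. J i \<subseteq> Q" "\<And>i. B i \<in> sets (coord_sigma (J i))"
      "\<And>i. prob (A i - B i \<union> (B i - A i)) < e / (2 * (real n + 1))"
    by metis
  have Bm: "B i \<in> sets \<Omega>" for i
    using JB(3) by (rule coord_sigma_sets_events)
  let ?J = "\<Union>i<n. J i" and ?B = "\<Union>i<n. B i"
  have "?U - ?B \<union> (?B - ?U) \<subseteq> (?U - (\<Union>i<n. A i)) \<union> (\<Union>i<n. A i - B i \<union> (B i - A i))"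
    by auto
  then have "prob (?U - ?B \<union> (?B - ?U)) \<le> prob ((?U - (\<Union>i<n. A i)) \<union> (\<Union>i<n. A i - B i \<union> (B i - A i)))"
    using Am Bm by (intro finite_measure_mono) auto
  also have "\<dots> \<le> prob (?U - (\<Union>i<n. A i)) + prob (\<Union>i<n. A i - B i \<union> (B i - A i))"
    using Am Bm by (intro measure_Un_le) auto
  also have "prob (\<Union>i<n. A i - B i \<union> (B i - A i)) \<le> (\<Sum>i<n. prob (A i - B i \<union> (B i - A i)))"
    using Am Bm by (intro finite_measure_subadditive_finite) auto
  also have "\<dots> \<le> (\<Sum>i<n. e / (2 * (real n + 1)))"
    by (intro sum_mono less_imp_le JB)
  also have "\<dots> \<le> e / 2"
    using Union.prems by (simp add: field_simps)
  finally have "prob (?U - ?B \<union> (?B - ?U)) < e" using n' by linarith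
  moreover have "?B \<in> sets (coord_sigma ?J)"
    using JB(3) subset_coord_sigma[of "J _" ?J] by (intro sets.finite_UN) blast+
  ultimately show ?case
    using JB(1,2) by (intro exI[of _ ?J] exI[of _ ?B]) auto
qed

definition cylinder :: "(int \<times> int) set \<Rightarrow> (config \<Rightarrow> real) \<Rightarrow> bool" where
  "cylinder Q h \<longleftrightarrow> (\<exists>J K. finite J \<and> J \<subseteq> Q \<and> bdd_meas K h \<and> dep J h)"

lemma cylinder_add:
  assumes "cylinder Q g" "cylinder Q h"
  shows "cylinder Q (\<lambda>\<omega>. g \<omega> + h \<omega>)"
proof -
  obtain J K J' K' where "finite J" "J \<subseteq> Q" "bdd_meas K g" "dep J g"
    "finite J'" "J' \<subseteq> Q" "bdd_meas K' h" "dep J' h"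
    using assms unfolding cylinder_def by blast
  moreover have "dep (J \<union> J') (\<lambda>\<omega>. g \<omega> + h \<omega>)"
    using dep_comp2[OF dep_mono[OF \<open>dep J g\<close> Un_upper1] dep_mono[OF \<open>dep J' h\<close> Un_upper2], of "(+)"] .
  ultimately show ?thesis
    unfolding cylinder_def by (intro exI[of _ "J \<union> J'"] exI[of _ "K + K'"]) (simp add: bdd_meas_add)
qed

lemma cylinder_integrable: "cylinder Q h \<Longrightarrow> integrable \<Omega> h"
  unfolding cylinder_def by (auto intro: bdd_meas_integrable)

text \<open>The induction runs in the measure restricted to \<open>coord_sigma Q\<close>, so that it
  starts from indicators of sets to which \<open>cylinder_approx_set\<close> applies; distances are
  taken in the full space.\<close>

lemma cylinder_approx_L1:
  assumes "integrable \<Omega> f" "f \<in> borel_measurable (coord_sigma Q)" "0 < e"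
  shows "\<exists>h. cylinder Q h \<and> (\<integral>\<omega>. \<bar>f \<omega> - h \<omega>\<bar> \<partial>\<Omega>) < e"
proof -
  let ?M = "restr_to_subalg \<Omega> (coord_sigma Q)"
  note sub = subalgebra_coord_sigma[of Q]
  note intM = integrable_from_subalg[OF sub]
  have meas: "g \<in> borel_measurable \<Omega>" if "integrable ?M g" for g :: "config \<Rightarrow> real"
    using intM[OF that] by auto
  have "integrable ?M f"
    using assms by (intro integrable_in_subalg sub)
  then have "\<forall>e>0. \<exists>h. cylinder Q h \<and> (\<integral>\<omega>. \<bar>f \<omega> - h \<omega>\<bar> \<partial>\<Omega>) < e"
  proof (induction rule: integrable_induct)
    case (base A c)
    show ?case
    proof safe
      fix e :: real assume "0 < e"
      have A: "A \<in> sets (coord_sigma Q)" using base by (simp add: sets_restr_to_subalg[OF sub])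
      have "0 < e / (\<bar>c\<bar> + 1)" using \<open>0 < e\<close> by simp
      from cylinder_approx_set[OF A this] obtain J B where
        B: "finite J" "J \<subseteq> Q" "B \<in> sets (coord_sigma J)" "prob (A - B \<union> (B - A)) < e / (\<bar>c\<bar> + 1)"
        by blast
      have [measurable]: "B \<in> sets \<Omega>" "A \<in> sets \<Omega>"
        using B A by (auto intro: coord_sigma_sets_events)
      have "dep J (\<lambda>\<omega>. indicator B \<omega> * c)"
        unfolding dep_def
      proof safe
        fix \<omega> \<omega>' :: config assume "\<forall>k\<in>J. \<omega> k = \<omega>' k"
        then have "\<omega> \<in> B \<longleftrightarrow> \<omega>' \<in> B" by (intro dep_coord_sigma_set[OF B(3)]) simp
        then show "indicator B \<omega> * c = indicator B \<omega>' * c" by (simp add: indicator_def)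
      qed
      then have "cylinder Q (\<lambda>\<omega>. indicator B \<omega> * c)"
        unfolding cylinder_def bdd_meas_def using B
        by (intro exI[of _ J] exI[of _ "\<bar>c\<bar>"]) (auto simp: indicator_def)
      moreover have "(\<integral>\<omega>. \<bar>indicator A \<omega> *\<^sub>R c - indicator B \<omega> * c\<bar> \<partial>\<Omega>)
         = (\<integral>\<omega>. \<bar>c\<bar> * indicator (A - B \<union> (B - A)) \<omega> \<partial>\<Omega>)"
        by (intro Bochner_Integration.integral_cong) (auto simp: indicator_def)
      moreover have "\<dots> = \<bar>c\<bar> * prob (A - B \<union> (B - A))" by simp
      moreover have "\<bar>c\<bar> * prob (A - B \<union> (B - A)) \<le> (\<bar>c\<bar> + 1) * prob (A - B \<union> (B - A))"
        by (intro mult_right_mono) auto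
      moreover have "(\<bar>c\<bar> + 1) * prob (A - B \<union> (B - A)) < e"
        using B(4) by (simp add: pos_less_divide_eq mult.commute)
      ultimately show "\<exists>h. cylinder Q h \<and> (\<integral>\<omega>. \<bar>indicator A \<omega> *\<^sub>R c - h \<omega>\<bar> \<partial>\<Omega>) < e"
        by (intro exI[of _ "\<lambda>\<omega>. indicator B \<omega> * c"]) auto
    qed
  next
    case (add f g)
    show ?case
    proof safe
      fix e :: real assume "0 < e"
      then have "0 < e / 2" by simp
      obtain h where h: "cylinder Q h" "(\<integral>\<omega>. \<bar>f \<omega> - h \<omega>\<bar> \<partial>\<Omega>) < e / 2"
        using add.IH(1) \<open>0 < e / 2\<close> by blast
      obtain k where k: "cylinder Q k" "(\<integral>\<omega>. \<bar>g \<omega> - k \<omega>\<bar> \<partial>\<Omega>) < e / 2"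
        using add.IH(2) \<open>0 < e / 2\<close> by blast
      note hk = h k
      note [simp] = intM[OF add.hyps(1)] intM[OF add.hyps(2)] cylinder_integrable[OF hk(1)] cylinder_integrable[OF hk(3)]
      have "(\<integral>\<omega>. \<bar>f \<omega> + g \<omega> - (h \<omega> + k \<omega>)\<bar> \<partial>\<Omega>) \<le> (\<integral>\<omega>. \<bar>f \<omega> - h \<omega>\<bar> + \<bar>g \<omega> - k \<omega>\<bar> \<partial>\<Omega>)"
        by (intro integral_mono) auto
      also have "\<dots> < e" using hk by (subst Bochner_Integration.integral_add) auto
      finally show "\<exists>h. cylinder Q h \<and> (\<integral>\<omega>. \<bar>f \<omega> + g \<omega> - h \<omega>\<bar> \<partial>\<Omega>) < e"
        using cylinder_add[OF hk(1,3)] by blast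
    qed
  next
    case (lim f s)
    show ?case
    proof safe
      fix e :: real assume "0 < e"
      note [simp] = intM[OF lim.hyps(1)] intM[OF lim.hyps(4)]
      note [measurable] = borel_measurable_integrable[OF intM[OF lim.hyps(1)]]
        borel_measurable_integrable[OF intM[OF lim.hyps(4)]]
      have "(\<lambda>i. \<integral>\<omega>. \<bar>f \<omega> - s i \<omega>\<bar> \<partial>\<Omega>) \<longlonglongrightarrow> (\<integral>\<omega>. 0 \<partial>\<Omega>)"
      proof (rule integral_dominated_convergence[where w="\<lambda>\<omega>. 3 * \<bar>f \<omega>\<bar>"])
        show "AE \<omega> in \<Omega>. (\<lambda>i. \<bar>f \<omega> - s i \<omega>\<bar>) \<longlonglongrightarrow> 0"
        proof (rule AE_I2)
          fix \<omega>
          have "(\<lambda>i. s i \<omega>) \<longlonglongrightarrow> f \<omega>" using lim.hyps(2)[of \<omega>] by (simp add: space_restr_to_subalg)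
          then show "(\<lambda>i. \<bar>f \<omega> - s i \<omega>\<bar>) \<longlonglongrightarrow> 0"
            using tendsto_rabs[OF tendsto_diff[OF tendsto_const[of "f \<omega>"]], of "\<lambda>i. s i \<omega>" "f \<omega>"] by simp
        qed
        show "AE \<omega> in \<Omega>. norm \<bar>f \<omega> - s i \<omega>\<bar> \<le> 3 * \<bar>f \<omega>\<bar>" for i
        proof (rule AE_I2)
          fix \<omega>
          have "\<bar>s i \<omega>\<bar> \<le> 2 * \<bar>f \<omega>\<bar>" using lim.hyps(3)[of \<omega> i] by (simp add: space_restr_to_subalg)
          then show "norm \<bar>f \<omega> - s i \<omega>\<bar> \<le> 3 * \<bar>f \<omega>\<bar>" by simp
        qed
      qed auto
      then have "eventually (\<lambda>i. (\<integral>\<omega>. \<bar>f \<omega> - s i \<omega>\<bar> \<partial>\<Omega>) < e / 2) sequentially"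
        using \<open>0 < e\<close> by (intro order_tendstoD) auto
      then obtain i where i: "(\<integral>\<omega>. \<bar>f \<omega> - s i \<omega>\<bar> \<partial>\<Omega>) < e / 2"
        by (auto simp: eventually_sequentially)
      have "0 < e / 2" using \<open>0 < e\<close> by simp
      from lim.IH[of i] this obtain h where h: "cylinder Q h" "(\<integral>\<omega>. \<bar>s i \<omega> - h \<omega>\<bar> \<partial>\<Omega>) < e / 2" by blast
      note [simp] = cylinder_integrable[OF h(1)]
      have "(\<integral>\<omega>. \<bar>f \<omega> - h \<omega>\<bar> \<partial>\<Omega>) \<le> (\<integral>\<omega>. \<bar>f \<omega> - s i \<omega>\<bar> + \<bar>s i \<omega> - h \<omega>\<bar> \<partial>\<Omega>)"
        by (intro integral_mono) auto
      also have "\<dots> < e" using i h by (subst Bochner_Integration.integral_add) auto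
      finally show "\<exists>h. cylinder Q h \<and> (\<integral>\<omega>. \<bar>f \<omega> - h \<omega>\<bar> \<partial>\<Omega>) < e" using h(1) by blast
    qed
  qed
  with \<open>0 < e\<close> show ?thesis by blast
qed

definition clip :: "real \<Rightarrow> real \<Rightarrow> real" where
  "clip K x = max (-K) (min K x)"

lemma clip_measurable [measurable]: "clip K \<in> borel_measurable borel"
  unfolding clip_def by measurable

lemma abs_clip: "0 \<le> K \<Longrightarrow> \<bar>clip K x\<bar> \<le> K"
  by (auto simp: clip_def)

lemma clip_lipschitz: "\<bar>clip K x - clip K y\<bar> \<le> \<bar>x - y\<bar>"
  by (auto simp: clip_def max_def min_def)

text \<open>From L1 to L2 by clipping: for two functions bounded by \<open>n\<close> the squared
  distance is at most \<open>2 n\<close> times the distance. Clipping the approximant as well does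
  not increase its distance, since \<open>clip\<close> is 1-Lipschitz and fixes the clipped
  \<open>f\<close>.\<close>

lemma cylinder_approx_L2:
  assumes f: "f \<in> borel_measurable (coord_sigma Q)" and f2: "integrable \<Omega> (\<lambda>\<omega>. (f \<omega>)\<^sup>2)" and "0 < e"
  shows "\<exists>J K h. finite J \<and> J \<subseteq> Q \<and> bdd_meas K h \<and> dep J h \<and> (\<integral>\<omega>. (f \<omega> - h \<omega>)\<^sup>2 \<partial>\<Omega>) < e"
proof -
  have [measurable]: "f \<in> borel_measurable \<Omega>" using f by (simp add: coord_sigma_measurable_iff)
  have le: "\<bar>f \<omega> - clip (real n) (f \<omega>)\<bar> \<le> \<bar>f \<omega>\<bar>" for n \<omega>
    by (auto simp: clip_def max_def min_def)
  have "(\<lambda>n. \<integral>\<omega>. (f \<omega> - clip (real n) (f \<omega>))\<^sup>2 \<partial>\<Omega>) \<longlonglongrightarrow> (\<integral>\<omega>. 0 \<partial>\<Omega>)"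
  proof (rule integral_dominated_convergence[OF _ _ f2])
    show "AE \<omega> in \<Omega>. (\<lambda>n. (f \<omega> - clip (real n) (f \<omega>))\<^sup>2) \<longlonglongrightarrow> 0"
    proof (rule AE_I2)
      fix \<omega>
      obtain N where N: "\<bar>f \<omega>\<bar> \<le> real N" using real_arch_simple by blast
      have "clip (real n) (f \<omega>) = f \<omega>" if "N \<le> n" for n
        using N that by (auto simp: clip_def)
      then have "eventually (\<lambda>n. (f \<omega> - clip (real n) (f \<omega>))\<^sup>2 = 0) sequentially"
        by (intro eventually_sequentiallyI[of N]) simp
      then show "(\<lambda>n. (f \<omega> - clip (real n) (f \<omega>))\<^sup>2) \<longlonglongrightarrow> 0" by (rule tendsto_eventually)
    qed
    show "AE \<omega> in \<Omega>. norm ((f \<omega> - clip (real n) (f \<omega>))\<^sup>2) \<le> (f \<omega>)\<^sup>2" for n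
      using le by (intro AE_I2) (simp flip: abs_le_square_iff)
  qed auto
  then have "eventually (\<lambda>n. (\<integral>\<omega>. (f \<omega> - clip (real n) (f \<omega>))\<^sup>2 \<partial>\<Omega>) < e / 4) sequentially"
    using \<open>0 < e\<close> by (intro order_tendstoD) auto
  then obtain n where n: "(\<integral>\<omega>. (f \<omega> - clip (real n) (f \<omega>))\<^sup>2 \<partial>\<Omega>) < e / 4"
    by (auto simp: eventually_sequentially)
  define g where "g \<omega> = clip (real n) (f \<omega>)" for \<omega>
  have gF: "g \<in> borel_measurable (coord_sigma Q)"
    unfolding g_def using f by measurable
  have gb: "\<bar>g \<omega>\<bar> \<le> real n" for \<omega>
    unfolding g_def by (rule abs_clip) simp
  have [measurable]: "g \<in> borel_measurable \<Omega>" using gF by (simp add: coord_sigma_measurable_iff)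
  have gi: "integrable \<Omega> g"
    by (rule integrable_const_bound[where B="real n"]) (auto simp: gb)
  \<comment> \<open>Chosen so that \<open>2 n\<close> times it is at most \<open>e / 4\<close>. The
    two errors, each below or at \<open>e / 4\<close>, are doubled by
    \<open>(a - c)\<^sup>2 \<le> 2 (a - b)\<^sup>2 + 2 (b - c)\<^sup>2\<close> and still add up to
    less than \<open>e\<close>.\<close>
  have "0 < e / (8 * (real n + 1))" using \<open>0 < e\<close> by simp
  from cylinder_approx_L1[OF gi gF this] obtain h where
    h: "cylinder Q h" "(\<integral>\<omega>. \<bar>g \<omega> - h \<omega>\<bar> \<partial>\<Omega>) < e / (8 * (real n + 1))" by blast
  then obtain J K where J: "finite J" "J \<subseteq> Q" "bdd_meas K h" "dep J h"
    unfolding cylinder_def by blast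
  have [measurable]: "h \<in> borel_measurable \<Omega>" using J by (simp add: bdd_meas_def)
  define k where "k \<omega> = clip (real n) (h \<omega>)" for \<omega>
  have kb: "\<bar>k \<omega>\<bar> \<le> real n" for \<omega>
    unfolding k_def by (rule abs_clip) simp
  have [measurable]: "k \<in> borel_measurable \<Omega>" unfolding k_def by measurable
  have gc: "clip (real n) (g \<omega>) = g \<omega>" for \<omega>
    using gb[of \<omega>] by (auto simp: clip_def)
  have gk: "(g \<omega> - k \<omega>)\<^sup>2 \<le> 2 * real n * \<bar>g \<omega> - h \<omega>\<bar>" for \<omega>
  proof -
    have "\<bar>g \<omega> - k \<omega>\<bar> \<le> 2 * real n" using gb[of \<omega>] kb[of \<omega>] by linarith
    moreover have "\<bar>g \<omega> - k \<omega>\<bar> \<le> \<bar>g \<omega> - h \<omega>\<bar>"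
      using clip_lipschitz[of "real n" "g \<omega>" "h \<omega>"] by (simp add: gc k_def)
    ultimately have "\<bar>g \<omega> - k \<omega>\<bar> * \<bar>g \<omega> - k \<omega>\<bar> \<le> 2 * real n * \<bar>g \<omega> - h \<omega>\<bar>"
      by (intro mult_mono) auto
    then show ?thesis by (simp add: power2_eq_square)
  qed
  have hi: "integrable \<Omega> h" using cylinder_integrable[OF h(1)] .
  have kgi: "integrable \<Omega> (\<lambda>\<omega>. (g \<omega> - k \<omega>)\<^sup>2)"
  proof (rule Bochner_Integration.integrable_bound[of \<Omega> "\<lambda>\<omega>. 2 * real n * \<bar>g \<omega> - h \<omega>\<bar>"])
    show "integrable \<Omega> (\<lambda>\<omega>. 2 * real n * \<bar>g \<omega> - h \<omega>\<bar>)"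
      by (intro integrable_mult_right integrable_abs Bochner_Integration.integrable_diff gi hi)
    show "AE \<omega> in \<Omega>. norm ((g \<omega> - k \<omega>)\<^sup>2) \<le> norm (2 * real n * \<bar>g \<omega> - h \<omega>\<bar>)"
      using order_trans[OF gk abs_ge_self] by (intro AE_I2) simp
  qed measurable
  have fgi: "integrable \<Omega> (\<lambda>\<omega>. (f \<omega> - g \<omega>)\<^sup>2)"
    by (rule Bochner_Integration.integrable_bound[OF f2])
       (use le in \<open>auto simp: g_def simp flip: abs_le_square_iff\<close>)
  have sq: "(a - c)\<^sup>2 \<le> 2 * (a - b)\<^sup>2 + 2 * (b - c)\<^sup>2" for a b c :: real
    using zero_le_power2[of "a - b - (b - c)"] by (simp add: power2_eq_square algebra_simps)
  have "(\<integral>\<omega>. (f \<omega> - k \<omega>)\<^sup>2 \<partial>\<Omega>) \<le> (\<integral>\<omega>. 2 * (f \<omega> - g \<omega>)\<^sup>2 + 2 * (g \<omega> - k \<omega>)\<^sup>2 \<partial>\<Omega>)"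
    by (intro integral_mono' sq) (use fgi kgi in auto)
  also have "\<dots> = 2 * (\<integral>\<omega>. (f \<omega> - g \<omega>)\<^sup>2 \<partial>\<Omega>) + 2 * (\<integral>\<omega>. (g \<omega> - k \<omega>)\<^sup>2 \<partial>\<Omega>)"
    using fgi kgi by simp
  also have "(\<integral>\<omega>. (g \<omega> - k \<omega>)\<^sup>2 \<partial>\<Omega>) \<le> (\<integral>\<omega>. 2 * real n * \<bar>g \<omega> - h \<omega>\<bar> \<partial>\<Omega>)"
    by (intro integral_mono kgi gk) (use gi hi in auto)
  also have "\<dots> = 2 * real n * (\<integral>\<omega>. \<bar>g \<omega> - h \<omega>\<bar> \<partial>\<Omega>)" by simp
  also have "\<dots> \<le> 2 * real n * (e / (8 * (real n + 1)))"
    by (rule mult_left_mono[OF less_imp_le[OF h(2)]]) simp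
  also have "\<dots> \<le> e / 4" using \<open>0 < e\<close> by (simp add: field_simps)
  finally have "(\<integral>\<omega>. (f \<omega> - k \<omega>)\<^sup>2 \<partial>\<Omega>) < e" using n by (simp add: g_def)
  moreover have "dep J k"
    using J(4) unfolding k_def dep_def by metis
  ultimately show ?thesis
    using J kb by (intro exI[of _ J] exI[of _ "real n"] exI[of _ k]) (auto simp: bdd_meas_def)
qed

text \<open>Orthogonality of \<open>cexp H h\<close> to \<open>f\<close> gives \<open>\<parallel>cexp H h\<parallel> \<le> \<parallel>h - f\<parallel>\<close>.\<close>

lemma subtract_cexp_L2:
  assumes h: "bdd_meas K h" and null: "null_on \<Omega> (coord_sigma H) f"
    and f2: "integrable \<Omega> (\<lambda>\<omega>. (f \<omega>)\<^sup>2)"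
  shows "(\<integral>\<omega>. (f \<omega> - (h \<omega> - cexp H h \<omega>))\<^sup>2 \<partial>\<Omega>) \<le> 4 * (\<integral>\<omega>. (f \<omega> - h \<omega>)\<^sup>2 \<partial>\<Omega>)"
proof -
  define c where "c = cexp H h"
  have c: "bdd_meas K c" unfolding c_def by (rule cexp_bdd_meas[OF h])
  have [measurable]: "f \<in> borel_measurable \<Omega>" "h \<in> borel_measurable \<Omega>" "c \<in> borel_measurable \<Omega>"
    using null h c by (auto simp: null_on_def bdd_meas_def)
  have sqi: "integrable \<Omega> (\<lambda>\<omega>. (g \<omega>)\<^sup>2)" if "bdd_meas K g" for g
  proof (rule integrable_const_bound[where B="K\<^sup>2"])
    have "\<bar>g \<omega>\<bar>\<^sup>2 \<le> K\<^sup>2" for \<omega>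
      using that by (intro power_mono) (auto simp: bdd_meas_def)
    then show "AE \<omega> in \<Omega>. norm ((g \<omega>)\<^sup>2) \<le> K\<^sup>2" by simp
  qed (use that in \<open>auto simp: bdd_meas_def\<close>)
  note c2 = sqi[OF c] and h2 = sqi[OF h]
  have fh: "integrable \<Omega> (\<lambda>\<omega>. f \<omega> * h \<omega>)" and ch: "integrable \<Omega> (\<lambda>\<omega>. c \<omega> * h \<omega>)"
    and cf: "integrable \<Omega> (\<lambda>\<omega>. c \<omega> * f \<omega>)"
    using f2 h2 c2 by (auto intro!: integrable_mult_L2)
  have "integrable \<Omega> (\<lambda>\<omega>. (f \<omega>)\<^sup>2 - 2 * (f \<omega> * h \<omega>) + (h \<omega>)\<^sup>2)"
    using fh f2 h2 by auto
  then have fh2: "integrable \<Omega> (\<lambda>\<omega>. (f \<omega> - h \<omega>)\<^sup>2)"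
    by (simp add: power2_diff algebra_simps)
  have "dep H c"
  proof -
    have "dep UNIV h" unfolding dep_def by (metis UNIV_I ext)
    from cexp_dep[OF this, of H] show ?thesis by (simp add: c_def)
  qed
  then have "c \<in> borel_measurable (coord_sigma H)" by (simp add: coord_sigma_measurable_iff)
  from null_onD[OF subalgebra_coord_sigma null this cf]
  have "(\<integral>\<omega>. c \<omega> * f \<omega> \<partial>\<Omega>) = 0" .
  moreover have "(\<integral>\<omega>. c \<omega> * h \<omega> \<partial>\<Omega>) = (\<integral>\<omega>. (c \<omega>)\<^sup>2 \<partial>\<Omega>)"
    using integral_mult_cexp[OF \<open>dep H c\<close> ch] by (simp add: c_def power2_eq_square)
  ultimately have "(\<integral>\<omega>. (c \<omega>)\<^sup>2 \<partial>\<Omega>) = (\<integral>\<omega>. c \<omega> * h \<omega> - c \<omega> * f \<omega> \<partial>\<Omega>)"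
    using ch cf by simp
  also have "\<dots> \<le> (\<integral>\<omega>. (c \<omega>)\<^sup>2 / 2 + (f \<omega> - h \<omega>)\<^sup>2 / 2 \<partial>\<Omega>)"
  proof (intro integral_mono)
    show "c \<omega> * h \<omega> - c \<omega> * f \<omega> \<le> (c \<omega>)\<^sup>2 / 2 + (f \<omega> - h \<omega>)\<^sup>2 / 2" for \<omega>
      using sum_squares_bound[of "- c \<omega>" "f \<omega> - h \<omega>"] by (simp add: algebra_simps)
  qed (use ch cf c2 fh2 in auto)
  also have "\<dots> = (\<integral>\<omega>. (c \<omega>)\<^sup>2 \<partial>\<Omega>) / 2 + (\<integral>\<omega>. (f \<omega> - h \<omega>)\<^sup>2 \<partial>\<Omega>) / 2"
    using c2 fh2 by simp
  finally have cle: "(\<integral>\<omega>. (c \<omega>)\<^sup>2 \<partial>\<Omega>) \<le> (\<integral>\<omega>. (f \<omega> - h \<omega>)\<^sup>2 \<partial>\<Omega>)" by simp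
  have "(\<integral>\<omega>. (f \<omega> - (h \<omega> - c \<omega>))\<^sup>2 \<partial>\<Omega>) \<le> (\<integral>\<omega>. 2 * (f \<omega> - h \<omega>)\<^sup>2 + 2 * (c \<omega>)\<^sup>2 \<partial>\<Omega>)"
  proof (intro integral_mono')
    show "(f \<omega> - (h \<omega> - c \<omega>))\<^sup>2 \<le> 2 * (f \<omega> - h \<omega>)\<^sup>2 + 2 * (c \<omega>)\<^sup>2" for \<omega>
      using zero_le_power2[of "f \<omega> - h \<omega> - c \<omega>"] by (simp add: power2_eq_square algebra_simps)
  qed (use c2 fh2 in auto)
  also have "\<dots> = 2 * (\<integral>\<omega>. (f \<omega> - h \<omega>)\<^sup>2 \<partial>\<Omega>) + 2 * (\<integral>\<omega>. (c \<omega>)\<^sup>2 \<partial>\<Omega>)"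
    using c2 fh2 by simp
  also have "\<dots> \<le> 4 * (\<integral>\<omega>. (f \<omega> - h \<omega>)\<^sup>2 \<partial>\<Omega>)" using cle by simp
  finally show ?thesis by (simp add: c_def)
qed

lemma dep_diff_cexp: "dep J h \<Longrightarrow> dep J (\<lambda>\<omega>. h \<omega> - cexp H h \<omega>)"
  using dep_comp2[of J h "cexp H h" "(-)"] dep_mono[OF cexp_dep[of J h H] Int_lower1] by blast

lemma cexp_diff_cexp:
  assumes "bdd_meas K h"
  shows "cexp H (\<lambda>\<omega>. h \<omega> - cexp H h \<omega>) = (\<lambda>_. 0)"
  using cexp_diff[OF assms cexp_bdd_meas[OF assms]] cexp_cexp[OF assms] by simp

text \<open>A cylinder approximation is centred given \<open>H1\<close> and then given
  \<open>H2\<close>. The second centring preserves the first because the conditional expectations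
  commute; both keep the finite coordinate set; each multiplies the bound on the squared distance to
  \<open>f\<close> by 4, whence \<open>e / 16\<close>.\<close>

lemma orthomartingale_approx:
  assumes f: "f \<in> borel_measurable (coord_sigma Q)" and f2: "integrable \<Omega> (\<lambda>\<omega>. (f \<omega>)\<^sup>2)"
    and null1: "null_on \<Omega> (coord_sigma H1) f" and null2: "null_on \<Omega> (coord_sigma H2) f"
    and "0 < e"
  obtains J K g where "finite J" "J \<subseteq> Q" "bdd_meas K g" "dep J g"
    "null_on \<Omega> (coord_sigma H1) g" "null_on \<Omega> (coord_sigma H2) g"
    "(\<integral>\<omega>. (f \<omega> - g \<omega>)\<^sup>2 \<partial>\<Omega>) < e"
proof -
  have "0 < e / 16" using \<open>0 < e\<close> by simp
  from cylinder_approx_L2[OF f f2 this] obtain J K h where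
    h: "finite J" "J \<subseteq> Q" "bdd_meas K h" "dep J h" "(\<integral>\<omega>. (f \<omega> - h \<omega>)\<^sup>2 \<partial>\<Omega>) < e / 16" by blast
  define h1 where "h1 \<omega> = h \<omega> - cexp H1 h \<omega>" for \<omega>
  define g where "g \<omega> = h1 \<omega> - cexp H2 h1 \<omega>" for \<omega>
  have h1: "bdd_meas (K + K) h1"
    unfolding h1_def by (intro bdd_meas_diff cexp_bdd_meas h)
  have g: "bdd_meas (K + K + (K + K)) g"
    unfolding g_def by (intro bdd_meas_diff cexp_bdd_meas h1)
  have "dep J h1" unfolding h1_def by (intro dep_diff_cexp h)
  then have "dep J g" unfolding g_def by (intro dep_diff_cexp)
  have z1: "cexp H1 h1 = (\<lambda>_. 0)" unfolding h1_def by (rule cexp_diff_cexp[OF h(3)])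
  have z2: "cexp H2 g = (\<lambda>_. 0)" unfolding g_def by (rule cexp_diff_cexp[OF h1])
  have "cexp H1 g = (\<lambda>\<omega>. cexp H1 h1 \<omega> - cexp H1 (cexp H2 h1) \<omega>)"
    unfolding g_def by (rule cexp_diff[OF h1 cexp_bdd_meas[OF h1]])
  also have "cexp H1 (cexp H2 h1) = cexp H2 (cexp H1 h1)"
    using cexp_cexp[OF h1] by (simp add: Int_commute)
  also have "\<dots> = (\<lambda>_. 0)" unfolding z1 by (simp add: cexp_def fun_eq_iff)
  finally have z3: "cexp H1 g = (\<lambda>_. 0)" by (simp add: z1)
  have "(\<integral>\<omega>. (f \<omega> - g \<omega>)\<^sup>2 \<partial>\<Omega>) \<le> 4 * (\<integral>\<omega>. (f \<omega> - h1 \<omega>)\<^sup>2 \<partial>\<Omega>)"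
    unfolding g_def by (rule subtract_cexp_L2[OF h1 null2 f2])
  also have "(\<integral>\<omega>. (f \<omega> - h1 \<omega>)\<^sup>2 \<partial>\<Omega>) \<le> 4 * (\<integral>\<omega>. (f \<omega> - h \<omega>)\<^sup>2 \<partial>\<Omega>)"
    unfolding h1_def by (rule subtract_cexp_L2[OF h(3) null1 f2])
  finally have "(\<integral>\<omega>. (f \<omega> - g \<omega>)\<^sup>2 \<partial>\<Omega>) < e" using h(5) by simp
  then show thesis
    using that[OF h(1,2) g \<open>dep J g\<close> null_on_cexp_0[OF g] null_on_cexp_0[OF g]] z2 z3 by simp
qed

end

section \<open>The central limit theorem\<close>

lemma norm_iexp_diff_le: "cmod (iexp x - iexp y) \<le> \<bar>x - y\<bar>"
proof -
  have "iexp x - iexp y = iexp y * (iexp (x - y) - 1)"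
    by (simp add: algebra_simps flip: exp_add)
  then show ?thesis
    using iexp_approx1[of "x - y" 0] by (simp add: norm_mult)
qed

lemma norm_iexp_taylor: "cmod (iexp x - 1 - \<i> * x) \<le> x\<^sup>2 / 2"
  using iexp_approx1[of x 1] by (simp add: power2_eq_square diff_diff_eq)

lemma has_vector_derivative_quadratic:
  fixes f :: "real \<Rightarrow> 'b :: real_normed_vector"
  assumes "\<And>h. norm (f (x + h) - f x - h *\<^sub>R D) \<le> C * h\<^sup>2"
  shows "(f has_vector_derivative D) (at x)"
  unfolding has_vector_derivative_def has_derivative_at
proof
  show "bounded_linear (\<lambda>h. h *\<^sub>R D)" by (rule bounded_linear_scaleR_left)
  have lim: "((\<lambda>h. C * \<bar>h\<bar>) \<longlongrightarrow> 0) (at 0)"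
    by (rule tendsto_eq_intros refl | simp)+
  have le: "norm (norm (f (x + h) - f x - h *\<^sub>R D) / norm h) \<le> C * \<bar>h\<bar>" if "h \<noteq> 0" for h
    using assms[of h] that by (simp add: divide_simps power2_eq_square)
  have "\<forall>\<^sub>F h in at 0. norm (norm (f (x + h) - f x - h *\<^sub>R D) / norm h) \<le> C * \<bar>h\<bar>"
    unfolding eventually_at_filter using le by (intro always_eventually) blast
  from Lim_null_comparison[OF this lim]
  show "(\<lambda>h. norm (f (x + h) - f x - h *\<^sub>R D) / norm h) \<midarrow>0\<rightarrow> 0" .
qed

text \<open>The integrating factor \<open>exp (v u\<^sup>2 / 2)\<close> removes the linear term and
  leaves a derivative bounded by \<open>E u\<^sup>2 exp (v u\<^sup>2 / 2)\<close> between
  \<open>-\<bar>u\<bar>\<close> and \<open>\<bar>u\<bar>\<close>. Undoing the factor cancels the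
  exponential, so the final bound is free of \<open>v\<close>.\<close>

lemma gaussian_ode_bound:
  fixes \<phi> \<phi>' :: "real \<Rightarrow> complex"
  assumes deriv: "\<And>u. (\<phi> has_vector_derivative \<phi>' u) (at u)" and "\<phi> 0 = 1" and "0 \<le> v"
    and le: "\<And>u. cmod (\<phi>' u + of_real (v * u) * \<phi> u) \<le> E * u\<^sup>2"
  shows "cmod (\<phi> u - exp (- (v * u\<^sup>2 / 2))) \<le> E * \<bar>u\<bar> ^ 3"
proof -
  have E0: "0 \<le> E" using order_trans[OF norm_ge_zero le[of 1]] by simp
  define \<psi> where "\<psi> s = \<phi> s * of_real (exp (v * s\<^sup>2 / 2))" for s
  define D where "D s = (\<phi>' s + of_real (v * s) * \<phi> s) * of_real (exp (v * s\<^sup>2 / 2))" for s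
  have "((\<lambda>s. exp (v * s\<^sup>2 / 2)) has_real_derivative (v * s * exp (v * s\<^sup>2 / 2))) (at s)" for s
    by (rule derivative_eq_intros refl | simp)+
  then have de: "((\<lambda>s. complex_of_real (exp (v * s\<^sup>2 / 2))) has_vector_derivative
      of_real (v * s * exp (v * s\<^sup>2 / 2))) (at s)" for s
    using has_vector_derivative_of_real by blast
  have "(\<psi> has_vector_derivative D s) (at s)" for s
    using has_vector_derivative_mult[OF deriv[of s] de[of s]]
    by (simp add: \<psi>_def[abs_def] D_def algebra_simps)
  then have deriv\<psi>: "(\<psi> has_derivative (\<lambda>h. h *\<^sub>R D s)) (at s within S)" for s S
    by (simp add: has_vector_derivative_def has_derivative_at_withinI)
  have Dle: "onorm (\<lambda>h. h *\<^sub>R D s) \<le> E * u\<^sup>2 * exp (v * u\<^sup>2 / 2)" if "s \<in> {- \<bar>u\<bar>..\<bar>u\<bar>}" for s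
  proof (rule onorm_bound)
    have s: "s\<^sup>2 \<le> u\<^sup>2" using that by (simp add: abs_le_square_iff[symmetric] abs_le_iff)
    have "cmod (D s) \<le> (E * s\<^sup>2) * exp (v * s\<^sup>2 / 2)"
      unfolding D_def norm_mult by (intro mult_mono le) (use E0 in auto)
    also have "\<dots> \<le> (E * u\<^sup>2) * exp (v * u\<^sup>2 / 2)"
      using s E0 \<open>0 \<le> v\<close> by (intro mult_mono) (auto intro!: mult_left_mono)
    finally have "cmod (D s) \<le> E * u\<^sup>2 * exp (v * u\<^sup>2 / 2)" .
    then show "norm (h *\<^sub>R D s) \<le> E * u\<^sup>2 * exp (v * u\<^sup>2 / 2) * norm h" for h :: real
      by (simp add: mult.commute mult_left_mono)
  qed (use E0 in auto)
  have "norm (\<psi> u - \<psi> 0) \<le> E * u\<^sup>2 * exp (v * u\<^sup>2 / 2) * norm (u - 0)"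
    by (rule differentiable_bound[OF _ deriv\<psi> Dle, of "{- \<bar>u\<bar>..\<bar>u\<bar>}"]) auto
  then have *: "cmod (\<psi> u - 1) \<le> E * \<bar>u\<bar> ^ 3 * exp (v * u\<^sup>2 / 2)"
    using \<open>\<phi> 0 = 1\<close> by (simp add: \<psi>_def power3_eq_cube power2_eq_square abs_mult_self_eq mult_ac)
  have "\<phi> u - exp (- (v * u\<^sup>2 / 2)) = (\<psi> u - 1) * of_real (exp (- (v * u\<^sup>2 / 2)))"
    by (simp add: \<psi>_def algebra_simps flip: of_real_mult exp_add)
  then have "cmod (\<phi> u - exp (- (v * u\<^sup>2 / 2))) = cmod (\<psi> u - 1) * exp (- (v * u\<^sup>2 / 2))"
    by (simp add: norm_mult)
  also have "\<dots> \<le> E * \<bar>u\<bar> ^ 3 * exp (v * u\<^sup>2 / 2) * exp (- (v * u\<^sup>2 / 2))"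
    using * by (intro mult_right_mono) auto
  also have "\<dots> = E * \<bar>u\<bar> ^ 3"
    by (simp add: mult.assoc flip: exp_add)
  finally show ?thesis .
qed

section \<open>Stein's method for locally dependent sums\<close>

context iid_field
begin

lemma integrable_cbdd:
  fixes g :: "config \<Rightarrow> complex"
  assumes "g \<in> borel_measurable \<Omega>" "\<And>\<omega>. cmod (g \<omega>) \<le> B"
  shows "integrable \<Omega> g"
  by (rule integrable_const_bound[where B=B]) (use assms in auto)

lemma norm_integral_cbdd:
  fixes g :: "config \<Rightarrow> complex"
  assumes "g \<in> borel_measurable \<Omega>" "\<And>\<omega>. cmod (g \<omega>) \<le> B"
  shows "cmod (\<integral>\<omega>. g \<omega> \<partial>\<Omega>) \<le> B"
proof -
  have "cmod (\<integral>\<omega>. g \<omega> \<partial>\<Omega>) \<le> (\<integral>\<omega>. cmod (g \<omega>) \<partial>\<Omega>)" by (rule integral_norm_bound)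
  also have "\<dots> \<le> (\<integral>\<omega>. B \<partial>\<Omega>)"
    using integrable_cbdd[OF assms] assms by (intro integral_mono) auto
  finally show ?thesis by simp
qed

lemma norm_integral_iexp_diff_le:
  assumes [measurable]: "S \<in> borel_measurable \<Omega>" "T \<in> borel_measurable \<Omega>"
    and "\<And>\<omega>. \<bar>S \<omega> - T \<omega>\<bar> \<le> B"
  shows "cmod ((\<integral>\<omega>. iexp (S \<omega>) \<partial>\<Omega>) - (\<integral>\<omega>. iexp (T \<omega>) \<partial>\<Omega>)) \<le> B"
proof -
  have i: "integrable \<Omega> (\<lambda>\<omega>. iexp (R \<omega>))" if [measurable]: "R \<in> borel_measurable \<Omega>" for R
    by (rule integrable_cbdd[where B=1]) auto
  have "(\<integral>\<omega>. iexp (S \<omega>) \<partial>\<Omega>) - (\<integral>\<omega>. iexp (T \<omega>) \<partial>\<Omega>) = (\<integral>\<omega>. iexp (S \<omega>) - iexp (T \<omega>) \<partial>\<Omega>)"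
    by (intro Bochner_Integration.integral_diff[symmetric] i) measurable
  also have "cmod \<dots> \<le> B"
    by (rule norm_integral_cbdd) (measurable, rule order_trans[OF norm_iexp_diff_le assms(3)])
  finally show ?thesis .
qed

text \<open>Boundedness of \<open>T\<close> makes the quadratic Taylor remainder of the exponential
  uniform, which yields the derivative directly.\<close>

lemma char_derivative:
  assumes T [measurable]: "T \<in> borel_measurable \<Omega>" and bdd: "\<And>\<omega>. \<bar>T \<omega>\<bar> \<le> B"
  shows "((\<lambda>u. \<integral>\<omega>. iexp (u * T \<omega>) \<partial>\<Omega>) has_vector_derivative (\<integral>\<omega>. \<i> * T \<omega> * iexp (u * T \<omega>) \<partial>\<Omega>)) (at u)"
proof (rule has_vector_derivative_quadratic[where C="B\<^sup>2 / 2"])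
  fix h :: real
  have i: "integrable \<Omega> (\<lambda>\<omega>. iexp (s * T \<omega>))" for s
    by (rule integrable_cbdd[where B=1]) auto
  have i': "integrable \<Omega> (\<lambda>\<omega>. \<i> * T \<omega> * iexp (u * T \<omega>))"
    by (rule integrable_cbdd[where B=B]) (auto simp: norm_mult bdd)
  have "(\<integral>\<omega>. iexp ((u + h) * T \<omega>) \<partial>\<Omega>) - (\<integral>\<omega>. iexp (u * T \<omega>) \<partial>\<Omega>) - h *\<^sub>R (\<integral>\<omega>. \<i> * T \<omega> * iexp (u * T \<omega>) \<partial>\<Omega>)
    = (\<integral>\<omega>. iexp ((u + h) * T \<omega>) - iexp (u * T \<omega>) - h *\<^sub>R (\<i> * T \<omega> * iexp (u * T \<omega>)) \<partial>\<Omega>)"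
    using i[of "u + h"] i[of u] i' by simp
  also have "cmod \<dots> \<le> B\<^sup>2 / 2 * h\<^sup>2"
  proof (rule norm_integral_cbdd)
    fix \<omega>
    have "iexp ((u + h) * T \<omega>) - iexp (u * T \<omega>) - h *\<^sub>R (\<i> * T \<omega> * iexp (u * T \<omega>))
       = iexp (u * T \<omega>) * (iexp (h * T \<omega>) - 1 - \<i> * of_real (h * T \<omega>))"
      by (simp add: algebra_simps scaleR_conv_of_real flip: exp_add)
    then have "cmod (iexp ((u + h) * T \<omega>) - iexp (u * T \<omega>) - h *\<^sub>R (\<i> * T \<omega> * iexp (u * T \<omega>))) \<le> (h * T \<omega>)\<^sup>2 / 2"
      using norm_iexp_taylor[of "h * T \<omega>"] by (simp add: norm_mult)
    also have "\<dots> \<le> B\<^sup>2 / 2 * h\<^sup>2"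
      using power_mono[OF bdd[of \<omega>] abs_ge_zero, of 2]
      by (simp add: power_mult_distrib mult.commute[of "h\<^sup>2"] mult_right_mono)
    finally show "cmod (iexp ((u + h) * T \<omega>) - iexp (u * T \<omega>) - h *\<^sub>R (\<i> * T \<omega> * iexp (u * T \<omega>))) \<le> B\<^sup>2 / 2 * h\<^sup>2" .
  qed measurable
  finally show "cmod ((\<integral>\<omega>. iexp ((u + h) * T \<omega>) \<partial>\<Omega>) - (\<integral>\<omega>. iexp (u * T \<omega>) \<partial>\<Omega>) - h *\<^sub>R (\<integral>\<omega>. \<i> * T \<omega> * iexp (u * T \<omega>) \<partial>\<Omega>))
     \<le> B\<^sup>2 / 2 * h\<^sup>2" .
qed

text \<open>The contribution of one summand to the derivative of the characteristic function.
  \<open>T - Y\<close> is independent of \<open>X\<close>, which kills the term of order zero;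
  \<open>T - Z\<close> is independent of \<open>X Y\<close>, which factors the term of first order;
  what remains is of order \<open>c b\<^sup>2 u\<^sup>2\<close>.\<close>

lemma stein_term:
  fixes X Y Z T :: "config \<Rightarrow> real" and u :: real
  assumes [measurable]: "X \<in> borel_measurable \<Omega>" "Y \<in> borel_measurable \<Omega>" "Z \<in> borel_measurable \<Omega>"
      "T \<in> borel_measurable \<Omega>"
    and bX: "\<And>\<omega>. \<bar>X \<omega>\<bar> \<le> c" and bY: "\<And>\<omega>. \<bar>Y \<omega>\<bar> \<le> b" and bZ: "\<And>\<omega>. \<bar>Z \<omega>\<bar> \<le> b"
    and mean: "(\<integral>\<omega>. X \<omega> \<partial>\<Omega>) = 0"
    and dX: "dep J X" and dTY: "dep J' (\<lambda>\<omega>. T \<omega> - Y \<omega>)" and JJ: "J \<inter> J' = {}"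
    and dXY: "dep A (\<lambda>\<omega>. X \<omega> * Y \<omega>)" and dTZ: "dep A' (\<lambda>\<omega>. T \<omega> - Z \<omega>)" and AA: "A \<inter> A' = {}"
  shows "cmod ((\<integral>\<omega>. X \<omega> * iexp (u * T \<omega>) \<partial>\<Omega>)
      - \<i> * u * (\<integral>\<omega>. X \<omega> * Y \<omega> \<partial>\<Omega>) * (\<integral>\<omega>. iexp (u * T \<omega>) \<partial>\<Omega>)) \<le> 4 * c * b\<^sup>2 * u\<^sup>2"
proof -
  define F where "F \<omega> = iexp (u * (T \<omega> - Y \<omega>))" for \<omega>
  define G where "G \<omega> = iexp (u * (T \<omega> - Z \<omega>))" for \<omega>
  have [measurable]: "F \<in> borel_measurable \<Omega>" "G \<in> borel_measurable \<Omega>"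
    unfolding F_def G_def by measurable
  have nF: "cmod (F \<omega>) = 1" and nG: "cmod (G \<omega>) = 1" for \<omega>
    by (simp_all add: F_def G_def)
  have c0: "0 \<le> c" and b0: "0 \<le> b"
    using order_trans[OF abs_ge_zero bX] order_trans[OF abs_ge_zero bY] by auto
  have XY: "\<bar>X \<omega> * Y \<omega>\<bar> \<le> c * b" for \<omega>
    unfolding abs_mult by (intro mult_mono bX bY c0) simp
  \<comment> \<open>\<open>R1\<close> is the Taylor remainder in \<open>Y\<close>. \<open>R2\<close>
    is the cost, in the first-order term, of passing from \<open>F\<close> to \<open>G\<close>, that
    is from \<open>T\<close> without \<open>Y\<close> to \<open>T\<close> without
    \<open>Z\<close>.\<close>
  define R1 where "R1 \<omega> = X \<omega> * F \<omega> * (iexp (u * Y \<omega>) - 1 - \<i> * of_real (u * Y \<omega>))" for \<omega>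
  define R2 where "R2 \<omega> = of_real (X \<omega> * Y \<omega>) * (F \<omega> - G \<omega>)" for \<omega>
  have [measurable]: "R1 \<in> borel_measurable \<Omega>" "R2 \<in> borel_measurable \<Omega>"
    unfolding R1_def R2_def by measurable
  have R1: "cmod (R1 \<omega>) \<le> c * (b\<^sup>2 * u\<^sup>2 / 2)" for \<omega>
  proof -
    have "cmod (iexp (u * Y \<omega>) - 1 - \<i> * of_real (u * Y \<omega>)) \<le> (u * Y \<omega>)\<^sup>2 / 2"
      by (rule norm_iexp_taylor)
    also have "\<dots> \<le> b\<^sup>2 * u\<^sup>2 / 2"
      using mult_left_mono[OF power_mono[OF bY[of \<omega>] abs_ge_zero, of 2], of "u\<^sup>2"]
      by (simp add: power_mult_distrib mult.commute)
    finally show ?thesis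
      unfolding R1_def norm_mult nF using bX[of \<omega>] c0 by (intro mult_mono) auto
  qed
  have R2: "cmod (R2 \<omega>) \<le> c * b * (\<bar>u\<bar> * (2 * b))" for \<omega>
  proof -
    have "cmod (F \<omega> - G \<omega>) \<le> \<bar>u * (T \<omega> - Y \<omega>) - u * (T \<omega> - Z \<omega>)\<bar>"
      unfolding F_def G_def by (rule norm_iexp_diff_le)
    also have "u * (T \<omega> - Y \<omega>) - u * (T \<omega> - Z \<omega>) = u * (Z \<omega> - Y \<omega>)" by (simp add: algebra_simps)
    also have "\<bar>u * (Z \<omega> - Y \<omega>)\<bar> \<le> \<bar>u\<bar> * (2 * b)"
      unfolding abs_mult using bY[of \<omega>] bZ[of \<omega>] by (intro mult_left_mono) auto
    finally show ?thesis
      unfolding R2_def norm_mult norm_of_real using b0 c0 by (intro mult_mono XY) auto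
  qed
  have i1: "integrable \<Omega> R1" and i2: "integrable \<Omega> R2"
    by (rule integrable_cbdd[OF _ R1] integrable_cbdd[OF _ R2], measurable)+
  have i3: "integrable \<Omega> (\<lambda>\<omega>. X \<omega> * F \<omega>)"
    by (rule integrable_cbdd[where B=c]) (auto simp: norm_mult nF bX)
  have i4: "integrable \<Omega> (\<lambda>\<omega>. of_real (X \<omega> * Y \<omega>) * G \<omega>)"
    by (rule integrable_cbdd[where B="c * b"]) (use XY in \<open>auto simp: norm_mult nG abs_mult\<close>)
  have dF: "dep J' F" unfolding F_def dep_def using dTY unfolding dep_def by metis
  have dG: "dep A' G" unfolding G_def dep_def using dTZ unfolding dep_def by metis
  have dX': "dep J (\<lambda>\<omega>. complex_of_real (X \<omega>))" using dX unfolding dep_def by metis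
  have dXY': "dep A (\<lambda>\<omega>. complex_of_real (X \<omega> * Y \<omega>))" using dXY unfolding dep_def by metis
  have e3: "(\<integral>\<omega>. X \<omega> * F \<omega> \<partial>\<Omega>) = 0"
    by (subst integral_mult_indep[OF i3 dX' dF JJ]) (simp add: mean)
  have e4: "(\<integral>\<omega>. of_real (X \<omega> * Y \<omega>) * G \<omega> \<partial>\<Omega>) = (\<integral>\<omega>. X \<omega> * Y \<omega> \<partial>\<Omega>) * (\<integral>\<omega>. G \<omega> \<partial>\<Omega>)"
    by (subst integral_mult_indep[OF i4 dXY' dG AA]) (simp only: integral_complex_of_real)
  have "X \<omega> * iexp (u * T \<omega>) = R1 \<omega> + X \<omega> * F \<omega> + \<i> * u * (R2 \<omega> + of_real (X \<omega> * Y \<omega>) * G \<omega>)" for \<omega>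
  proof -
    have "iexp (u * T \<omega>) = F \<omega> * iexp (u * Y \<omega>)"
      by (simp add: F_def algebra_simps flip: exp_add)
    then show ?thesis by (simp add: R1_def R2_def algebra_simps)
  qed
  then have "(\<integral>\<omega>. X \<omega> * iexp (u * T \<omega>) \<partial>\<Omega>)
      = (\<integral>\<omega>. R1 \<omega> \<partial>\<Omega>) + \<i> * u * ((\<integral>\<omega>. R2 \<omega> \<partial>\<Omega>) + (\<integral>\<omega>. X \<omega> * Y \<omega> \<partial>\<Omega>) * (\<integral>\<omega>. G \<omega> \<partial>\<Omega>))"
    using i1 i2 i3 i4 by (simp add: e3 e4 del: of_real_mult)
  then have "(\<integral>\<omega>. X \<omega> * iexp (u * T \<omega>) \<partial>\<Omega>) - \<i> * u * (\<integral>\<omega>. X \<omega> * Y \<omega> \<partial>\<Omega>) * (\<integral>\<omega>. iexp (u * T \<omega>) \<partial>\<Omega>)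
     = (\<integral>\<omega>. R1 \<omega> \<partial>\<Omega>) + \<i> * u * (\<integral>\<omega>. R2 \<omega> \<partial>\<Omega>)
      + \<i> * u * (\<integral>\<omega>. X \<omega> * Y \<omega> \<partial>\<Omega>) * ((\<integral>\<omega>. G \<omega> \<partial>\<Omega>) - (\<integral>\<omega>. iexp (u * T \<omega>) \<partial>\<Omega>))"
    by (simp add: algebra_simps)
  also have "cmod \<dots> \<le> c * (b\<^sup>2 * u\<^sup>2 / 2) + \<bar>u\<bar> * (c * b * (\<bar>u\<bar> * (2 * b))) + \<bar>u\<bar> * (c * b) * (\<bar>u\<bar> * b)"
  proof (intro norm_triangle_mono)
    show "cmod (\<integral>\<omega>. R1 \<omega> \<partial>\<Omega>) \<le> c * (b\<^sup>2 * u\<^sup>2 / 2)"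
      by (rule norm_integral_cbdd[OF _ R1]) measurable
    have "cmod (\<integral>\<omega>. R2 \<omega> \<partial>\<Omega>) \<le> c * b * (\<bar>u\<bar> * (2 * b))"
      by (rule norm_integral_cbdd[OF _ R2]) measurable
    then show "cmod (\<i> * u * (\<integral>\<omega>. R2 \<omega> \<partial>\<Omega>)) \<le> \<bar>u\<bar> * (c * b * (\<bar>u\<bar> * (2 * b)))"
      by (simp add: norm_mult mult_left_mono)
    have 1: "\<bar>\<integral>\<omega>. X \<omega> * Y \<omega> \<partial>\<Omega>\<bar> \<le> c * b"
    proof -
      have "\<bar>\<integral>\<omega>. X \<omega> * Y \<omega> \<partial>\<Omega>\<bar> = cmod (\<integral>\<omega>. complex_of_real (X \<omega> * Y \<omega>) \<partial>\<Omega>)"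
        by (simp only: integral_complex_of_real norm_of_real)
      also have "\<dots> \<le> c * b"
        by (rule norm_integral_cbdd) (use XY in \<open>auto simp del: of_real_mult\<close>)
      finally show ?thesis .
    qed
    have 2: "cmod ((\<integral>\<omega>. G \<omega> \<partial>\<Omega>) - (\<integral>\<omega>. iexp (u * T \<omega>) \<partial>\<Omega>)) \<le> \<bar>u\<bar> * b"
      unfolding G_def
    proof (rule norm_integral_iexp_diff_le)
      have "u * (T \<omega> - Z \<omega>) - u * T \<omega> = - (u * Z \<omega>)" for \<omega> by (simp add: algebra_simps)
      then show "\<bar>u * (T \<omega> - Z \<omega>) - u * T \<omega>\<bar> \<le> \<bar>u\<bar> * b" for \<omega>
        using bZ[of \<omega>] by (simp add: abs_mult mult_left_mono)
    qed measurable
    show "cmod (\<i> * u * (\<integral>\<omega>. X \<omega> * Y \<omega> \<partial>\<Omega>) * ((\<integral>\<omega>. G \<omega> \<partial>\<Omega>) - (\<integral>\<omega>. iexp (u * T \<omega>) \<partial>\<Omega>)))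
       \<le> \<bar>u\<bar> * (c * b) * (\<bar>u\<bar> * b)"
      unfolding norm_mult norm_of_real norm_ii mult_1_left
      using b0 c0 by (intro mult_mono 2 mult_left_mono 1) auto
  qed
  \<comment> \<open>\<open>7 / 2 = 1 / 2 + 2 + 1\<close>: the Taylor remainder, the passage from
    \<open>F\<close> to \<open>G\<close>, and the return from \<open>G\<close> to the full
    exponential.\<close>
  also have "\<dots> = (7 / 2) * (c * b\<^sup>2 * u\<^sup>2)"
    by (simp add: power2_eq_square algebra_simps abs_mult_self_eq)
  also have "\<dots> \<le> 4 * (c * b\<^sup>2 * u\<^sup>2)"
    using b0 c0 by (intro mult_right_mono) auto
  finally show ?thesis by (simp add: mult.assoc)
qed

lemma dep_sum:
  assumes "\<And>k. k \<in> I \<Longrightarrow> dep A (f k)"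
  shows "dep A (\<lambda>\<omega>. \<Sum>k\<in>I. f k \<omega>)"
  unfolding dep_def
proof safe
  fix \<omega> \<omega>' :: config assume "\<forall>k\<in>A. \<omega> k = \<omega>' k"
  then show "(\<Sum>k\<in>I. f k \<omega>) = (\<Sum>k\<in>I. f k \<omega>')"
    by (intro sum.cong refl depD[OF assms]) auto
qed

text \<open>\<open>J k\<close> holds the coordinates seen by summand \<open>k\<close>, so disjoint
  sets mean independence. Neighbourhoods of first and second order, both of size at most
  \<open>d\<close>, supply the \<open>Y\<close> and \<open>Z\<close> of \<open>stein_term\<close>.
  Orthogonality makes the variance of the sum diagonal, so the differential inequality closes with
  the sum of the single variances.\<close>

lemma dependency_char_bound:
  fixes \<xi> :: "'k \<Rightarrow> config \<Rightarrow> real" and J :: "'k \<Rightarrow> (int \<times> int) set"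
  assumes fin: "finite V" and bdd: "\<And>k. k \<in> V \<Longrightarrow> bdd_meas c (\<xi> k)"
    and dp: "\<And>k. k \<in> V \<Longrightarrow> dep (J k) (\<xi> k)" and ne: "\<And>k. k \<in> V \<Longrightarrow> J k \<noteq> {}"
    and mean: "\<And>k. k \<in> V \<Longrightarrow> (\<integral>\<omega>. \<xi> k \<omega> \<partial>\<Omega>) = 0"
    and orth: "\<And>k l. k \<in> V \<Longrightarrow> l \<in> V \<Longrightarrow> k \<noteq> l \<Longrightarrow> (\<integral>\<omega>. \<xi> k \<omega> * \<xi> l \<omega> \<partial>\<Omega>) = 0"
    and card1: "\<And>k. k \<in> V \<Longrightarrow> card {l\<in>V. J k \<inter> J l \<noteq> {}} \<le> d"
    and card2: "\<And>k. k \<in> V \<Longrightarrow> card {m\<in>V. \<exists>l\<in>V. J k \<inter> J l \<noteq> {} \<and> J l \<inter> J m \<noteq> {}} \<le> d"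
  shows "cmod ((\<integral>\<omega>. iexp (u * (\<Sum>k\<in>V. \<xi> k \<omega>)) \<partial>\<Omega>) - exp (- ((\<Sum>k\<in>V. \<integral>\<omega>. (\<xi> k \<omega>)\<^sup>2 \<partial>\<Omega>) * u\<^sup>2 / 2)))
     \<le> 4 * real (card V) * (real d)\<^sup>2 * c ^ 3 * \<bar>u\<bar> ^ 3"
proof -
  define T where "T \<omega> = (\<Sum>k\<in>V. \<xi> k \<omega>)" for \<omega>
  define v where "v = (\<Sum>k\<in>V. \<integral>\<omega>. (\<xi> k \<omega>)\<^sup>2 \<partial>\<Omega>)"
  have [measurable]: "\<xi> k \<in> borel_measurable \<Omega>" if "k \<in> V" for k
    using bdd[OF that] by (simp add: bdd_meas_def)
  have b: "\<bar>\<xi> k \<omega>\<bar> \<le> c" if "k \<in> V" for k \<omega>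
    using bdd[OF that] by (simp add: bdd_meas_def)
  have sb: "\<bar>\<Sum>l\<in>I. \<xi> l \<omega>\<bar> \<le> real (card I) * c" if "I \<subseteq> V" for I \<omega>
  proof -
    have "\<bar>\<Sum>l\<in>I. \<xi> l \<omega>\<bar> \<le> (\<Sum>l\<in>I. c)"
      using that by (intro order_trans[OF sum_abs] sum_mono b) auto
    then show ?thesis by simp
  qed
  have [measurable]: "T \<in> borel_measurable \<Omega>" unfolding T_def by measurable
  have v0: "0 \<le> v" unfolding v_def by (intro sum_nonneg Bochner_Integration.integral_nonneg) simp
  have "cmod ((\<integral>\<omega>. iexp (u * T \<omega>) \<partial>\<Omega>) - exp (- (v * u\<^sup>2 / 2)))
      \<le> (4 * real (card V) * (real d)\<^sup>2 * c ^ 3) * \<bar>u\<bar> ^ 3"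
  proof (rule gaussian_ode_bound[OF _ _ v0])
    show "((\<lambda>u. \<integral>\<omega>. iexp (u * T \<omega>) \<partial>\<Omega>) has_vector_derivative (\<integral>\<omega>. \<i> * T \<omega> * iexp (u * T \<omega>) \<partial>\<Omega>)) (at u)" for u
      by (rule char_derivative[where B="real (card V) * c"]) (auto simp: T_def intro: sb)
    show "(\<integral>\<omega>. iexp (0 * T \<omega>) \<partial>\<Omega>) = 1" by simp
    fix u :: real
    let ?\<phi> = "\<integral>\<omega>. iexp (u * T \<omega>) \<partial>\<Omega>"
    have i: "integrable \<Omega> (\<lambda>\<omega>. \<xi> k \<omega> * iexp (u * T \<omega>))" if "k \<in> V" for k
      by (rule integrable_cbdd[where B=c]) (use that b in \<open>auto simp: norm_mult\<close>)
    have "(\<integral>\<omega>. \<i> * T \<omega> * iexp (u * T \<omega>) \<partial>\<Omega>) = \<i> * (\<integral>\<omega>. (\<Sum>k\<in>V. \<xi> k \<omega> * iexp (u * T \<omega>)) \<partial>\<Omega>)"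
      by (simp add: T_def[of "_"] mult.assoc flip: sum_distrib_right)
    also have "\<dots> = \<i> * (\<Sum>k\<in>V. \<integral>\<omega>. \<xi> k \<omega> * iexp (u * T \<omega>) \<partial>\<Omega>)"
      using i by (subst Bochner_Integration.integral_sum) auto
    finally have D: "(\<integral>\<omega>. \<i> * T \<omega> * iexp (u * T \<omega>) \<partial>\<Omega>) = \<i> * (\<Sum>k\<in>V. \<integral>\<omega>. \<xi> k \<omega> * iexp (u * T \<omega>) \<partial>\<Omega>)" .
    have main: "cmod ((\<integral>\<omega>. \<xi> k \<omega> * iexp (u * T \<omega>) \<partial>\<Omega>) - \<i> * u * (\<integral>\<omega>. (\<xi> k \<omega>)\<^sup>2 \<partial>\<Omega>) * ?\<phi>)
        \<le> 4 * c * (real d * c)\<^sup>2 * u\<^sup>2" if k: "k \<in> V" for k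
    proof -
      have c0: "0 \<le> c" using order_trans[OF abs_ge_zero b[OF k]] .
      define N1 where "N1 = {l\<in>V. J k \<inter> J l \<noteq> {}}"
      define N2 where "N2 = {m\<in>V. \<exists>l\<in>V. J k \<inter> J l \<noteq> {} \<and> J l \<inter> J m \<noteq> {}}"
      \<comment> \<open>\<open>J k \<noteq> {}\<close> puts \<open>k\<close> into its own
        neighbourhood; from there the variance of the \<open>k\<close>-th summand arises.\<close>
      have sub: "N1 \<subseteq> V" "N2 \<subseteq> V" "finite N1" "finite N2" "k \<in> N1"
        using fin k ne[OF k] by (auto simp: N1_def N2_def)
      define Y where "Y \<omega> = (\<Sum>l\<in>N1. \<xi> l \<omega>)" for \<omega>
      define Z where "Z \<omega> = (\<Sum>l\<in>N2. \<xi> l \<omega>)" for \<omega>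
      have YZm: "Y \<in> borel_measurable \<Omega>" "Z \<in> borel_measurable \<Omega>"
        unfolding Y_def Z_def using sub by (auto intro!: borel_measurable_sum)
      have TY: "T \<omega> - Y \<omega> = (\<Sum>l\<in>V - N1. \<xi> l \<omega>)" and TZ: "T \<omega> - Z \<omega> = (\<Sum>l\<in>V - N2. \<xi> l \<omega>)" for \<omega>
        using sub fin by (simp_all add: T_def Y_def Z_def sum_diff)
      have bY: "\<bar>Y \<omega>\<bar> \<le> real d * c" and bZ: "\<bar>Z \<omega>\<bar> \<le> real d * c" for \<omega>
        using order_trans[OF sb[OF sub(1)] mult_right_mono[OF _ c0]] card1[OF k, folded N1_def]
          order_trans[OF sb[OF sub(2)] mult_right_mono[OF _ c0]] card2[OF k, folded N2_def]
        by (simp_all add: Y_def Z_def)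
      have "(\<integral>\<omega>. \<xi> k \<omega> * Y \<omega> \<partial>\<Omega>) = (\<Sum>l\<in>N1. \<integral>\<omega>. \<xi> k \<omega> * \<xi> l \<omega> \<partial>\<Omega>)"
        unfolding Y_def sum_distrib_left
      proof (rule Bochner_Integration.integral_sum)
        fix l assume "l \<in> N1"
        then have "l \<in> V" using sub by auto
        then show "integrable \<Omega> (\<lambda>\<omega>. \<xi> k \<omega> * \<xi> l \<omega>)"
          using k b by (intro integrable_mult_bounded bdd_meas_integrable[OF bdd])
            (auto simp: bounded_iff intro!: exI[of _ c])
      qed
      also have "\<dots> = (\<Sum>l\<in>N1. if l = k then \<integral>\<omega>. (\<xi> k \<omega>)\<^sup>2 \<partial>\<Omega> else 0)"
        using sub k by (intro sum.cong) (auto simp: orth power2_eq_square)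
      also have "\<dots> = (\<integral>\<omega>. (\<xi> k \<omega>)\<^sup>2 \<partial>\<Omega>)"
        using sub by simp
      finally have XY: "(\<integral>\<omega>. \<xi> k \<omega> * Y \<omega> \<partial>\<Omega>) = (\<integral>\<omega>. (\<xi> k \<omega>)\<^sup>2 \<partial>\<Omega>)" .
      have d1: "dep (\<Union>l\<in>V - N1. J l) (\<lambda>\<omega>. T \<omega> - Y \<omega>)"
        unfolding TY by (intro dep_sum) (auto intro: dep_mono[OF dp])
      have d2: "dep (\<Union>l\<in>V - N2. J l) (\<lambda>\<omega>. T \<omega> - Z \<omega>)"
        unfolding TZ by (intro dep_sum) (auto intro: dep_mono[OF dp])
      have "dep (\<Union>l\<in>N1. J l) Y"
        unfolding Y_def by (intro dep_sum) (use sub in \<open>auto intro: dep_mono[OF dp]\<close>)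
      moreover have "dep (\<Union>l\<in>N1. J l) (\<xi> k)"
        by (rule dep_mono[OF dp[OF k]]) (use sub in auto)
      ultimately have d3: "dep (\<Union>l\<in>N1. J l) (\<lambda>\<omega>. \<xi> k \<omega> * Y \<omega>)"
        using dep_comp2[of "\<Union>l\<in>N1. J l" "\<xi> k" Y "(*)"] by simp
      have "cmod ((\<integral>\<omega>. \<xi> k \<omega> * iexp (u * T \<omega>) \<partial>\<Omega>) - \<i> * u * (\<integral>\<omega>. \<xi> k \<omega> * Y \<omega> \<partial>\<Omega>) * ?\<phi>)
        \<le> 4 * c * (real d * c)\<^sup>2 * u\<^sup>2"
        by (rule stein_term[OF _ YZm _ b[OF k] bY bZ mean[OF k] dp[OF k] d1 _ d3 d2])
           (use k in \<open>auto simp: N1_def N2_def\<close>)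
      then show ?thesis by (simp only: XY)
    qed
    have "(\<Sum>k\<in>V. \<i> * u * (\<integral>\<omega>. (\<xi> k \<omega>)\<^sup>2 \<partial>\<Omega>) * ?\<phi>) = \<i> * u * v * ?\<phi>"
      by (simp only: v_def of_real_sum sum_distrib_left sum_distrib_right)
    then have "\<i> * (\<Sum>k\<in>V. \<integral>\<omega>. \<xi> k \<omega> * iexp (u * T \<omega>) \<partial>\<Omega>) + of_real (v * u) * ?\<phi>
       = \<i> * (\<Sum>k\<in>V. (\<integral>\<omega>. \<xi> k \<omega> * iexp (u * T \<omega>) \<partial>\<Omega>) - \<i> * u * (\<integral>\<omega>. (\<xi> k \<omega>)\<^sup>2 \<partial>\<Omega>) * ?\<phi>)"
      by (simp only: sum_subtractf) (simp add: algebra_simps)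
    also have "cmod \<dots> \<le> (\<Sum>k\<in>V. 4 * c * (real d * c)\<^sup>2 * u\<^sup>2)"
      unfolding norm_mult norm_ii mult_1_left by (intro sum_norm_le main)
    also have "\<dots> = (4 * real (card V) * (real d)\<^sup>2 * c ^ 3) * u\<^sup>2"
      by (simp add: power_mult_distrib power2_eq_square power3_eq_cube)
    finally show "cmod ((\<integral>\<omega>. \<i> * T \<omega> * iexp (u * T \<omega>) \<partial>\<Omega>) + of_real (v * u) * ?\<phi>)
       \<le> (4 * real (card V) * (real d)\<^sup>2 * c ^ 3) * u\<^sup>2"
      unfolding D .
  qed
  then show ?thesis by (simp add: T_def v_def)
qed

end

lemma card_rect: "card (rect a b) = a * b"
  by (simp add: rect_def card_cartesian_product)

lemma finite_rect [simp]: "finite (rect a b)"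
  by (simp add: rect_def)

lemma abs_exp_minus_diff_le:
  fixes x y :: real
  assumes "0 \<le> x" "0 \<le> y"
  shows "\<bar>exp (- x) - exp (- y)\<bar> \<le> \<bar>x - y\<bar>"
proof -
  have *: "exp (- x) - exp (- y) \<le> y - x" if "0 \<le> x" "x \<le> y" for x y :: real
  proof -
    have "exp (- x) - exp (- y) = exp (- x) * (1 - exp (- (y - x)))"
      by (simp add: algebra_simps flip: exp_add)
    also have "\<dots> \<le> 1 * (1 - exp (- (y - x)))"
      using that by (intro mult_right_mono) auto
    also have "\<dots> \<le> y - x"
      using exp_ge_add_one_self[of "x - y"] unfolding minus_diff_eq mult_1_left by linarith
    finally show ?thesis .
  qed
  show ?thesis
  proof (cases "x \<le> y")
    case True
    then have "exp (- y) \<le> exp (- x)" by simp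
    then show ?thesis using *[OF assms(1) True] True by simp
  next
    case False
    then have "exp (- x) \<le> exp (- y)" by simp
    then show ?thesis using *[OF assms(2)] False by simp
  qed
qed

lemma (in prob_space) expectation_abs_le_sqrt:
  fixes X :: "'a \<Rightarrow> real"
  assumes [measurable]: "X \<in> borel_measurable M" and X2: "integrable M (\<lambda>x. (X x)\<^sup>2)"
  shows "expectation (\<lambda>x. \<bar>X x\<bar>) \<le> sqrt (expectation (\<lambda>x. (X x)\<^sup>2))"
proof (rule real_le_rsqrt)
  have "integrable M X"
    using integrable_mult_L2[of "\<lambda>_. 1" M X] X2 by simp
  then have "integrable M (\<lambda>x. \<bar>X x\<bar>)" by simp
  from variance_eq[OF this] variance_positive[of "\<lambda>x. \<bar>X x\<bar>"] X2
  show "(expectation (\<lambda>x. \<bar>X x\<bar>))\<^sup>2 \<le> expectation (\<lambda>x. (X x)\<^sup>2)" by simp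
qed

section \<open>Weighted sums over a rectangle\<close>

context iid_field
begin

text \<open>The hypotheses on \<open>f\<close>, moved to the origin. As \<open>a \<le> -1\<close> is
  the past strictly before index 0, the shift by \<open>(k, l)\<close> is centred given
  \<open>a < k\<close> and given \<open>b < l\<close>. The class is closed under differences, so the
  maximal inequalities also apply to \<open>f - g\<close>.\<close>

definition orthomart :: "(config \<Rightarrow> real) \<Rightarrow> bool" where
  "orthomart f \<longleftrightarrow> f \<in> borel_measurable \<Omega> \<and> integrable \<Omega> (\<lambda>\<omega>. (f \<omega>)\<^sup>2) \<and>
     dep {(a, b). a \<le> 0 \<and> b \<le> 0} f \<and>
     null_on \<Omega> (coord_sigma {(a, b). a \<le> -1}) f \<and> null_on \<Omega> (coord_sigma {(a, b). b \<le> -1}) f"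

lemma orthomart_measurable: "orthomart f \<Longrightarrow> f \<in> borel_measurable \<Omega>"
  by (simp add: orthomart_def)

lemma L2_diff:
  fixes f g :: "config \<Rightarrow> real"
  assumes [measurable]: "f \<in> borel_measurable \<Omega>" "g \<in> borel_measurable \<Omega>"
    and "integrable \<Omega> (\<lambda>\<omega>. (f \<omega>)\<^sup>2)" "integrable \<Omega> (\<lambda>\<omega>. (g \<omega>)\<^sup>2)"
  shows "integrable \<Omega> (\<lambda>\<omega>. (f \<omega> - g \<omega>)\<^sup>2)"
proof -
  have "integrable \<Omega> (\<lambda>\<omega>. (f \<omega>)\<^sup>2 - 2 * (f \<omega> * g \<omega>) + (g \<omega>)\<^sup>2)"
    using assms by (intro Bochner_Integration.integrable_add Bochner_Integration.integrable_diff
        integrable_mult_right integrable_mult_L2)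
  then show ?thesis by (simp add: power2_diff algebra_simps)
qed

lemma orthomart_diff:
  assumes "orthomart f" "orthomart g"
  shows "orthomart (\<lambda>\<omega>. f \<omega> - g \<omega>)"
  using assms dep_comp2[of _ f g "(-)"]
  by (auto simp: orthomart_def intro!: L2_diff null_on_diff subalgebra_coord_sigma)

lemma orthomart_shift_null:
  assumes "orthomart f"
  shows "null_on \<Omega> (coord_sigma {(a, b). a < k}) (\<lambda>\<omega>. f (shift k l \<omega>))"
    and "null_on \<Omega> (coord_sigma {(a, b). b < l}) (\<lambda>\<omega>. f (shift k l \<omega>))"
  by (rule null_on_shift[of "{(a, b). a \<le> -1}"] null_on_shift[of "{(a, b). b \<le> -1}"],
      use assms in \<open>auto simp: orthomart_def\<close>)+

lemma orthomart_shift_dep: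
  assumes "orthomart f"
  shows "dep {(a, b). a \<le> k \<and> b \<le> l} (\<lambda>\<omega>. f (shift k l \<omega>))"
  by (rule dep_shift[of "{(a, b). a \<le> 0 \<and> b \<le> 0}"]) (use assms in \<open>auto simp: orthomart_def\<close>)

lemma orthomart_shift_meas:
  assumes "orthomart f"
  shows "(\<lambda>\<omega>. f (shift k l \<omega>)) \<in> borel_measurable \<Omega>"
  using measurable_compose[OF shift_measurable orthomart_measurable[OF assms]] .

lemma orthomart_shift_L2:
  assumes "orthomart f"
  shows "integrable \<Omega> (\<lambda>\<omega>. (f (shift k l \<omega>))\<^sup>2)" "(\<integral>\<omega>. (f (shift k l \<omega>))\<^sup>2 \<partial>\<Omega>) = (\<integral>\<omega>. (f \<omega>)\<^sup>2 \<partial>\<Omega>)"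
  using integrable_shift[of "\<lambda>\<omega>. (f \<omega>)\<^sup>2" k l] integral_shift[of "\<lambda>\<omega>. (f \<omega>)\<^sup>2" k l] assms
  by (auto simp: orthomart_def)

lemma orthomart_mean:
  assumes "orthomart f"
  shows "(\<integral>\<omega>. f (shift k l \<omega>) \<partial>\<Omega>) = 0"
proof -
  have "(\<lambda>_. 1) \<in> borel_measurable (coord_sigma {(a, b). a < k})" "bounded (range (\<lambda>_ :: config. 1 :: real))"
    by simp_all
  with orthomart_shift_null(1)[OF assms, of k l]
  have "(\<integral>\<omega>. 1 * f (shift k l \<omega>) \<partial>\<Omega>) = 0"
    unfolding null_on_def by blast
  then show ?thesis by simp
qed

text \<open>Two distinct indices differ in some coordinate; along it, the summand with the smaller
  index is measurable for the strict past of the other.\<close>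

lemma orthomart_orthogonal:
  assumes f: "orthomart f" and "(k, l) \<noteq> (k', l')"
  shows "(\<integral>\<omega>. f (shift k l \<omega>) * f (shift k' l' \<omega>) \<partial>\<Omega>) = 0"
proof -
  have i: "integrable \<Omega> (\<lambda>\<omega>. f (shift k l \<omega>) * f (shift k' l' \<omega>))" for k l k' l'
    by (intro integrable_mult_L2 orthomart_shift_L2 orthomart_shift_meas f)
  have 1: "(\<integral>\<omega>. f (shift k l \<omega>) * f (shift k' l' \<omega>) \<partial>\<Omega>) = 0" if "k < k'" for k l k' l'
  proof (rule null_onD[OF subalgebra_coord_sigma orthomart_shift_null(1)[OF f] _ i])
    have "dep {(a, b). a < k'} (\<lambda>\<omega>. f (shift k l \<omega>))"
      by (rule dep_mono[OF orthomart_shift_dep[OF f]]) (use that in auto)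
    then show "(\<lambda>\<omega>. f (shift k l \<omega>)) \<in> borel_measurable (coord_sigma {(a, b). a < k'})"
      by (simp add: coord_sigma_measurable_iff orthomart_shift_meas[OF f])
  qed
  have 2: "(\<integral>\<omega>. f (shift k l \<omega>) * f (shift k' l' \<omega>) \<partial>\<Omega>) = 0" if "l < l'" for k l k' l'
  proof (rule null_onD[OF subalgebra_coord_sigma orthomart_shift_null(2)[OF f] _ i])
    have "dep {(a, b). b < l'} (\<lambda>\<omega>. f (shift k l \<omega>))"
      by (rule dep_mono[OF orthomart_shift_dep[OF f]]) (use that in auto)
    then show "(\<lambda>\<omega>. f (shift k l \<omega>)) \<in> borel_measurable (coord_sigma {(a, b). b < l'})"
      by (simp add: coord_sigma_measurable_iff orthomart_shift_meas[OF f])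
  qed
  consider "k < k'" | "k' < k" | "l < l'" | "l' < l" using assms(2) by fastforce
  then show ?thesis
    using 1[of k k' l l'] 1[of k' k l' l] 2[of l l' k k'] 2[of l' l k' k]
    by cases (auto simp: mult.commute)
qed

text \<open>Weights are arbitrary so that \<open>S\<^sub>n\<close> (all weights 1), a value of
  \<open>B\<^sub>n\<close> (cell areas) and any linear combination of such values have one common
  form.\<close>

definition lin :: "nat \<Rightarrow> nat \<Rightarrow> (int \<times> int \<Rightarrow> real) \<Rightarrow> (config \<Rightarrow> real) \<Rightarrow> config \<Rightarrow> real" where
  "lin a b w f \<omega> = (\<Sum>k\<in>rect a b. w k * f (shift (fst k) (snd k) \<omega>))"

lemma lin_measurable:
  assumes "orthomart f"
  shows "lin a b w f \<in> borel_measurable \<Omega>"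
proof -
  note [measurable] = orthomart_shift_meas[OF assms]
  show ?thesis unfolding lin_def[abs_def] by measurable
qed

lemma lin_diff: "lin a b w f \<omega> - lin a b w g \<omega> = lin a b w (\<lambda>\<omega>. f \<omega> - g \<omega>) \<omega>"
  by (simp add: lin_def sum_subtractf right_diff_distrib)

lemma lin_second_moment:
  assumes "orthomart f"
  shows "integrable \<Omega> (\<lambda>\<omega>. (lin a b w f \<omega>)\<^sup>2)"
    "(\<integral>\<omega>. (lin a b w f \<omega>)\<^sup>2 \<partial>\<Omega>) = (\<Sum>k\<in>rect a b. (w k)\<^sup>2) * (\<integral>\<omega>. (f \<omega>)\<^sup>2 \<partial>\<Omega>)"
proof -
  define X where "X k \<omega> = f (shift (fst k) (snd k) \<omega>)" for k \<omega>
  have i: "integrable \<Omega> (\<lambda>\<omega>. X k \<omega> * X l \<omega>)" for k l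
    unfolding X_def by (intro integrable_mult_L2 orthomart_shift_L2 orthomart_shift_meas assms)
  have eq: "(lin a b w f \<omega>)\<^sup>2 = (\<Sum>k\<in>rect a b. \<Sum>l\<in>rect a b. w k * w l * (X k \<omega> * X l \<omega>))" for \<omega>
    by (simp add: lin_def X_def power2_eq_square sum_product mult_ac)
  show "integrable \<Omega> (\<lambda>\<omega>. (lin a b w f \<omega>)\<^sup>2)"
    unfolding eq by (intro Bochner_Integration.integrable_sum integrable_mult_right i)
  have "(\<integral>\<omega>. (lin a b w f \<omega>)\<^sup>2 \<partial>\<Omega>) = (\<Sum>k\<in>rect a b. \<Sum>l\<in>rect a b. w k * w l * (\<integral>\<omega>. X k \<omega> * X l \<omega> \<partial>\<Omega>))"
    unfolding eq using i by (simp add: Bochner_Integration.integral_sum Bochner_Integration.integrable_sum)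
  also have "\<dots> = (\<Sum>k\<in>rect a b. \<Sum>l\<in>rect a b. if l = k then (w k)\<^sup>2 * (\<integral>\<omega>. (f \<omega>)\<^sup>2 \<partial>\<Omega>) else 0)"
  proof (intro sum.cong refl)
    fix k l
    show "w k * w l * (\<integral>\<omega>. X k \<omega> * X l \<omega> \<partial>\<Omega>) = (if l = k then (w k)\<^sup>2 * (\<integral>\<omega>. (f \<omega>)\<^sup>2 \<partial>\<Omega>) else 0)"
      using orthomart_orthogonal[OF assms, of "fst k" "snd k" "fst l" "snd l"]
        orthomart_shift_L2(2)[OF assms, of "fst k" "snd k"]
      by (auto simp: X_def power2_eq_square)
  qed
  also have "\<dots> = (\<Sum>k\<in>rect a b. (w k)\<^sup>2) * (\<integral>\<omega>. (f \<omega>)\<^sup>2 \<partial>\<Omega>)"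
    by (simp add: sum_distrib_right)
  finally show "(\<integral>\<omega>. (lin a b w f \<omega>)\<^sup>2 \<partial>\<Omega>) = (\<Sum>k\<in>rect a b. (w k)\<^sup>2) * (\<integral>\<omega>. (f \<omega>)\<^sup>2 \<partial>\<Omega>)" .
qed

lemma lin_char_bound:
  assumes g: "orthomart g" and J: "finite J" "dep J g" and K: "bdd_meas K g"
    and w: "\<And>k. \<bar>w k\<bar> \<le> A" and ab: "0 < a" "0 < b"
  defines "N \<equiv> real a * real b"
  shows "cmod ((\<integral>\<omega>. iexp (u * (lin a b w g \<omega> / sqrt N)) \<partial>\<Omega>)
      - exp (- ((\<Sum>k\<in>rect a b. (w k)\<^sup>2) / N * (\<integral>\<omega>. (g \<omega>)\<^sup>2 \<partial>\<Omega>) * u\<^sup>2 / 2)))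
     \<le> 4 * (real (card J + 1) ^ 4)\<^sup>2 * (A * K) ^ 3 * \<bar>u\<bar> ^ 3 / sqrt N"
proof -
  \<comment> \<open>The origin is added so that the coordinate set is nonempty, as
    \<open>dependency_char_bound\<close> demands, even for constant \<open>g\<close>.\<close>
  define J0 where "J0 = insert (0, 0) J"
  have J0: "finite J0" "dep J0 g" "J0 \<noteq> {}"
    using J by (auto simp: J0_def intro: dep_mono)
  have cJ0: "1 \<le> card J0" "card J0 \<le> card J + 1"
    using J0 by (auto simp: J0_def card_insert_if Suc_le_eq card_gt_0_iff)
  define Jk where "Jk k = (\<lambda>j. j + k) ` J0" for k
  define \<xi> where "\<xi> k \<omega> = w k * g (shift (fst k) (snd k) \<omega>) / sqrt N" for k \<omega>
  have N: "0 < N" using ab by (simp add: N_def)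
  have A0: "0 \<le> A" and K0: "0 \<le> K"
    using order_trans[OF abs_ge_zero w] K by (auto simp: bdd_meas_def intro: order_trans[OF abs_ge_zero])
  have gK: "\<bar>g \<omega>\<bar> \<le> K" for \<omega> using K by (simp add: bdd_meas_def)
  \<comment> \<open>A shared coordinate means \<open>p + k = q + l\<close> with \<open>p\<close>,
    \<open>q\<close> in \<open>J0\<close>. So there are at most \<open>card J0 ^ 2\<close>
    neighbours and \<open>card J0 ^ 4\<close> neighbours of neighbours, independently of the
    rectangle; the fourth power serves as common bound.\<close>
  have meet: "\<exists>p\<in>J0. \<exists>q\<in>J0. l = k + p - q" if "Jk k \<inter> Jk l \<noteq> {}" for k l
    using that unfolding Jk_def by (auto, metis add.commute add_diff_cancel_right')
  have "cmod ((\<integral>\<omega>. iexp (u * (\<Sum>k\<in>rect a b. \<xi> k \<omega>)) \<partial>\<Omega>)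
      - exp (- ((\<Sum>k\<in>rect a b. \<integral>\<omega>. (\<xi> k \<omega>)\<^sup>2 \<partial>\<Omega>) * u\<^sup>2 / 2)))
     \<le> 4 * real (card (rect a b)) * (real (card J0 ^ 4))\<^sup>2 * (A * K / sqrt N) ^ 3 * \<bar>u\<bar> ^ 3"
  proof (rule dependency_char_bound[where J=Jk])
    show "bdd_meas (A * K / sqrt N) (\<xi> k)" for k
      unfolding bdd_meas_def \<xi>_def
      using orthomart_shift_meas[OF g] gK w[of k] A0 N
      by (auto simp: abs_mult intro!: divide_right_mono mult_mono)
    show "dep (Jk k) (\<xi> k)" for k
    proof -
      have "dep (Jk k) (\<lambda>\<omega>. g (shift (fst k) (snd k) \<omega>))"
      proof (rule dep_shift[OF J0(2)])
        show "(i + fst k, j + snd k) \<in> Jk k" if "(i, j) \<in> J0" for i j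
          unfolding Jk_def by (rule image_eqI[OF _ that]) (simp add: prod_eq_iff)
      qed
      then show ?thesis
        using dep_comp2[of "Jk k" "\<lambda>\<omega>. g (shift (fst k) (snd k) \<omega>)" "\<lambda>\<omega>. g (shift (fst k) (snd k) \<omega>)" "\<lambda>x y. w k * x / sqrt N"]
        by (simp add: \<xi>_def[abs_def])
    qed
    show "Jk k \<noteq> {}" for k using J0 by (simp add: Jk_def)
    show "(\<integral>\<omega>. \<xi> k \<omega> \<partial>\<Omega>) = 0" for k
      using orthomart_mean[OF g] by (simp add: \<xi>_def)
    show "(\<integral>\<omega>. \<xi> k \<omega> * \<xi> l \<omega> \<partial>\<Omega>) = 0" if "k \<noteq> l" for k l
    proof -
      have "(\<integral>\<omega>. \<xi> k \<omega> * \<xi> l \<omega> \<partial>\<Omega>) = (\<integral>\<omega>. w k * w l / N * (g (shift (fst k) (snd k) \<omega>) * g (shift (fst l) (snd l) \<omega>)) \<partial>\<Omega>)"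
        using N by (intro Bochner_Integration.integral_cong) (auto simp: \<xi>_def)
      then show ?thesis
        using orthomart_orthogonal[OF g, of "fst k" "snd k" "fst l" "snd l"] that by (auto simp: prod_eq_iff)
    qed
    show "card {l \<in> rect a b. Jk k \<inter> Jk l \<noteq> {}} \<le> card J0 ^ 4" for k
    proof -
      have "{l \<in> rect a b. Jk k \<inter> Jk l \<noteq> {}} \<subseteq> (\<lambda>(p, q). k + p - q) ` (J0 \<times> J0)"
      proof
        fix l assume "l \<in> {l \<in> rect a b. Jk k \<inter> Jk l \<noteq> {}}"
        then obtain p q where "p \<in> J0" "q \<in> J0" "l = k + p - q" using meet[of k l] by blast
        then show "l \<in> (\<lambda>(p, q). k + p - q) ` (J0 \<times> J0)"
          by (intro image_eqI[of _ _ "(p, q)"]) auto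
      qed
      then have "card {l \<in> rect a b. Jk k \<inter> Jk l \<noteq> {}} \<le> card (J0 \<times> J0)"
        by (rule surj_card_le[rotated]) (simp add: J0(1))
      also have "\<dots> = card J0 ^ 2" by (simp add: card_cartesian_product power2_eq_square)
      also have "\<dots> \<le> card J0 ^ 4" using cJ0 by (intro power_increasing) auto
      finally show ?thesis .
    qed
    show "card {m \<in> rect a b. \<exists>l\<in>rect a b. Jk k \<inter> Jk l \<noteq> {} \<and> Jk l \<inter> Jk m \<noteq> {}} \<le> card J0 ^ 4" for k
    proof -
      have "{m \<in> rect a b. \<exists>l\<in>rect a b. Jk k \<inter> Jk l \<noteq> {} \<and> Jk l \<inter> Jk m \<noteq> {}}
         \<subseteq> (\<lambda>((p, q), (r, s)). k + p - q + r - s) ` ((J0 \<times> J0) \<times> (J0 \<times> J0))"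
      proof
        fix m assume "m \<in> {m \<in> rect a b. \<exists>l\<in>rect a b. Jk k \<inter> Jk l \<noteq> {} \<and> Jk l \<inter> Jk m \<noteq> {}}"
        then obtain l where l: "Jk k \<inter> Jk l \<noteq> {}" "Jk l \<inter> Jk m \<noteq> {}" by blast
        obtain p q where "p \<in> J0" "q \<in> J0" "l = k + p - q" using meet[OF l(1)] by blast
        moreover obtain r s where "r \<in> J0" "s \<in> J0" "m = l + r - s" using meet[OF l(2)] by blast
        ultimately show "m \<in> (\<lambda>((p, q), (r, s)). k + p - q + r - s) ` ((J0 \<times> J0) \<times> (J0 \<times> J0))"
          by (intro image_eqI[of _ _ "((p, q), (r, s))"]) auto
      qed
      then have "card {m \<in> rect a b. \<exists>l\<in>rect a b. Jk k \<inter> Jk l \<noteq> {} \<and> Jk l \<inter> Jk m \<noteq> {}}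
         \<le> card ((J0 \<times> J0) \<times> (J0 \<times> J0))"
        by (rule surj_card_le[rotated]) (simp add: J0(1))
      also have "\<dots> = card J0 ^ 4" by (simp add: card_cartesian_product power4_eq_xxxx)
      finally show ?thesis .
    qed
  qed auto
  moreover have "(\<Sum>k\<in>rect a b. \<xi> k \<omega>) = lin a b w g \<omega> / sqrt N" for \<omega>
    by (simp add: \<xi>_def lin_def sum_divide_distrib)
  moreover have "(\<Sum>k\<in>rect a b. \<integral>\<omega>. (\<xi> k \<omega>)\<^sup>2 \<partial>\<Omega>) = (\<Sum>k\<in>rect a b. (w k)\<^sup>2) / N * (\<integral>\<omega>. (g \<omega>)\<^sup>2 \<partial>\<Omega>)"
    using N by (simp add: \<xi>_def power_mult_distrib power_divide orthomart_shift_L2(2)[OF g] sum_divide_distrib sum_distrib_right)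
  moreover have "4 * real (card (rect a b)) * (real (card J0 ^ 4))\<^sup>2 * (A * K / sqrt N) ^ 3 * \<bar>u\<bar> ^ 3
      \<le> 4 * (real (card J + 1) ^ 4)\<^sup>2 * (A * K) ^ 3 * \<bar>u\<bar> ^ 3 / sqrt N"
  proof -
    \<comment> \<open>The rate: \<open>N\<close> summands contribute
      \<open>N\<^sup>-\<^sup>3\<^sup>/\<^sup>2\<close> each, hence
      \<open>N\<^sup>-\<^sup>1\<^sup>/\<^sup>2\<close> in total.\<close>
    have eq: "real (card (rect a b)) * (A * K / sqrt N) ^ 3 = (A * K) ^ 3 / sqrt N"
    proof -
      have "sqrt N ^ 3 = N * sqrt N" using N by (simp add: power3_eq_cube)
      then show ?thesis using N by (simp add: card_rect power_divide N_def)
    qed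
    have "4 * real (card (rect a b)) * (real (card J0 ^ 4))\<^sup>2 * (A * K / sqrt N) ^ 3 * \<bar>u\<bar> ^ 3
       = 4 * (real (card J0 ^ 4))\<^sup>2 * (real (card (rect a b)) * (A * K / sqrt N) ^ 3) * \<bar>u\<bar> ^ 3"
      by (simp only: mult_ac)
    also have "\<dots> = 4 * (real (card J0) ^ 4)\<^sup>2 * ((A * K) ^ 3 / sqrt N) * \<bar>u\<bar> ^ 3"
      by (simp only: eq of_nat_power)
    also have "\<dots> \<le> 4 * (real (card J + 1) ^ 4)\<^sup>2 * ((A * K) ^ 3 / sqrt N) * \<bar>u\<bar> ^ 3"
      using cJ0 A0 K0 N by (intro mult_right_mono mult_left_mono power_mono) auto
    finally show ?thesis by simp
  qed
  ultimately show ?thesis by simp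
qed

lemma norm_integral_iexp_diff_L1:
  assumes [measurable]: "S \<in> borel_measurable \<Omega>" "T \<in> borel_measurable \<Omega>"
    and i: "integrable \<Omega> (\<lambda>\<omega>. S \<omega> - T \<omega>)"
  shows "cmod ((\<integral>\<omega>. iexp (S \<omega>) \<partial>\<Omega>) - (\<integral>\<omega>. iexp (T \<omega>) \<partial>\<Omega>)) \<le> (\<integral>\<omega>. \<bar>S \<omega> - T \<omega>\<bar> \<partial>\<Omega>)"
proof -
  have ie: "integrable \<Omega> (\<lambda>\<omega>. iexp (R \<omega>))" if [measurable]: "R \<in> borel_measurable \<Omega>" for R
    by (rule integrable_cbdd[where B=1]) auto
  have "(\<integral>\<omega>. iexp (S \<omega>) \<partial>\<Omega>) - (\<integral>\<omega>. iexp (T \<omega>) \<partial>\<Omega>) = (\<integral>\<omega>. iexp (S \<omega>) - iexp (T \<omega>) \<partial>\<Omega>)"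
    by (intro Bochner_Integration.integral_diff[symmetric] ie) measurable
  also have "cmod \<dots> \<le> (\<integral>\<omega>. cmod (iexp (S \<omega>) - iexp (T \<omega>)) \<partial>\<Omega>)"
    by (rule integral_norm_bound)
  also have "\<dots> \<le> (\<integral>\<omega>. \<bar>S \<omega> - T \<omega>\<bar> \<partial>\<Omega>)"
    by (intro integral_mono norm_iexp_diff_le integrable_abs i integrable_norm Bochner_Integration.integrable_diff ie)
      measurable
  finally show ?thesis .
qed

lemma second_moment_close:
  fixes f g :: "config \<Rightarrow> real"
  assumes [measurable]: "f \<in> borel_measurable \<Omega>" "g \<in> borel_measurable \<Omega>"
    and f2: "integrable \<Omega> (\<lambda>\<omega>. (f \<omega>)\<^sup>2)" and g2: "integrable \<Omega> (\<lambda>\<omega>. (g \<omega>)\<^sup>2)"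
    and d: "(\<integral>\<omega>. (f \<omega> - g \<omega>)\<^sup>2 \<partial>\<Omega>) \<le> \<eta>\<^sup>2" and \<eta>: "0 < \<eta>" "\<eta> \<le> 1"
  shows "\<bar>(\<integral>\<omega>. (g \<omega>)\<^sup>2 \<partial>\<Omega>) - (\<integral>\<omega>. (f \<omega>)\<^sup>2 \<partial>\<Omega>)\<bar> \<le> \<eta> * ((\<integral>\<omega>. (f \<omega>)\<^sup>2 \<partial>\<Omega>) + 2)"
proof -
  note d2 = L2_diff[OF assms(1-4)]
  \<comment> \<open>Young's inequality with parameter \<eta>: the weight \<open>1 / \<eta>\<close>
    on the squared difference is paid by its bound \<open>\<eta>\<^sup>2\<close>, so both
    contributions are of order \<eta>.\<close>
  have pw: "\<bar>b\<^sup>2 - a\<^sup>2\<bar> \<le> \<eta> * a\<^sup>2 + (1 / \<eta> + 1) * (a - b)\<^sup>2" for a b :: real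
  proof -
    have "0 \<le> (\<eta> * a - (a - b))\<^sup>2 / \<eta>" "0 \<le> (\<eta> * a + (a - b))\<^sup>2 / \<eta>" using \<eta> by simp_all
    then have "2 * a * (a - b) \<le> \<eta> * a\<^sup>2 + (a - b)\<^sup>2 / \<eta>" "- (2 * a * (a - b)) \<le> \<eta> * a\<^sup>2 + (a - b)\<^sup>2 / \<eta>"
      using \<eta> by (simp_all add: power2_eq_square field_simps)
    moreover have "b\<^sup>2 - a\<^sup>2 = (a - b)\<^sup>2 - 2 * a * (a - b)"
      by (simp add: power2_eq_square algebra_simps)
    moreover have "(1 / \<eta> + 1) * (a - b)\<^sup>2 = (a - b)\<^sup>2 / \<eta> + (a - b)\<^sup>2"
      by (simp add: algebra_simps)
    moreover have "0 \<le> (a - b)\<^sup>2" by simp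
    ultimately show ?thesis by linarith
  qed
  have "\<bar>(\<integral>\<omega>. (g \<omega>)\<^sup>2 \<partial>\<Omega>) - (\<integral>\<omega>. (f \<omega>)\<^sup>2 \<partial>\<Omega>)\<bar> = \<bar>\<integral>\<omega>. (g \<omega>)\<^sup>2 - (f \<omega>)\<^sup>2 \<partial>\<Omega>\<bar>"
    using f2 g2 by simp
  also have "\<dots> \<le> (\<integral>\<omega>. \<bar>(g \<omega>)\<^sup>2 - (f \<omega>)\<^sup>2\<bar> \<partial>\<Omega>)" by (rule integral_abs_bound)
  also have "\<dots> \<le> (\<integral>\<omega>. \<eta> * (f \<omega>)\<^sup>2 + (1 / \<eta> + 1) * (f \<omega> - g \<omega>)\<^sup>2 \<partial>\<Omega>)"
    by (intro integral_mono pw) (use f2 g2 d2 in auto)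
  also have "\<dots> = \<eta> * (\<integral>\<omega>. (f \<omega>)\<^sup>2 \<partial>\<Omega>) + (1 / \<eta> + 1) * (\<integral>\<omega>. (f \<omega> - g \<omega>)\<^sup>2 \<partial>\<Omega>)"
    using f2 d2 by simp
  also have "(1 / \<eta> + 1) * (\<integral>\<omega>. (f \<omega> - g \<omega>)\<^sup>2 \<partial>\<Omega>) \<le> (1 / \<eta> + 1) * \<eta>\<^sup>2"
    using \<eta> by (intro mult_left_mono d) auto
  also have "(1 / \<eta> + 1) * \<eta>\<^sup>2 = \<eta> + \<eta> * \<eta>"
    using \<eta> by (simp add: field_simps power2_eq_square)
  also have "\<dots> \<le> \<eta> * 2"
    using \<eta> mult_left_mono[of \<eta> 1 \<eta>] by simp
  finally show ?thesis by (simp add: algebra_simps)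
qed

lemma lin_diff_L1:
  assumes h: "orthomart h" and w: "\<And>k. \<bar>w k\<bar> \<le> A" and "0 < a" "0 < b"
    and h2: "(\<integral>\<omega>. (h \<omega>)\<^sup>2 \<partial>\<Omega>) \<le> \<eta>\<^sup>2" and "0 \<le> \<eta>"
  shows "(\<integral>\<omega>. \<bar>lin a b w h \<omega> / sqrt (real a * real b)\<bar> \<partial>\<Omega>) \<le> A * \<eta>"
proof -
  have N: "0 < real a * real b" using assms by simp
  have A0: "0 \<le> A" using order_trans[OF abs_ge_zero w] .
  have sw: "(\<Sum>k\<in>rect a b. (w k)\<^sup>2) \<le> real a * real b * A\<^sup>2"
  proof -
    have "(\<Sum>k\<in>rect a b. (w k)\<^sup>2) \<le> (\<Sum>k\<in>rect a b. A\<^sup>2)"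
    proof (rule sum_mono)
      show "(w k)\<^sup>2 \<le> A\<^sup>2" for k
        using power_mono[OF w[of k] abs_ge_zero, of 2] by simp
    qed
    then show ?thesis by (simp add: card_rect)
  qed
  have "(\<integral>\<omega>. \<bar>lin a b w h \<omega> / sqrt (real a * real b)\<bar> \<partial>\<Omega>) = (\<integral>\<omega>. \<bar>lin a b w h \<omega>\<bar> \<partial>\<Omega>) / sqrt (real a * real b)"
    using N by simp
  also have "\<dots> \<le> sqrt (\<integral>\<omega>. (lin a b w h \<omega>)\<^sup>2 \<partial>\<Omega>) / sqrt (real a * real b)"
    using N by (intro divide_right_mono expectation_abs_le_sqrt lin_measurable lin_second_moment h) auto
  also have "\<dots> \<le> sqrt (real a * real b * A\<^sup>2 * \<eta>\<^sup>2) / sqrt (real a * real b)"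
    unfolding lin_second_moment(2)[OF h] using N
    by (intro divide_right_mono real_sqrt_le_mono mult_mono sw h2) auto
  also have "\<dots> = A * \<eta>"
  proof -
    have "sqrt (real a * real b * A\<^sup>2 * \<eta>\<^sup>2) = sqrt (real a * real b) * (A * \<eta>)"
      unfolding real_sqrt_mult[of "real a * real b * A\<^sup>2" "\<eta>\<^sup>2"] real_sqrt_mult[of "real a * real b" "A\<^sup>2"] real_sqrt_abs
      using A0 \<open>0 \<le> \<eta>\<close> by simp
    then show ?thesis using \<open>0 < a\<close> \<open>0 < b\<close> by simp
  qed
  finally show ?thesis .
qed

text \<open>The approximation takes place inside the quadrant of nonpositive indices, so that
  \<open>g\<close> inherits the adaptedness of \<open>f\<close> along with its centring.\<close>

lemma orthomart_approx:
  assumes f: "orthomart f" and "0 < \<eta>"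
  obtains J K g where "finite J" "bdd_meas K g" "dep J g" "orthomart g" "(\<integral>\<omega>. (f \<omega> - g \<omega>)\<^sup>2 \<partial>\<Omega>) \<le> \<eta>\<^sup>2"
proof -
  let ?Q = "{(a, b). a \<le> 0 \<and> b \<le> (0 :: int)}"
  have "f \<in> borel_measurable (coord_sigma ?Q)"
    using f by (simp add: coord_sigma_measurable_iff orthomart_def)
  moreover have "0 < \<eta>\<^sup>2" using \<open>0 < \<eta>\<close> by simp
  ultimately obtain J K g where g: "finite J" "J \<subseteq> ?Q" "bdd_meas K g" "dep J g"
    "null_on \<Omega> (coord_sigma {(a, b). a \<le> -1}) g" "null_on \<Omega> (coord_sigma {(a, b). b \<le> -1}) g"
    "(\<integral>\<omega>. (f \<omega> - g \<omega>)\<^sup>2 \<partial>\<Omega>) < \<eta>\<^sup>2"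
    using orthomartingale_approx[of f ?Q "{(a, b). a \<le> -1}" "{(a, b). b \<le> -1}" "\<eta>\<^sup>2"] f
    unfolding orthomart_def by blast
  have "integrable \<Omega> (\<lambda>\<omega>. (g \<omega>)\<^sup>2)"
  proof (rule bdd_meas_integrable[where K="K\<^sup>2"])
    have "(g \<omega>)\<^sup>2 \<le> K\<^sup>2" for \<omega>
      using g(3) power_mono[of "\<bar>g \<omega>\<bar>" K 2] by (simp add: bdd_meas_def)
    moreover have "(\<lambda>\<omega>. (g \<omega>)\<^sup>2) \<in> borel_measurable \<Omega>"
      using g(3) unfolding bdd_meas_def by (intro borel_measurable_power) blast
    ultimately show "bdd_meas (K\<^sup>2) (\<lambda>\<omega>. (g \<omega>)\<^sup>2)" by (simp add: bdd_meas_def)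
  qed
  then have "orthomart g"
    using g dep_mono[OF g(4,2)] by (simp add: orthomart_def bdd_meas_def)
  then show thesis using that g by (meson less_imp_le)
qed

text \<open>Three errors: replacing \<open>f\<close> by \<open>g\<close> costs
  \<open>O(\<eta>)\<close> uniformly in \<open>n\<close>; the characteristic function for
  \<open>g\<close> is Gaussian up to \<open>O(N\<^sup>-\<^sup>1\<^sup>/\<^sup>2)\<close>, with a
  constant that depends on \<eta>; the Gaussian exponents differ by \<open>O(\<eta>)\<close> plus
  the convergence error of the squared weights. Hence \<eta> is fixed before
  \<open>n\<close>.\<close>

lemma lin_clt:
  fixes m1 m2 :: "nat \<Rightarrow> nat"
  assumes f: "orthomart f" and m: "filterlim m1 at_top sequentially" "filterlim m2 at_top sequentially"
    and w: "\<And>n k. \<bar>w n k\<bar> \<le> A"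
    and s: "(\<lambda>n. (\<Sum>k\<in>rect (m1 n) (m2 n). (w n k)\<^sup>2) / (real (m1 n) * real (m2 n))) \<longlonglongrightarrow> s"
  shows "(\<lambda>n. \<integral>\<omega>. iexp (u * (lin (m1 n) (m2 n) (w n) f \<omega> / sqrt (real (m1 n) * real (m2 n)))) \<partial>\<Omega>)
    \<longlonglongrightarrow> exp (- (s * (\<integral>\<omega>. (f \<omega>)\<^sup>2 \<partial>\<Omega>) * u\<^sup>2 / 2))"
proof (rule tendstoI)
  fix e :: real assume "0 < e"
  define \<sigma>2 where "\<sigma>2 = (\<integral>\<omega>. (f \<omega>)\<^sup>2 \<partial>\<Omega>)"
  define N where "N n = real (m1 n) * real (m2 n)" for n
  define S where "S n = (\<Sum>k\<in>rect (m1 n) (m2 n). (w n k)\<^sup>2) / N n" for n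
  \<comment> \<open>All coefficients of \<eta> in the final estimate; the summand 1 keeps the sum
    positive for the division.\<close>
  define C1 where "C1 = \<bar>u\<bar> * A + A\<^sup>2 * (\<sigma>2 + 2) * u\<^sup>2 / 2 + 1"
  have A0: "0 \<le> A" using order_trans[OF abs_ge_zero w] .
  have \<sigma>0: "0 \<le> \<sigma>2" unfolding \<sigma>2_def by (intro Bochner_Integration.integral_nonneg) simp
  have C1: "0 < C1" unfolding C1_def using A0 \<sigma>0 by (intro add_nonneg_pos add_nonneg_nonneg) auto
  define \<eta> where "\<eta> = min 1 (e / (2 * C1))"
  have \<eta>: "0 < \<eta>" "\<eta> \<le> 1" "C1 * \<eta> \<le> e / 2"
  proof -
    show "0 < \<eta>" "\<eta> \<le> 1" using \<open>0 < e\<close> C1 by (auto simp: \<eta>_def)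
    have "C1 * \<eta> \<le> C1 * (e / (2 * C1))" using C1 by (intro mult_left_mono) (auto simp: \<eta>_def)
    then show "C1 * \<eta> \<le> e / 2" using C1 by simp
  qed
  obtain J K g where g: "finite J" "bdd_meas K g" "dep J g" "orthomart g" "(\<integral>\<omega>. (f \<omega> - g \<omega>)\<^sup>2 \<partial>\<Omega>) \<le> \<eta>\<^sup>2"
    using orthomart_approx[OF f \<eta>(1)] by blast
  define \<sigma>g where "\<sigma>g = (\<integral>\<omega>. (g \<omega>)\<^sup>2 \<partial>\<Omega>)"
  have \<sigma>g0: "0 \<le> \<sigma>g" unfolding \<sigma>g_def by (intro Bochner_Integration.integral_nonneg) simp
  have close: "\<bar>\<sigma>g - \<sigma>2\<bar> \<le> \<eta> * (\<sigma>2 + 2)"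
    unfolding \<sigma>g_def \<sigma>2_def
    by (rule second_moment_close) (use f g \<eta> in \<open>auto simp: orthomart_def\<close>)
  have s': "S \<longlonglongrightarrow> s" using s by (simp add: S_def[abs_def] N_def)
  have "0 \<le> S n" for n unfolding S_def N_def by (intro divide_nonneg_nonneg sum_nonneg) auto
  then have s0: "0 \<le> s" by (intro LIMSEQ_le_const[OF s']) auto
  define C2 where "C2 = 4 * (real (card J + 1) ^ 4)\<^sup>2 * (A * K) ^ 3 * \<bar>u\<bar> ^ 3"
  have Nlim: "filterlim N at_top sequentially"
    unfolding N_def
    by (intro filterlim_at_top_mult_at_top filterlim_compose[OF filterlim_real_sequentially] m)
  have "(\<lambda>n. C2 / sqrt (N n) + u\<^sup>2 / 2 * (\<sigma>2 * \<bar>S n - s\<bar>)) \<longlonglongrightarrow> 0 + u\<^sup>2 / 2 * (\<sigma>2 * \<bar>s - s\<bar>)"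
    by (intro tendsto_intros s' tendsto_divide_0[OF tendsto_const]
        filterlim_at_top_imp_at_infinity filterlim_compose[OF sqrt_at_top Nlim])
  then have "eventually (\<lambda>n. C2 / sqrt (N n) + u\<^sup>2 / 2 * (\<sigma>2 * \<bar>S n - s\<bar>) < e / 2) sequentially"
    using \<open>0 < e\<close> by (intro order_tendstoD(2)[where y="0 + u\<^sup>2 / 2 * (\<sigma>2 * \<bar>s - s\<bar>)"]) auto
  moreover have "eventually (\<lambda>n. 0 < m1 n) sequentially" "eventually (\<lambda>n. 0 < m2 n) sequentially"
    using m by (auto dest: eventually_compose_filterlim[OF eventually_gt_at_top])
  ultimately show "\<forall>\<^sub>F n in sequentially. dist (\<integral>\<omega>. iexp (u * (lin (m1 n) (m2 n) (w n) f \<omega> / sqrt (real (m1 n) * real (m2 n)))) \<partial>\<Omega>)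
      (exp (- (s * (\<integral>\<omega>. (f \<omega>)\<^sup>2 \<partial>\<Omega>) * u\<^sup>2 / 2))) < e"
  proof eventually_elim
    case (elim n)
    let ?X = "\<lambda>h \<omega>. lin (m1 n) (m2 n) (w n) h \<omega> / sqrt (N n)"
    have Npos: "0 < N n" using elim by (simp add: N_def)
    have SA: "S n \<le> A\<^sup>2"
    proof -
      have "(\<Sum>k\<in>rect (m1 n) (m2 n). (w n k)\<^sup>2) \<le> (\<Sum>k\<in>rect (m1 n) (m2 n). A\<^sup>2)"
      proof (rule sum_mono)
        show "(w n k)\<^sup>2 \<le> A\<^sup>2" for k
          using power_mono[OF w[of n k] abs_ge_zero, of 2] by simp
      qed
      also have "\<dots> = N n * A\<^sup>2" by (simp add: card_rect N_def)
      finally show ?thesis using Npos by (simp add: S_def field_simps)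
    qed
    have fg: "orthomart (\<lambda>\<omega>. f \<omega> - g \<omega>)" by (rule orthomart_diff[OF f g(4)])
    note [measurable] = lin_measurable[OF f] lin_measurable[OF g(4)] lin_measurable[OF fg]
    have dX: "u * ?X f \<omega> - u * ?X g \<omega> = u * ?X (\<lambda>\<omega>. f \<omega> - g \<omega>) \<omega>" for \<omega>
      by (simp add: diff_divide_distrib right_diff_distrib flip: lin_diff)
    have Xi: "integrable \<Omega> (\<lambda>\<omega>. u * ?X (\<lambda>\<omega>. f \<omega> - g \<omega>) \<omega>)"
      using integrable_mult_L2[of "\<lambda>_. 1" \<Omega> "lin (m1 n) (m2 n) (w n) (\<lambda>\<omega>. f \<omega> - g \<omega>)"]
        lin_second_moment(1)[OF fg] by simp
    have "cmod ((\<integral>\<omega>. iexp (u * ?X f \<omega>) \<partial>\<Omega>) - (\<integral>\<omega>. iexp (u * ?X g \<omega>) \<partial>\<Omega>))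
        \<le> (\<integral>\<omega>. \<bar>u * ?X f \<omega> - u * ?X g \<omega>\<bar> \<partial>\<Omega>)"
      by (rule norm_integral_iexp_diff_L1) (measurable, use Xi in \<open>simp only: dX\<close>)
    also have "\<dots> = \<bar>u\<bar> * (\<integral>\<omega>. \<bar>?X (\<lambda>\<omega>. f \<omega> - g \<omega>) \<omega>\<bar> \<partial>\<Omega>)"
      unfolding dX abs_mult by simp
    also have "\<dots> \<le> \<bar>u\<bar> * (A * \<eta>)"
      using lin_diff_L1[OF fg w _ _ g(5) less_imp_le[OF \<eta>(1)], of "m1 n" "m2 n"] elim
      by (intro mult_left_mono) (auto simp: N_def)
    finally have t1: "cmod ((\<integral>\<omega>. iexp (u * ?X f \<omega>) \<partial>\<Omega>) - (\<integral>\<omega>. iexp (u * ?X g \<omega>) \<partial>\<Omega>)) \<le> \<bar>u\<bar> * (A * \<eta>)" .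
    have t2: "cmod ((\<integral>\<omega>. iexp (u * ?X g \<omega>) \<partial>\<Omega>) - exp (- (S n * \<sigma>g * u\<^sup>2 / 2))) \<le> C2 / sqrt (N n)"
      using lin_char_bound[OF g(4,1,3,2) w[of n], where a="m1 n" and b="m2 n" and u=u] elim
      by (simp only: S_def \<sigma>g_def C2_def N_def)
    have "\<bar>exp (- (S n * \<sigma>g * u\<^sup>2 / 2)) - exp (- (s * \<sigma>2 * u\<^sup>2 / 2))\<bar> \<le> \<bar>S n * \<sigma>g * u\<^sup>2 / 2 - s * \<sigma>2 * u\<^sup>2 / 2\<bar>"
      using \<open>0 \<le> S n\<close> s0 \<sigma>0 \<sigma>g0 by (intro abs_exp_minus_diff_le) auto
    also have "\<dots> = u\<^sup>2 / 2 * \<bar>S n * (\<sigma>g - \<sigma>2) + \<sigma>2 * (S n - s)\<bar>"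
    proof -
      have "S n * \<sigma>g * u\<^sup>2 / 2 - s * \<sigma>2 * u\<^sup>2 / 2 = u\<^sup>2 / 2 * (S n * (\<sigma>g - \<sigma>2) + \<sigma>2 * (S n - s))"
        by (simp add: field_simps)
      then show ?thesis by (simp only: abs_mult) simp
    qed
    also have "\<dots> \<le> u\<^sup>2 / 2 * (A\<^sup>2 * (\<eta> * (\<sigma>2 + 2)) + \<sigma>2 * \<bar>S n - s\<bar>)"
    proof (intro mult_left_mono order_trans[OF abs_triangle_ineq] add_mono)
      show "\<bar>S n * (\<sigma>g - \<sigma>2)\<bar> \<le> A\<^sup>2 * (\<eta> * (\<sigma>2 + 2))"
        unfolding abs_mult using \<open>0 \<le> S n\<close> SA close by (intro mult_mono) auto
    qed (use \<sigma>0 in \<open>auto simp: abs_mult\<close>)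
    finally have t3: "\<bar>exp (- (S n * \<sigma>g * u\<^sup>2 / 2)) - exp (- (s * \<sigma>2 * u\<^sup>2 / 2))\<bar>
       \<le> u\<^sup>2 / 2 * (A\<^sup>2 * (\<eta> * (\<sigma>2 + 2)) + \<sigma>2 * \<bar>S n - s\<bar>)" .
    have t3': "cmod (complex_of_real (exp (- (S n * \<sigma>g * u\<^sup>2 / 2))) - complex_of_real (exp (- (s * \<sigma>2 * u\<^sup>2 / 2))))
       \<le> u\<^sup>2 / 2 * (A\<^sup>2 * (\<eta> * (\<sigma>2 + 2)) + \<sigma>2 * \<bar>S n - s\<bar>)"
      using t3 by (simp only: norm_of_real flip: of_real_diff)
    have "cmod ((\<integral>\<omega>. iexp (u * ?X f \<omega>) \<partial>\<Omega>) - exp (- (s * \<sigma>2 * u\<^sup>2 / 2)))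
      \<le> \<bar>u\<bar> * (A * \<eta>) + C2 / sqrt (N n) + u\<^sup>2 / 2 * (A\<^sup>2 * (\<eta> * (\<sigma>2 + 2)) + \<sigma>2 * \<bar>S n - s\<bar>)"
    proof -
      have "cmod (p - t) \<le> cmod (p - q) + cmod (q - r) + cmod (r - t)" for p q r t
        using norm_triangle_ineq[of "p - q" "q - t"] norm_triangle_ineq[of "q - r" "r - t"] by simp
      from order_trans[OF this add_mono[OF add_mono[OF t1 t2] t3']] show ?thesis .
    qed
    also have "\<dots> \<le> C1 * \<eta> + (C2 / sqrt (N n) + u\<^sup>2 / 2 * (\<sigma>2 * \<bar>S n - s\<bar>))"
      using \<eta>(1) by (simp add: C1_def algebra_simps add_divide_distrib)
    also have "\<dots> < e" using \<eta>(3) elim(1) by linarith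
    finally show ?case by (simp add: dist_norm N_def \<sigma>2_def)
  qed
qed

lemma partial_sum_lin: "partial_sum a b f = lin a b (\<lambda>_. 1) f"
  by (simp add: partial_sum_def lin_def fun_eq_iff case_prod_unfold)

text \<open>Orthogonality gives the second moment exactly, so the quotient is constant as soon as
  both sides of the rectangle are positive.\<close>

lemma variance_limit:
  fixes m1 m2 :: "nat \<Rightarrow> nat"
  assumes f: "orthomart f" and m: "filterlim m1 at_top sequentially" "filterlim m2 at_top sequentially"
  shows "(\<lambda>n. (\<integral>\<omega>. (partial_sum (m1 n) (m2 n) f \<omega>)\<^sup>2 \<partial>\<Omega>) / real (card (rect (m1 n) (m2 n)))) \<longlonglongrightarrow> (\<integral>\<omega>. (f \<omega>)\<^sup>2 \<partial>\<Omega>)"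
proof (rule tendsto_eventually)
  have "eventually (\<lambda>n. 0 < m1 n) sequentially" "eventually (\<lambda>n. 0 < m2 n) sequentially"
    using m by (auto dest: eventually_compose_filterlim[OF eventually_gt_at_top])
  then show "\<forall>\<^sub>F n in sequentially. (\<integral>\<omega>. (partial_sum (m1 n) (m2 n) f \<omega>)\<^sup>2 \<partial>\<Omega>) / real (card (rect (m1 n) (m2 n))) = (\<integral>\<omega>. (f \<omega>)\<^sup>2 \<partial>\<Omega>)"
    by eventually_elim (simp add: partial_sum_lin lin_second_moment(2)[OF f] card_rect)
qed

lemma partial_sum_clt:
  fixes m1 m2 :: "nat \<Rightarrow> nat"
  assumes f: "orthomart f" and m: "filterlim m1 at_top sequentially" "filterlim m2 at_top sequentially"
  shows "weak_conv_m
     (\<lambda>n. distr \<Omega> borel (\<lambda>\<omega>. partial_sum (m1 n) (m2 n) f \<omega> / sqrt (real (card (rect (m1 n) (m2 n))))))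
     (distr std_normal_distribution borel (\<lambda>x. sqrt (\<integral>\<omega>. (f \<omega>)\<^sup>2 \<partial>\<Omega>) * x))"
proof (rule levy_continuity)
  define \<sigma> where "\<sigma> = sqrt (\<integral>\<omega>. (f \<omega>)\<^sup>2 \<partial>\<Omega>)"
  have \<sigma>2: "\<sigma>\<^sup>2 = (\<integral>\<omega>. (f \<omega>)\<^sup>2 \<partial>\<Omega>)"
    unfolding \<sigma>_def by (intro real_sqrt_pow2 Bochner_Integration.integral_nonneg) simp
  interpret N: real_distribution std_normal_distribution by (rule real_dist_normal_dist)
  have meas [measurable]: "(\<lambda>\<omega>. partial_sum (m1 n) (m2 n) f \<omega> / sqrt (real (card (rect (m1 n) (m2 n))))) \<in> borel_measurable \<Omega>" for n
    unfolding partial_sum_lin using lin_measurable[OF f] by measurable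
  show "real_distribution (distr \<Omega> borel (\<lambda>\<omega>. partial_sum (m1 n) (m2 n) f \<omega> / sqrt (real (card (rect (m1 n) (m2 n))))))" for n
    by (rule real_distribution_distr) (rule meas)
  show "real_distribution (distr std_normal_distribution borel (\<lambda>x. \<sigma> * x))"
    by (rule N.real_distribution_distr) simp
  fix u :: real
  have "char (distr std_normal_distribution borel (\<lambda>x. \<sigma> * x)) u = char std_normal_distribution (u * \<sigma>)"
    by (simp add: char_def integral_distr mult.assoc)
  also have "\<dots> = complex_of_real (exp (- (1 * (\<integral>\<omega>. (f \<omega>)\<^sup>2 \<partial>\<Omega>) * u\<^sup>2 / 2)))"
    by (simp add: char_std_normal_distribution power_mult_distrib \<sigma>2 mult.commute)
  finally have lim: "char (distr std_normal_distribution borel (\<lambda>x. \<sigma> * x)) u = \<dots>" .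
  have "eventually (\<lambda>n. 0 < m1 n) sequentially" "eventually (\<lambda>n. 0 < m2 n) sequentially"
    using m by (auto dest: eventually_compose_filterlim[OF eventually_gt_at_top])
  then have "\<forall>\<^sub>F n in sequentially. (\<Sum>k\<in>rect (m1 n) (m2 n). (1 :: real)\<^sup>2) / (real (m1 n) * real (m2 n)) = 1"
    by eventually_elim (simp add: card_rect)
  then have "(\<lambda>n. (\<Sum>k\<in>rect (m1 n) (m2 n). (1 :: real)\<^sup>2) / (real (m1 n) * real (m2 n))) \<longlonglongrightarrow> 1"
    by (rule tendsto_eventually)
  from lin_clt[OF f m _ this, of 1 u]
  have "(\<lambda>n. \<integral>\<omega>. iexp (u * (lin (m1 n) (m2 n) (\<lambda>_. 1) f \<omega> / sqrt (real (m1 n) * real (m2 n)))) \<partial>\<Omega>)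
     \<longlonglongrightarrow> char (distr std_normal_distribution borel (\<lambda>x. \<sigma> * x)) u"
    unfolding lim by simp
  moreover have "char (distr \<Omega> borel (\<lambda>\<omega>. partial_sum (m1 n) (m2 n) f \<omega> / sqrt (real (card (rect (m1 n) (m2 n)))))) u
      = (\<integral>\<omega>. iexp (u * (lin (m1 n) (m2 n) (\<lambda>_. 1) f \<omega> / sqrt (real (m1 n) * real (m2 n)))) \<partial>\<Omega>)" for n
    unfolding char_def by (subst integral_distr) (use meas in \<open>simp_all add: partial_sum_lin card_rect\<close>)
  ultimately show "(\<lambda>n. char (distr \<Omega> borel (\<lambda>\<omega>. partial_sum (m1 n) (m2 n) f \<omega> / sqrt (real (card (rect (m1 n) (m2 n)))))) u)
     \<longlonglongrightarrow> char (distr std_normal_distribution borel (\<lambda>x. \<sigma> * x)) u"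
    by simp
qed

end

section \<open>Weak convergence in finite dimensions and on metric spaces\<close>

text \<open>Expectations of these functions are real and imaginary parts of characteristic
  functions, and the product-to-sum formulas make them an algebra, as the Stone-Weierstrass theorem
  needs.\<close>

inductive trig_poly :: "'i set \<Rightarrow> (('i \<Rightarrow> real) \<Rightarrow> real) \<Rightarrow> bool" for I where
  cos: "trig_poly I (\<lambda>x. c * cos (\<Sum>i\<in>I. u i * x i))"
| sin: "trig_poly I (\<lambda>x. c * sin (\<Sum>i\<in>I. u i * x i))"
| add: "trig_poly I p \<Longrightarrow> trig_poly I q \<Longrightarrow> trig_poly I (\<lambda>x. p x + q x)"

lemma trig_poly_cos_sum:
  "trig_poly I (\<lambda>x. c * cos (\<Sum>i\<in>I. u i * x i) + d * cos (\<Sum>i\<in>I. v i * x i))"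
  by (intro trig_poly.intros)

lemma trig_poly_sin_sum:
  "trig_poly I (\<lambda>x. c * sin (\<Sum>i\<in>I. u i * x i) + d * sin (\<Sum>i\<in>I. v i * x i))"
  by (intro trig_poly.intros)

lemma trig_poly_mult_cos: "trig_poly I p \<Longrightarrow> trig_poly I (\<lambda>x. p x * (d * cos (\<Sum>i\<in>I. v i * x i)))"
proof (induction rule: trig_poly.induct)
  case (cos c u)
  show ?case
    using trig_poly_cos_sum[of I "c * d / 2" "\<lambda>i. u i - v i" "c * d / 2" "\<lambda>i. u i + v i"]
    by (simp add: cos_add cos_diff algebra_simps sum.distrib sum_subtractf)
next
  case (sin c u)
  show ?case
    using trig_poly_sin_sum[of I "c * d / 2" "\<lambda>i. u i + v i" "c * d / 2" "\<lambda>i. u i - v i"]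
    by (simp add: sin_add sin_diff algebra_simps sum.distrib sum_subtractf)
next
  case (add p q)
  from trig_poly.add[OF add.IH] show ?case by (simp add: distrib_right)
qed

lemma trig_poly_mult_sin: "trig_poly I p \<Longrightarrow> trig_poly I (\<lambda>x. p x * (d * sin (\<Sum>i\<in>I. v i * x i)))"
proof (induction rule: trig_poly.induct)
  case (cos c u)
  show ?case
    using trig_poly_sin_sum[of I "c * d / 2" "\<lambda>i. u i + v i" "- (c * d / 2)" "\<lambda>i. u i - v i"]
    by (simp add: sin_add sin_diff algebra_simps sum.distrib sum_subtractf)
next
  case (sin c u)
  show ?case
    using trig_poly_cos_sum[of I "c * d / 2" "\<lambda>i. u i - v i" "- (c * d / 2)" "\<lambda>i. u i + v i"]
    by (simp add: cos_add cos_diff algebra_simps sum.distrib sum_subtractf)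
next
  case (add p q)
  from trig_poly.add[OF add.IH] show ?case by (simp add: distrib_right)
qed

lemma trig_poly_mult:
  assumes p: "trig_poly I p" and "trig_poly I q"
  shows "trig_poly I (\<lambda>x. p x * q x)"
  using assms(2)
proof (induction rule: trig_poly.induct)
  case (add q r)
  from trig_poly.add[OF add.IH] show ?case by (simp add: distrib_left)
qed (use p in \<open>auto intro: trig_poly_mult_cos trig_poly_mult_sin\<close>)

lemma abs_sin_minus_id_le: "\<bar>sin x - x\<bar> \<le> x\<^sup>2" for x :: real
proof -
  have "\<bar>sin x - x\<bar> = \<bar>Im (iexp x - 1 - \<i> * x)\<bar>"
    by (simp add: Im_exp)
  also have "\<dots> \<le> cmod (iexp x - 1 - \<i> * x)" by (rule abs_Im_le_cmod)
  also have "\<dots> \<le> x\<^sup>2 / 2" by (rule norm_iexp_taylor)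
  finally show ?thesis by (rule order_trans) simp
qed

lemma continuous_finite_lipschitz:
  fixes \<Phi> :: "('i \<Rightarrow> real) \<Rightarrow> real"
  assumes "\<And>x y. \<bar>\<Phi> x - \<Phi> y\<bar> \<le> L * (\<Sum>i\<in>I. \<bar>x i - y i\<bar>)"
  shows "continuous_on UNIV \<Phi>"
  unfolding continuous_on_def
proof safe
  fix a :: "'i \<Rightarrow> real"
  have "((\<lambda>x. L * (\<Sum>i\<in>I. \<bar>x i - a i\<bar>)) \<longlongrightarrow> L * (\<Sum>i\<in>I. \<bar>a i - a i\<bar>)) (at a)"
  proof (intro tendsto_intros)
    fix i
    have "continuous_on UNIV (\<lambda>x :: 'i \<Rightarrow> real. x i)" by (rule continuous_on_product_coordinates)
    then show "((\<lambda>x. x i) \<longlongrightarrow> a i) (at a)" by (simp add: continuous_on_def)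
  qed
  then have "((\<lambda>x. L * (\<Sum>i\<in>I. \<bar>x i - a i\<bar>)) \<longlongrightarrow> 0) (at a)" by simp
  then have "((\<lambda>x. \<Phi> x - \<Phi> a) \<longlongrightarrow> 0) (at a)"
    by (rule Lim_null_comparison[OF always_eventually, rotated]) (simp add: assms)
  then show "(\<Phi> \<longlongrightarrow> \<Phi> a) (at a within UNIV)"
    by (simp add: LIM_zero_iff)
qed

text \<open>On the torus: \<open>x \<mapsto> R sin (x / R)\<close> is close to the identity in mean and has compact range, where
  the Stone-Weierstrass theorem provides a trigonometric polynomial.\<close>

lemma trig_poly_approx:
  fixes \<Phi> :: "('i :: countable \<Rightarrow> real) \<Rightarrow> real"
  assumes lip: "\<And>x y. \<bar>\<Phi> x - \<Phi> y\<bar> \<le> L * (\<Sum>i\<in>I. \<bar>x i - y i\<bar>)"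
    and "0 < R" "0 < e" "0 \<le> L" "finite I"
  obtains p where "trig_poly I p" "\<And>x. \<bar>\<Phi> x - p x\<bar> \<le> e + L / R * (\<Sum>i\<in>I. (x i)\<^sup>2)"
proof -
  \<comment> \<open>Coordinates outside \<open>I\<close> are pinned to 0, so that distinct points of
    \<open>S\<close> differ in a coordinate that trigonometric polynomials over \<open>I\<close> can
    see.\<close>
  define S :: "('i \<Rightarrow> real) set" where "S = PiE UNIV (\<lambda>i. if i \<in> I then {-1..1} else {0})"
  define s :: "('i \<Rightarrow> real) \<Rightarrow> 'i \<Rightarrow> real" where "s x i = (if i \<in> I then sin (x i / R) else 0)" for x i
  have sS: "s x \<in> S" for x by (auto simp: s_def S_def)
  have coord: "continuous_on A (\<lambda>y :: 'i \<Rightarrow> real. y i)" for A i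
    by (rule continuous_on_subset[OF continuous_on_product_coordinates]) simp
  have "compactin (product_topology (\<lambda>_ :: 'i. euclidean :: real topology) UNIV) S"
    unfolding S_def compactin_PiE by auto
  then have comp: "compact S" by (simp add: euclidean_product_topology)
  have "\<exists>h. (continuous_on S h \<and> trig_poly I (\<lambda>x. h (s x))) \<and> (\<forall>y\<in>S. \<bar>\<Phi> (\<lambda>i. R * y i) - h y\<bar> < e)"
  proof (rule Stone_Weierstrass_HOL[OF comp])
    show "continuous_on S (\<lambda>_. c) \<and> trig_poly I (\<lambda>_. c)" for c
      using trig_poly.cos[of I c "\<lambda>_. 0"] by simp
    show "\<exists>h. (continuous_on S h \<and> trig_poly I (\<lambda>x. h (s x))) \<and> h x \<noteq> h y"
      if xy: "x \<in> S \<and> y \<in> S \<and> x \<noteq> y" for x y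
    proof -
      obtain i where i: "x i \<noteq> y i" using xy by (auto simp: fun_eq_iff)
      have "z i = 0" if "z \<in> S" "i \<notin> I" for z
        using PiE_mem[OF that(1)[unfolded S_def] UNIV_I, of i] that(2) by simp
      with xy i have "i \<in> I" by metis
      have "(\<lambda>x. s x i) = (\<lambda>x. 1 * sin (\<Sum>j\<in>I. (if j = i then 1 / R else 0) * x j))"
        using \<open>i \<in> I\<close> \<open>finite I\<close> by (simp add: s_def fun_eq_iff if_distrib[of "\<lambda>a. a * _"] cong: if_cong)
      then have "trig_poly I (\<lambda>x. s x i)" by (simp only: trig_poly.sin)
      then show ?thesis
        using coord i by (intro exI[of _ "\<lambda>y. y i"]) auto
    qed
    have "\<bar>\<Phi> (\<lambda>i. R * x i) - \<Phi> (\<lambda>i. R * y i)\<bar> \<le> (L * R) * (\<Sum>i\<in>I. \<bar>x i - y i\<bar>)" for x y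
    proof -
      have "(\<Sum>i\<in>I. \<bar>R * x i - R * y i\<bar>) = R * (\<Sum>i\<in>I. \<bar>x i - y i\<bar>)"
        using \<open>0 < R\<close> by (simp add: sum_distrib_left abs_mult flip: right_diff_distrib)
      then show ?thesis using lip[of "\<lambda>i. R * x i" "\<lambda>i. R * y i"] by (simp add: mult.assoc)
    qed
    then have "continuous_on UNIV (\<lambda>y. \<Phi> (\<lambda>i. R * y i))"
      by (rule continuous_finite_lipschitz)
    then show "continuous_on S (\<lambda>y. \<Phi> (\<lambda>i. R * y i))"
      by (rule continuous_on_subset) simp
  qed (use \<open>0 < e\<close> in \<open>auto intro: continuous_intros trig_poly.add trig_poly_mult\<close>)
  then obtain h where h: "trig_poly I (\<lambda>x. h (s x))" "\<And>y. y \<in> S \<Longrightarrow> \<bar>\<Phi> (\<lambda>i. R * y i) - h y\<bar> < e" by blast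
  have "\<bar>\<Phi> x - h (s x)\<bar> \<le> e + L / R * (\<Sum>i\<in>I. (x i)\<^sup>2)" for x
  proof -
    have "\<bar>\<Phi> x - \<Phi> (\<lambda>i. R * s x i)\<bar> \<le> L * (\<Sum>i\<in>I. \<bar>x i - R * s x i\<bar>)" by (rule lip)
    also have "\<dots> \<le> L * (\<Sum>i\<in>I. (x i)\<^sup>2 / R)"
    proof (intro mult_left_mono sum_mono \<open>0 \<le> L\<close>)
      fix i assume "i \<in> I"
      have "x i - R * s x i = - (R * (sin (x i / R) - x i / R))"
        using \<open>i \<in> I\<close> \<open>0 < R\<close> by (simp add: s_def field_simps)
      then have "\<bar>x i - R * s x i\<bar> = R * \<bar>sin (x i / R) - x i / R\<bar>"
        using \<open>0 < R\<close> by (simp add: abs_mult)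
      also have "\<dots> \<le> R * (x i / R)\<^sup>2"
        using \<open>0 < R\<close> by (intro mult_left_mono abs_sin_minus_id_le) simp
      also have "\<dots> = (x i)\<^sup>2 / R"
        using \<open>0 < R\<close> by (simp add: power2_eq_square)
      finally show "\<bar>x i - R * s x i\<bar> \<le> (x i)\<^sup>2 / R" .
    qed
    also have "\<dots> = L / R * (\<Sum>i\<in>I. (x i)\<^sup>2)"
      by (simp flip: sum_divide_distrib)
    finally show ?thesis using h(2)[OF sS, of x] by linarith
  qed
  with h(1) that show thesis by blast
qed

lemma trig_poly_measurable_bounded:
  fixes X :: "'a \<Rightarrow> 'i \<Rightarrow> real"
  assumes "trig_poly I p" and meas: "\<And>i. i \<in> I \<Longrightarrow> (\<lambda>\<omega>. X \<omega> i) \<in> borel_measurable M"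
  shows "(\<lambda>\<omega>. p (X \<omega>)) \<in> borel_measurable M \<and> (\<exists>B. \<forall>\<omega>. \<bar>p (X \<omega>)\<bar> \<le> B)"
  using assms(1)
proof (induction rule: trig_poly.induct)
  case (cos c u)
  have "\<bar>c * cos t\<bar> \<le> \<bar>c\<bar>" for t by (simp add: abs_mult mult_left_le)
  then show ?case using meas by (auto intro!: borel_measurable_sum exI[of _ "\<bar>c\<bar>"] borel_measurable_times
      measurable_compose[OF _ borel_measurable_continuous_onI[of cos]] continuous_intros)
next
  case (sin c u)
  have "\<bar>c * sin t\<bar> \<le> \<bar>c\<bar>" for t by (simp add: abs_mult mult_left_le)
  then show ?case using meas by (auto intro!: borel_measurable_sum exI[of _ "\<bar>c\<bar>"] borel_measurable_times
      measurable_compose[OF _ borel_measurable_continuous_onI[of sin]] continuous_intros)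
next
  case (add p q)
  then obtain A B where "\<And>\<omega>. \<bar>p (X \<omega>)\<bar> \<le> A" "\<And>\<omega>. \<bar>q (X \<omega>)\<bar> \<le> B" by blast
  then have "\<bar>p (X \<omega>) + q (X \<omega>)\<bar> \<le> A + B" for \<omega>
    by (intro order_trans[OF abs_triangle_ineq] add_mono)
  with add show ?case by (auto intro!: borel_measurable_add)
qed

lemma (in prob_space) integral_cos_sin_iexp:
  assumes [measurable]: "T \<in> borel_measurable M"
  shows "expectation (\<lambda>\<omega>. cos (T \<omega>)) = Re (\<integral>\<omega>. iexp (T \<omega>) \<partial>M)"
    "expectation (\<lambda>\<omega>. sin (T \<omega>)) = Im (\<integral>\<omega>. iexp (T \<omega>) \<partial>M)"
proof -
  have "integrable M (\<lambda>\<omega>. iexp (T \<omega>))"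
    by (rule integrable_const_bound[where B=1]) auto
  then have "Re (\<integral>\<omega>. iexp (T \<omega>) \<partial>M) = (\<integral>\<omega>. Re (iexp (T \<omega>)) \<partial>M)"
    "Im (\<integral>\<omega>. iexp (T \<omega>) \<partial>M) = (\<integral>\<omega>. Im (iexp (T \<omega>)) \<partial>M)"
    by (simp_all only: integral_Re integral_Im)
  then show "expectation (\<lambda>\<omega>. cos (T \<omega>)) = Re (\<integral>\<omega>. iexp (T \<omega>) \<partial>M)"
    "expectation (\<lambda>\<omega>. sin (T \<omega>)) = Im (\<integral>\<omega>. iexp (T \<omega>) \<partial>M)"
    by (simp_all add: Re_exp Im_exp)
qed

lemma trig_poly_expectation_tendsto:
  fixes X :: "nat \<Rightarrow> 'a \<Rightarrow> 'i \<Rightarrow> real" and Y :: "'b \<Rightarrow> 'i \<Rightarrow> real"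
  assumes "prob_space M" "prob_space W"
    and X: "\<And>n i. i \<in> I \<Longrightarrow> (\<lambda>\<omega>. X n \<omega> i) \<in> borel_measurable M"
    and Y: "\<And>i. i \<in> I \<Longrightarrow> (\<lambda>\<omega>. Y \<omega> i) \<in> borel_measurable W"
    and char: "\<And>u. (\<lambda>n. \<integral>\<omega>. iexp (\<Sum>i\<in>I. u i * X n \<omega> i) \<partial>M) \<longlonglongrightarrow> (\<integral>\<omega>. iexp (\<Sum>i\<in>I. u i * Y \<omega> i) \<partial>W)"
    and "trig_poly I p"
  shows "(\<lambda>n. \<integral>\<omega>. p (X n \<omega>) \<partial>M) \<longlonglongrightarrow> (\<integral>\<omega>. p (Y \<omega>) \<partial>W)"
  using assms(6)
proof (induction rule: trig_poly.induct)
  interpret M: prob_space M by fact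
  interpret W: prob_space W by fact
  have mX: "(\<lambda>\<omega>. \<Sum>i\<in>I. u i * X n \<omega> i) \<in> borel_measurable M" for n u
    using X by (intro borel_measurable_sum borel_measurable_times) auto
  have mY: "(\<lambda>\<omega>. \<Sum>i\<in>I. u i * Y \<omega> i) \<in> borel_measurable W" for u
    using Y by (intro borel_measurable_sum borel_measurable_times) auto
  {
    case (cos c u)
    from tendsto_mult_left[OF tendsto_Re[OF char[of u]], of c] show ?case
      by (simp add: M.integral_cos_sin_iexp(1)[OF mX] W.integral_cos_sin_iexp(1)[OF mY])
  next
    case (sin c u)
    from tendsto_mult_left[OF tendsto_Im[OF char[of u]], of c] show ?case
      by (simp add: M.integral_cos_sin_iexp(2)[OF mX] W.integral_cos_sin_iexp(2)[OF mY])
  next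
    case (add p q)
    have iM: "integrable M (\<lambda>\<omega>. r (X n \<omega>))" if r: "trig_poly I r" for n r
    proof -
      obtain B where "\<forall>\<omega>. \<bar>r (X n \<omega>)\<bar> \<le> B" "(\<lambda>\<omega>. r (X n \<omega>)) \<in> borel_measurable M"
        using trig_poly_measurable_bounded[OF r, of "X n" M] X by blast
      then show ?thesis by (intro M.integrable_const_bound[where B=B]) auto
    qed
    have iW: "integrable W (\<lambda>\<omega>. r (Y \<omega>))" if r: "trig_poly I r" for r
    proof -
      obtain B where "\<forall>\<omega>. \<bar>r (Y \<omega>)\<bar> \<le> B" "(\<lambda>\<omega>. r (Y \<omega>)) \<in> borel_measurable W"
        using trig_poly_measurable_bounded[OF r, of Y W] Y by blast
      then show ?thesis by (intro W.integrable_const_bound[where B=B]) auto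
    qed
    from tendsto_add[OF add.IH] show ?case
      using iM[OF add.hyps(1)] iM[OF add.hyps(2)] iW[OF add.hyps(1)] iW[OF add.hyps(2)] by simp
  }
qed

text \<open>Uniformly bounded second moments take the place of tightness: the error of the
  trigonometric approximation is quadratic in the argument, so they bound it in mean, for all
  \<open>n\<close> and for the limit alike.\<close>

lemma multivariate_levy:
  fixes X :: "nat \<Rightarrow> 'a \<Rightarrow> 'i :: countable \<Rightarrow> real" and Y :: "'b \<Rightarrow> 'i \<Rightarrow> real" and \<Phi> :: "('i \<Rightarrow> real) \<Rightarrow> real"
  assumes "prob_space M" "prob_space W" and "finite I"
    and X: "\<And>n i. (\<lambda>\<omega>. X n \<omega> i) \<in> borel_measurable M"
    and Y: "\<And>i. (\<lambda>\<omega>. Y \<omega> i) \<in> borel_measurable W"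
    and char: "\<And>u. (\<lambda>n. \<integral>\<omega>. iexp (\<Sum>i\<in>I. u i * X n \<omega> i) \<partial>M) \<longlonglongrightarrow> (\<integral>\<omega>. iexp (\<Sum>i\<in>I. u i * Y \<omega> i) \<partial>W)"
    and X2: "\<And>n i. i \<in> I \<Longrightarrow> integrable M (\<lambda>\<omega>. (X n \<omega> i)\<^sup>2)" "\<And>n i. i \<in> I \<Longrightarrow> (\<integral>\<omega>. (X n \<omega> i)\<^sup>2 \<partial>M) \<le> C"
    and Y2: "\<And>i. i \<in> I \<Longrightarrow> integrable W (\<lambda>\<omega>. (Y \<omega> i)\<^sup>2)" "\<And>i. i \<in> I \<Longrightarrow> (\<integral>\<omega>. (Y \<omega> i)\<^sup>2 \<partial>W) \<le> C"
    and bdd: "\<And>x. \<bar>\<Phi> x\<bar> \<le> B"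
    and lip: "\<And>x y. \<bar>\<Phi> x - \<Phi> y\<bar> \<le> L * (\<Sum>i\<in>I. \<bar>x i - y i\<bar>)" and "0 \<le> L"
  shows "(\<lambda>n. \<integral>\<omega>. \<Phi> (X n \<omega>) \<partial>M) \<longlonglongrightarrow> (\<integral>\<omega>. \<Phi> (Y \<omega>) \<partial>W)"
proof (rule tendstoI)
  fix e :: real assume "0 < e"
  interpret M: prob_space M by fact
  interpret W: prob_space W by fact
  have [measurable]: "\<Phi> \<in> borel_measurable borel"
    by (rule borel_measurable_continuous_onI[OF continuous_finite_lipschitz[OF lip]])
  \<comment> \<open>Makes \<open>L / R\<close> times the total second moment at most
    \<open>e / 8\<close>. The absolute value covers an empty \<open>I\<close>, where nothing forces
    \<open>C \<ge> 0\<close>; the summand 1 keeps \<open>R\<close> positive.\<close>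
  define R where "R = 8 * (L * (real (card I) * \<bar>C\<bar>) + 1) / e"
  have L1: "0 < L * (real (card I) * \<bar>C\<bar>) + 1" using \<open>0 \<le> L\<close> by (intro add_nonneg_pos mult_nonneg_nonneg) auto
  have R: "0 < R" unfolding R_def using L1 \<open>0 < e\<close> by simp
  have Rle: "L / R * (real (card I) * \<bar>C\<bar>) \<le> e / 8"
    using L1 \<open>0 < e\<close> by (simp add: R_def field_simps)
  obtain p where p: "trig_poly I p" "\<And>x. \<bar>\<Phi> x - p x\<bar> \<le> e / 8 + L / R * (\<Sum>i\<in>I. (x i)\<^sup>2)"
    using trig_poly_approx[OF lip R _ \<open>0 \<le> L\<close> \<open>finite I\<close>, of "e / 8"] \<open>0 < e\<close> by auto
  have key: "\<bar>(\<integral>\<omega>. \<Phi> (Z \<omega>) \<partial>N) - (\<integral>\<omega>. p (Z \<omega>) \<partial>N)\<bar> \<le> e / 4"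
    if "prob_space N" and Z [measurable]: "\<And>i. (\<lambda>\<omega>. Z \<omega> i) \<in> borel_measurable N"
      and Z2: "\<And>i. i \<in> I \<Longrightarrow> integrable N (\<lambda>\<omega>. (Z \<omega> i)\<^sup>2)" "\<And>i. i \<in> I \<Longrightarrow> (\<integral>\<omega>. (Z \<omega> i)\<^sup>2 \<partial>N) \<le> C"
    for N :: "'c measure" and Z :: "'c \<Rightarrow> 'i \<Rightarrow> real"
  proof -
    interpret N: prob_space N by fact
    have [measurable]: "Z \<in> borel_measurable N" by (rule measurable_coordinatewise_then_product) (rule Z)
    have i1: "integrable N (\<lambda>\<omega>. \<Phi> (Z \<omega>))"
      by (rule N.integrable_const_bound[where B=B]) (auto simp: bdd)
    obtain B' where "\<forall>\<omega>. \<bar>p (Z \<omega>)\<bar> \<le> B'" "(\<lambda>\<omega>. p (Z \<omega>)) \<in> borel_measurable N"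
      using trig_poly_measurable_bounded[OF p(1), of Z N] Z by blast
    then have i2: "integrable N (\<lambda>\<omega>. p (Z \<omega>))" by (intro N.integrable_const_bound[where B=B']) auto
    have "\<bar>(\<integral>\<omega>. \<Phi> (Z \<omega>) \<partial>N) - (\<integral>\<omega>. p (Z \<omega>) \<partial>N)\<bar> = \<bar>\<integral>\<omega>. \<Phi> (Z \<omega>) - p (Z \<omega>) \<partial>N\<bar>"
      using i1 i2 by simp
    also have "\<dots> \<le> (\<integral>\<omega>. \<bar>\<Phi> (Z \<omega>) - p (Z \<omega>)\<bar> \<partial>N)" by (rule integral_abs_bound)
    also have "\<dots> \<le> (\<integral>\<omega>. e / 8 + L / R * (\<Sum>i\<in>I. (Z \<omega> i)\<^sup>2) \<partial>N)"
      using i1 i2 Z2(1) by (intro integral_mono p) auto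
    also have "\<dots> = e / 8 + L / R * (\<Sum>i\<in>I. \<integral>\<omega>. (Z \<omega> i)\<^sup>2 \<partial>N)"
      using Z2(1) by (simp add: N.prob_space Bochner_Integration.integral_sum)
    also have "\<dots> \<le> e / 8 + L / R * (\<Sum>i\<in>I. \<bar>C\<bar>)"
      using \<open>0 \<le> L\<close> R
      by (intro add_left_mono mult_left_mono sum_mono order_trans[OF Z2(2) abs_ge_self]) auto
    also have "\<dots> \<le> e / 4"
      unfolding sum_constant using Rle \<open>0 < e\<close> by linarith
    finally show ?thesis .
  qed
  have "(\<lambda>n. \<integral>\<omega>. p (X n \<omega>) \<partial>M) \<longlonglongrightarrow> (\<integral>\<omega>. p (Y \<omega>) \<partial>W)"
    by (rule trig_poly_expectation_tendsto[OF assms(1,2) X Y char p(1)])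
  then have "\<forall>\<^sub>F n in sequentially. dist (\<integral>\<omega>. p (X n \<omega>) \<partial>M) (\<integral>\<omega>. p (Y \<omega>) \<partial>W) < e / 4"
    by (rule tendstoD) (use \<open>0 < e\<close> in simp)
  then show "\<forall>\<^sub>F n in sequentially. dist (\<integral>\<omega>. \<Phi> (X n \<omega>) \<partial>M) (\<integral>\<omega>. \<Phi> (Y \<omega>) \<partial>W) < e"
  proof eventually_elim
    case (elim n)
    have "\<bar>(\<integral>\<omega>. \<Phi> (X n \<omega>) \<partial>M) - (\<integral>\<omega>. p (X n \<omega>) \<partial>M)\<bar> \<le> e / 4"
      by (rule key[OF assms(1) X X2])
    moreover have "\<bar>(\<integral>\<omega>. \<Phi> (Y \<omega>) \<partial>W) - (\<integral>\<omega>. p (Y \<omega>) \<partial>W)\<bar> \<le> e / 4"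
      by (rule key[OF assms(2) Y Y2])
    ultimately show ?case using elim \<open>0 < e\<close> unfolding dist_real_def by linarith
  qed
qed

section \<open>Weak convergence tested on Lipschitz functions\<close>

lemma space_borel_of_top [simp]: "space (borel_of_top T) = topspace T"
  unfolding borel_of_top_def by (rule space_measure_of) (auto dest: openin_subset)

lemma sets_borel_of_top: "sets (borel_of_top T) = sigma_sets (topspace T) {U. openin T U}"
  unfolding borel_of_top_def by (rule sets_measure_of) (auto dest: openin_subset)

lemma measurable_borel_of_top:
  assumes "\<And>x. x \<in> space M \<Longrightarrow> f x \<in> topspace T"
    and "\<And>U. openin T U \<Longrightarrow> f -` U \<inter> space M \<in> sets M"
  shows "f \<in> measurable M (borel_of_top T)"
  unfolding borel_of_top_def
  by (rule measurable_measure_of) (use assms in \<open>auto dest: openin_subset\<close>)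

lemma borel_measurable_continuous_map:
  assumes "continuous_map T euclideanreal F"
  shows "F \<in> borel_measurable (borel_of_top T)"
proof (rule borel_measurableI)
  fix U :: "real set" assume "open U"
  then have "openin T {x \<in> topspace T. F x \<in> U}"
    using assms by (auto simp: continuous_map_def)
  moreover have "F -` U \<inter> space (borel_of_top T) = {x \<in> topspace T. F x \<in> U}" by auto
  ultimately show "F -` U \<inter> space (borel_of_top T) \<in> sets (borel_of_top T)"
    unfolding sets_borel_of_top by (simp add: sigma_sets.Basic)
qed

lemma continuous_map_of_lipschitz:
  fixes m :: "'a metric"
  assumes "\<And>x y. x \<in> mspace m \<Longrightarrow> y \<in> mspace m \<Longrightarrow> \<bar>F x - F y\<bar> \<le> L * mdist m x y"
  shows "continuous_map (mtopology_of m) euclideanreal F"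
proof -
  have "Lipschitz_continuous_map m euclidean_metric F"
    unfolding Lipschitz_continuous_map_def
    using assms by (auto simp: dist_real_def intro!: exI[of _ L])
  from Lipschitz_continuous_imp_continuous_map[OF this] show ?thesis by simp
qed

text \<open>Approximation from below by the Lipschitz functions \<open>x \<mapsto> inf\<^sub>y (F y + k d(x, y))\<close>.\<close>

lemma lipschitz_lower_approx:
  fixes m :: "'a metric"
  assumes F: "continuous_map (mtopology_of m) euclideanreal F"
    and B: "\<And>x. x \<in> mspace m \<Longrightarrow> \<bar>F x\<bar> \<le> B"
  obtains G :: "nat \<Rightarrow> 'a \<Rightarrow> real" where
    "\<And>k x. x \<in> mspace m \<Longrightarrow> \<bar>G k x\<bar> \<le> B" "\<And>k x. x \<in> mspace m \<Longrightarrow> G k x \<le> F x"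
    "\<And>k x y. x \<in> mspace m \<Longrightarrow> y \<in> mspace m \<Longrightarrow> \<bar>G k x - G k y\<bar> \<le> real k * mdist m x y"
    "\<And>x. x \<in> mspace m \<Longrightarrow> (\<lambda>k. G k x) \<longlonglongrightarrow> F x"
proof -
  interpret m: Metric_space "mspace m" "mdist m" by simp
  define G where "G k x = (INF y\<in>mspace m. F y + real k * mdist m x y)" for k x
  have low: "- B \<le> F y + real k * mdist m x y" if "y \<in> mspace m" for x y k
    using B[OF that] m.nonneg[of x y] by (simp add: abs_le_iff add_increasing2)
  have bdd: "bdd_below ((\<lambda>y. F y + real k * mdist m x y) ` mspace m)" for k x
    using low by (auto intro!: bdd_belowI[of _ "- B"])
  have GF: "G k x \<le> F x" if "x \<in> mspace m" for k x
    using cINF_lower[OF bdd that, of k x] that by (simp add: G_def)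
  have GB: "- B \<le> G k x" if "x \<in> mspace m" for k x
    unfolding G_def using that low by (intro cINF_greatest) auto
  have half: "G k x \<le> G k y + real k * mdist m x y" if xy: "x \<in> mspace m" "y \<in> mspace m" for k x y
  proof -
    have "G k x - real k * mdist m x y \<le> G k y"
      unfolding G_def[of k y]
    proof (rule cINF_greatest)
      fix z assume z: "z \<in> mspace m"
      have "G k x \<le> F z + real k * mdist m x z"
        unfolding G_def by (rule cINF_lower[OF bdd z])
      also have "real k * mdist m x z \<le> real k * (mdist m x y + mdist m y z)"
        by (intro mult_left_mono m.triangle xy z) simp
      finally show "G k x - real k * mdist m x y \<le> F z + real k * mdist m y z"
        by (simp add: algebra_simps)
    qed (use xy in auto)
    then show ?thesis by simp
  qed
  have lip: "\<bar>G k x - G k y\<bar> \<le> real k * mdist m x y" if "x \<in> mspace m" "y \<in> mspace m" for k x y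
    using half[OF that, of k] half[OF that(2,1), of k] m.commute[of x y] by (simp add: abs_le_iff)
  have lim: "(\<lambda>k. G k x) \<longlonglongrightarrow> F x" if x: "x \<in> mspace m" for x
  proof (rule LIMSEQ_I)
    fix e :: real assume "0 < e"
    have "\<forall>a\<in>mspace m. \<forall>\<epsilon>>0. \<exists>\<delta>>0. \<forall>y. y \<in> mspace m \<and> mdist m a y < \<delta> \<longrightarrow> dist (F a) (F y) < \<epsilon>"
      using F m.metric_continuous_map[OF Met_TC.Metric_space_axioms, of F]
      unfolding mtopology_of_def by auto
    from bspec[OF this x] half_gt_zero[OF \<open>0 < e\<close>] obtain \<delta> where \<delta>: "0 < \<delta>" "\<And>y. y \<in> mspace m \<Longrightarrow> mdist m x y < \<delta> \<Longrightarrow> dist (F x) (F y) < e / 2" by blast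
    \<comment> \<open>From distance \<open>\<delta>\<close> on, a penalty of slope at least
      \<open>N\<close> amounts to \<open>2 B\<close>, the largest possible drop of
      \<open>F\<close>.\<close>
    obtain N where N: "2 * B / \<delta> \<le> real N" using real_arch_simple by blast
    have "norm (G k x - F x) < e" if "N \<le> k" for k
    proof -
      have "F x - e / 2 \<le> G k x"
        unfolding G_def
      proof (rule cINF_greatest)
        fix y assume y: "y \<in> mspace m"
        show "F x - e / 2 \<le> F y + real k * mdist m x y"
        proof (cases "mdist m x y < \<delta>")
          case True
          have "0 \<le> real k * mdist m x y" using m.nonneg by simp
          moreover have "\<bar>F x - F y\<bar> < e / 2" using \<delta>(2)[OF y True] by (simp add: dist_real_def)
          ultimately show ?thesis by linarith
        next
          case False
          have "2 * B \<le> real N * \<delta>" using N \<open>0 < \<delta>\<close> by (simp add: field_simps)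
          also have "\<dots> \<le> real k * mdist m x y"
            using that False \<open>0 < \<delta>\<close> by (intro mult_mono) auto
          finally show ?thesis using B[OF x] B[OF y] \<open>0 < e\<close> by linarith
        qed
      qed (use x in auto)
      then show ?thesis using GF[OF x, of k] \<open>0 < e\<close> by simp
    qed
    then show "\<exists>N. \<forall>k\<ge>N. norm (G k x - F x) < e" by blast
  qed
  have "\<bar>G k x\<bar> \<le> B" if "x \<in> mspace m" for k x
    using GF[OF that, of k] GB[OF that, of k] B[OF that] by linarith
  with GF lip lim show thesis by (intro that[of G])
qed

text \<open>Approximation from below suffices: it shows that the integrals of \<open>F\<close> are
  eventually not much smaller than the limit, and the same for \<open>- F\<close> is the opposite
  bound.\<close>

lemma weak_conv_top_lipschitz:
  fixes m :: "'a metric"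
  assumes \<mu>s: "\<And>n. prob_space (\<mu>s n)" "\<And>n. sets (\<mu>s n) = sets (borel_of_top (mtopology_of m))"
    and \<mu>: "prob_space \<mu>" "sets \<mu> = sets (borel_of_top (mtopology_of m))"
    and lip: "\<And>F B L. 0 \<le> L \<Longrightarrow> (\<And>x. x \<in> mspace m \<Longrightarrow> \<bar>F x\<bar> \<le> B) \<Longrightarrow>
      (\<And>x y. x \<in> mspace m \<Longrightarrow> y \<in> mspace m \<Longrightarrow> \<bar>F x - F y\<bar> \<le> L * mdist m x y) \<Longrightarrow>
      (\<lambda>n. integral\<^sup>L (\<mu>s n) F) \<longlonglongrightarrow> integral\<^sup>L \<mu> F"
  shows "weak_conv_top (mtopology_of m) \<mu>s \<mu>"
proof -
  let ?T = "mtopology_of m"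
  have sp: "space (\<mu>s n) = mspace m" "space \<mu> = mspace m" for n
    using sets_eq_imp_space_eq[OF \<mu>s(2)[of n]] sets_eq_imp_space_eq[OF \<mu>(2)] by simp_all
  have meas: "H \<in> borel_measurable (\<mu>s n)" "H \<in> borel_measurable \<mu>"
    if "continuous_map ?T euclideanreal H" for H n
    using borel_measurable_continuous_map[OF that]
    by (simp_all only: measurable_cong_sets[OF \<mu>s(2) refl] measurable_cong_sets[OF \<mu>(2) refl])
  have int: "integrable (\<mu>s n) H" "integrable \<mu> H"
    if "continuous_map ?T euclideanreal H" "\<And>x. x \<in> mspace m \<Longrightarrow> \<bar>H x\<bar> \<le> B" for H B n
  proof -
    interpret n: prob_space "\<mu>s n" by fact
    interpret \<mu>: prob_space \<mu> by fact
    show "integrable (\<mu>s n) H" "integrable \<mu> H"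
      using that by (auto intro!: n.integrable_const_bound[where B=B] \<mu>.integrable_const_bound[where B=B] meas AE_I2
        simp: sp)
  qed
  have lower: "\<forall>\<^sub>F n in sequentially. integral\<^sup>L \<mu> F - e < integral\<^sup>L (\<mu>s n) F"
    if F: "continuous_map ?T euclideanreal F" and B: "\<And>x. x \<in> mspace m \<Longrightarrow> \<bar>F x\<bar> \<le> B" and "0 < e" for F B e
  proof -
    interpret \<mu>: prob_space \<mu> by fact
    obtain G :: "nat \<Rightarrow> 'a \<Rightarrow> real" where G: "\<And>k x. x \<in> mspace m \<Longrightarrow> \<bar>G k x\<bar> \<le> B" "\<And>k x. x \<in> mspace m \<Longrightarrow> G k x \<le> F x"
      "\<And>k x y. x \<in> mspace m \<Longrightarrow> y \<in> mspace m \<Longrightarrow> \<bar>G k x - G k y\<bar> \<le> real k * mdist m x y"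
      "\<And>x. x \<in> mspace m \<Longrightarrow> (\<lambda>k. G k x) \<longlonglongrightarrow> F x"
      using lipschitz_lower_approx[OF F B] by blast
    have Gc: "continuous_map ?T euclideanreal (G k)" for k
      by (rule continuous_map_of_lipschitz[OF G(3)])
    have "(\<lambda>k. integral\<^sup>L \<mu> (G k)) \<longlonglongrightarrow> integral\<^sup>L \<mu> F"
      by (rule integral_dominated_convergence[where w="\<lambda>_. B"])
         (use G in \<open>auto intro!: meas F Gc AE_I2 simp: sp\<close>)
    then have "\<forall>\<^sub>F k in sequentially. integral\<^sup>L \<mu> F - e / 2 < integral\<^sup>L \<mu> (G k)"
      using \<open>0 < e\<close> by (intro order_tendstoD) auto
    then obtain k where k: "integral\<^sup>L \<mu> F - e / 2 < integral\<^sup>L \<mu> (G k)"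
      by (auto simp: eventually_sequentially)
    have "(\<lambda>n. integral\<^sup>L (\<mu>s n) (G k)) \<longlonglongrightarrow> integral\<^sup>L \<mu> (G k)"
      by (rule lip[OF _ G(1) G(3)]) auto
    then have "\<forall>\<^sub>F n in sequentially. integral\<^sup>L \<mu> (G k) - e / 2 < integral\<^sup>L (\<mu>s n) (G k)"
      using \<open>0 < e\<close> by (intro order_tendstoD) auto
    then show ?thesis
    proof eventually_elim
      case (elim n)
      have "integral\<^sup>L (\<mu>s n) (G k) \<le> integral\<^sup>L (\<mu>s n) F"
        using G(2) by (intro integral_mono int(1)[OF F B] int(1)[OF Gc G(1)]) (auto simp: sp)
      then show ?case using elim k by linarith
    qed
  qed
  show ?thesis
    unfolding weak_conv_top_def
  proof (intro conjI allI impI \<mu>s \<mu>)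
    fix F assume F: "continuous_map ?T euclideanreal F \<and> bounded (F ` topspace ?T)"
    then obtain B where B: "\<And>x. x \<in> mspace m \<Longrightarrow> \<bar>F x\<bar> \<le> B" by (auto simp: bounded_iff)
    have Fc: "continuous_map ?T euclideanreal F" using F ..
    have "continuous_map euclideanreal euclideanreal (uminus :: real \<Rightarrow> real)"
      by (simp add: continuous_on_minus)
    from continuous_map_compose[OF Fc this]
    have Fc': "continuous_map ?T euclideanreal (\<lambda>x. - F x)" by (simp add: comp_def)
    show "(\<lambda>n. integral\<^sup>L (\<mu>s n) F) \<longlonglongrightarrow> integral\<^sup>L \<mu> F"
    proof (rule tendstoI)
      fix e :: real assume "0 < e"
      have "\<forall>\<^sub>F n in sequentially. integral\<^sup>L \<mu> (\<lambda>x. - F x) - e < integral\<^sup>L (\<mu>s n) (\<lambda>x. - F x)"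
        by (rule lower[OF Fc' _ \<open>0 < e\<close>, of B]) (simp add: B)
      moreover have "\<forall>\<^sub>F n in sequentially. integral\<^sup>L \<mu> F - e < integral\<^sup>L (\<mu>s n) F"
        by (rule lower[OF Fc _ \<open>0 < e\<close>, of B]) (simp add: B)
      ultimately show "\<forall>\<^sub>F n in sequentially. dist (integral\<^sup>L (\<mu>s n) F) (integral\<^sup>L \<mu> F) < e"
        by eventually_elim (simp add: dist_real_def abs_less_iff)
    qed
  qed
qed

section \<open>Bilinear interpolation and the space of continuous functions on the square\<close>

text \<open>For \<open>x \<ge> 0\<close> this is the length of
  \<open>[0, x] \<inter> (k, k + 1]\<close>, the one-dimensional factor of a cell area, with cells
  numbered from 0.\<close>

definition ramp :: "real \<Rightarrow> nat \<Rightarrow> real" where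
  "ramp x k = max 0 (min 1 (x - real k))"

text \<open>The piecewise linear hat centred at \<open>i\<close>, written as a difference of ramps
  so that sums telescope.\<close>

definition tent :: "real \<Rightarrow> nat \<Rightarrow> real" where
  "tent x i = ramp (x + 1) i - ramp x i"

lemma ramp_bounds [simp]: "0 \<le> ramp x k" "ramp x k \<le> 1"
  by (auto simp: ramp_def)

lemma ramp_Suc: "ramp (x + 1) (Suc k) = ramp x k"
  by (simp add: ramp_def)

lemma ramp_eq_0: "x \<le> real k \<Longrightarrow> ramp x k = 0"
  by (simp add: ramp_def)

lemma ramp_eq_1: "real k + 1 \<le> x \<Longrightarrow> ramp x k = 1"
  by (simp add: ramp_def)

lemma tent_nonneg [simp]: "0 \<le> tent x i"
  by (auto simp: tent_def ramp_def max_def min_def)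

lemma tent_le_1: "tent x i \<le> 1"
  using ramp_bounds(2)[of "x + 1" i] ramp_bounds(1)[of x i] unfolding tent_def by linarith

lemma tent_support: "tent x i \<noteq> 0 \<Longrightarrow> \<bar>x - real i\<bar> \<le> 1"
  by (auto simp: tent_def ramp_def max_def min_def split: if_splits)

lemma sum_tent: "0 \<le> x \<Longrightarrow> (\<Sum>i\<le>w. tent x i) = 1 - ramp x w"
  by (induction w) (auto simp: tent_def ramp_Suc ramp_eq_1)

text \<open>Summation by parts: ramp weights on summands are hat weights on partial sums. On
  \<open>[0, w]\<close> the hats are nonnegative with sum 1, so smoothed sums are convex
  combinations of partial sums and inherit their bounds.\<close>

lemma ramp_abel: "(\<Sum>k<w. ramp x k * c k) = (\<Sum>i\<le>w. tent x i * (\<Sum>k<i. c k)) + ramp x w * (\<Sum>k<w. c k)"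
proof (induction w)
  case (Suc w)
  have "tent x (Suc w) + ramp x (Suc w) = ramp x w"
    by (simp add: tent_def ramp_Suc)
  then have *: "tent x (Suc w) * S + ramp x (Suc w) * S = ramp x w * S" for S
    by (metis distrib_right)
  from Suc *[of "sum c {..<w}"] *[of "c w"] show ?case by (simp add: distrib_left)
qed simp

lemma ramp_sum_bound:
  fixes c :: "nat \<Rightarrow> real"
  assumes "0 \<le> x" "x \<le> real w" and M: "\<And>i. i \<le> w \<Longrightarrow> \<bar>\<Sum>k<i. c k\<bar> \<le> M"
  shows "\<bar>\<Sum>k<w. ramp x k * c k\<bar> \<le> M"
proof -
  have "(\<Sum>k<w. ramp x k * c k) = (\<Sum>i\<le>w. tent x i * (\<Sum>k<i. c k))"
    using ramp_abel[of x c w] assms by (simp add: ramp_eq_0)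
  also have "\<bar>\<dots>\<bar> \<le> (\<Sum>i\<le>w. tent x i * M)"
    using M by (intro order_trans[OF sum_abs] sum_mono) (auto simp: abs_mult intro!: mult_left_mono)
  also have "\<dots> = M"
    using sum_tent[OF assms(1), of w] assms by (simp add: ramp_eq_0 flip: sum_distrib_right)
  finally show ?thesis .
qed

text \<open>By \<open>ramp_abel\<close> in each variable, this is the bilinear interpolation at
  \<open>(x, y)\<close> of the partial sums of \<open>c\<close> over initial rectangles, as long as
  \<open>(x, y)\<close> lies in \<open>[0, a] \<times> [0, b]\<close>.\<close>

definition bilin :: "(nat \<Rightarrow> nat \<Rightarrow> real) \<Rightarrow> nat \<Rightarrow> nat \<Rightarrow> real \<Rightarrow> real \<Rightarrow> real" where
  "bilin c a b x y = (\<Sum>k<a. ramp x k * (\<Sum>l<b. ramp y l * c k l))"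

lemma bilin_swap: "bilin c a b x y = bilin (\<lambda>l k. c k l) b a y x"
  unfolding bilin_def sum_distrib_left
  by (subst sum.swap) (simp add: mult_ac)

lemma bilin_bound:
  assumes "0 \<le> x" "x \<le> real a" "0 \<le> y" "y \<le> real b"
    and M: "\<And>i j. i \<le> a \<Longrightarrow> j \<le> b \<Longrightarrow> \<bar>\<Sum>k<i. \<Sum>l<j. c k l\<bar> \<le> M"
  shows "\<bar>bilin c a b x y\<bar> \<le> M"
  unfolding bilin_def
proof (rule ramp_sum_bound[OF assms(1,2)])
  fix i assume "i \<le> a"
  have "(\<Sum>k<i. \<Sum>l<b. ramp y l * c k l) = (\<Sum>l<b. ramp y l * (\<Sum>k<i. c k l))"
    unfolding sum_distrib_left by (rule sum.swap)
  also have "\<bar>\<dots>\<bar> \<le> M"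
  proof (rule ramp_sum_bound[OF assms(3,4)])
    fix j assume "j \<le> b"
    then show "\<bar>\<Sum>l<j. \<Sum>k<i. c k l\<bar> \<le> M"
      using M[OF \<open>i \<le> a\<close>, of j] by (subst sum.swap) simp
  qed
  finally show "\<bar>\<Sum>k<i. \<Sum>l<b. ramp y l * c k l\<bar> \<le> M" .
qed

text \<open>At an integer \<open>p\<close> the ramps are 0 or 1, so the difference involves only the
  rows from \<open>p\<close> to \<open>p + w - 1\<close> and is itself a bilinear interpolation, of
  the field shifted by \<open>p\<close>. Increments are thus bounded by maxima over a strip.\<close>

lemma bilin_increment:
  assumes x: "real p \<le> x" "x \<le> real (p + w)" "x \<le> real a" and y: "0 \<le> y" "y \<le> real b"
    and M: "\<And>i j. i \<le> w \<Longrightarrow> j \<le> b \<Longrightarrow> \<bar>\<Sum>k<i. \<Sum>l<j. c (p + k) l\<bar> \<le> M"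
  shows "\<bar>bilin c a b x y - bilin c a b (real p) y\<bar> \<le> M"
proof -
  define d where "d k = (\<Sum>l<b. ramp y l * c k l)" for k
  have "bilin c a b x y - bilin c a b (real p) y = (\<Sum>k<a. (ramp x k - ramp (real p) k) * d k)"
    by (simp add: bilin_def d_def sum_subtractf left_diff_distrib)
  also have "\<dots> = (\<Sum>k\<in>{p..<p + w}. ramp x k * d k)"
  proof (rule sum.mono_neutral_cong)
    show "(ramp x k - ramp (real p) k) * d k = 0" if "k \<in> {..<a} - {p..<p + w}" for k
    proof (cases "k < p")
      case True
      then have "ramp x k = 1" "ramp (real p) k = 1" using x by (auto intro!: ramp_eq_1)
      then show ?thesis by simp
    next
      case False
      then have "ramp x k = 0" "ramp (real p) k = 0" using x that by (auto intro!: ramp_eq_0)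
      then show ?thesis by simp
    qed
    show "ramp x k * d k = 0" if "k \<in> {p..<p + w} - {..<a}" for k
      using that x by (simp add: ramp_eq_0)
    show "(ramp x k - ramp (real p) k) * d k = ramp x k * d k" if "k \<in> {..<a} \<inter> {p..<p + w}" for k
      using that by (simp add: ramp_eq_0)
  qed auto
  also have "\<dots> = (\<Sum>k<w. ramp x (p + k) * d (p + k))"
    by (rule sum.reindex_bij_witness[of _ "\<lambda>k. p + k" "\<lambda>k. k - p"]) auto
  also have "\<dots> = bilin (\<lambda>k. c (p + k)) w b (x - real p) y"
    by (simp add: bilin_def d_def ramp_def algebra_simps)
  also have "\<bar>\<dots>\<bar> \<le> M"
    by (rule bilin_bound) (use x y M in auto)
  finally show ?thesis .
qed

text \<open>\<open>t\<close> and the neighbouring grid point \<open>q / N\<close> lie in a common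
  interval \<open>[j / N, (j + 1) / N]\<close>, the last one if \<open>q = N\<close>. A strip has to
  start at an integer, here \<open>a * j div N\<close>; the extra 1 in its width pays for the
  rounding.\<close>

lemma grid_cell:
  fixes a N q w :: nat and t :: real
  assumes "0 < N" "0 \<le> t" "t \<le> 1" "q \<le> N" "\<bar>real N * t - real q\<bar> \<le> 1" and w: "real a / real N + 1 \<le> real w"
  shows "\<exists>j<N. real (a * j div N) \<le> real a * t \<and> real a * t \<le> real (a * j div N + w) \<and>
     real (a * j div N) \<le> real a * (real q / real N) \<and> real a * (real q / real N) \<le> real (a * j div N + w)"
proof -
  have "\<exists>j<N. real j \<le> real N * t \<and> real N * t \<le> real j + 1 \<and> j \<le> q \<and> q \<le> j + 1"
  proof (cases "real q \<le> real N * t")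
    case True
    show ?thesis
    proof (cases "q < N")
      case False
      then have "q = N" using assms by simp
      moreover have "real N * t \<le> real N" using assms by (simp add: mult_left_le)
      ultimately show ?thesis using True \<open>0 < N\<close> by (intro exI[of _ "N - 1"]) auto
    qed (use True assms in \<open>auto intro!: exI[of _ q]\<close>)
  next
    case False
    have "0 < q" using False assms by (cases q) (auto simp: not_le mult_less_0_iff)
    then show ?thesis using False assms by (intro exI[of _ "q - 1"]) auto
  qed
  then obtain j where j: "j < N" "real j \<le> real N * t" "real N * t \<le> real j + 1" "j \<le> q" "q \<le> j + 1" by blast
  have "real a * real j = real N * real (a * j div N) + real (a * j mod N)"
    using mult_div_mod_eq[of N "a * j"] by (metis of_nat_add of_nat_mult)
  moreover have "real (a * j mod N) \<le> real N" using \<open>0 < N\<close> by (simp add: less_imp_le)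
  ultimately have lo: "real (a * j div N) \<le> real a * real j / real N"
    and "real a * real j / real N \<le> real (a * j div N) + 1"
    using \<open>0 < N\<close> by (simp_all add: field_simps)
  note this(2)
  moreover have "real a * (real j + 1) / real N = real a * real j / real N + real a / real N"
    by (simp add: add_divide_distrib algebra_simps)
  ultimately have hi: "real a * (real j + 1) / real N \<le> real (a * j div N + w)"
    using w by simp
  have mid: "real (a * j div N) \<le> real a * s \<and> real a * s \<le> real (a * j div N + w)"
    if "real j \<le> real N * s" "real N * s \<le> real j + 1" for s
  proof -
    have "real j / real N \<le> s" "s \<le> (real j + 1) / real N"
      using that \<open>0 < N\<close> by (simp_all add: field_simps)
    then have "real a * (real j / real N) \<le> real a * s \<and> real a * s \<le> real a * ((real j + 1) / real N)"
      by (intro conjI mult_left_mono) auto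
    then show ?thesis using lo hi by simp
  qed
  have "real j \<le> real N * (real q / real N)" "real N * (real q / real N) \<le> real j + 1"
    using j \<open>0 < N\<close> by auto
  from mid[OF j(2,3)] mid[OF this] j(1) show ?thesis by blast
qed

text \<open>From one point to the other, the first variable moves through the left end of its strip
  and then the second one does the same. Each strip is used twice, whence the factors 2. The strips
  depend only on the cell, so \<open>2 N\<close> of them serve all points.\<close>

lemma bilin_grid_modulus:
  fixes a b N w1 w2 q1 q2 :: nat and t1 t2 :: real
  assumes N: "0 < N" and w1: "real a / real N + 1 \<le> real w1" and w2: "real b / real N + 1 \<le> real w2"
    and t: "0 \<le> t1" "t1 \<le> 1" "0 \<le> t2" "t2 \<le> 1" and q: "q1 \<le> N" "q2 \<le> N"
    and near: "\<bar>real N * t1 - real q1\<bar> \<le> 1" "\<bar>real N * t2 - real q2\<bar> \<le> 1"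
    and M1: "\<And>m i j. m < N \<Longrightarrow> i \<le> w1 \<Longrightarrow> j \<le> b \<Longrightarrow> \<bar>\<Sum>k<i. \<Sum>l<j. c (a * m div N + k) l\<bar> \<le> M1 m"
    and M2: "\<And>m i j. m < N \<Longrightarrow> i \<le> a \<Longrightarrow> j \<le> w2 \<Longrightarrow> \<bar>\<Sum>k<i. \<Sum>l<j. c k (b * m div N + l)\<bar> \<le> M2 m"
  obtains m1 m2 where "m1 < N" "m2 < N"
    "\<bar>bilin c a b (real a * t1) (real b * t2) - bilin c a b (real a * (real q1 / real N)) (real b * (real q2 / real N))\<bar>
      \<le> 2 * M1 m1 + 2 * M2 m2"
proof -
  have le: "real d * s \<le> real d" if "s \<le> 1" for d s using that by (simp add: mult_left_le)
  have qN: "real q1 / real N \<le> 1" "real q2 / real N \<le> 1" using q N by simp_all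
  obtain m1 where m1: "m1 < N" "real (a * m1 div N) \<le> real a * t1" "real a * t1 \<le> real (a * m1 div N + w1)"
     "real (a * m1 div N) \<le> real a * (real q1 / real N)" "real a * (real q1 / real N) \<le> real (a * m1 div N + w1)"
    using grid_cell[OF N t(1,2) q(1) near(1) w1] by blast
  obtain m2 where m2: "m2 < N" "real (b * m2 div N) \<le> real b * t2" "real b * t2 \<le> real (b * m2 div N + w2)"
     "real (b * m2 div N) \<le> real b * (real q2 / real N)" "real b * (real q2 / real N) \<le> real (b * m2 div N + w2)"
    using grid_cell[OF N t(3,4) q(2) near(2) w2] by blast
  let ?pa = "real (a * m1 div N)" and ?pb = "real (b * m2 div N)"
  let ?x = "real a * t1" and ?y = "real b * t2"
  let ?xq = "real a * (real q1 / real N)" and ?yq = "real b * (real q2 / real N)"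
  have y: "0 \<le> ?y" "?y \<le> real b" using t le by auto
  have x0: "0 \<le> ?xq" "?xq \<le> real a" by (simp, rule le[OF qN(1)])
  have y0: "?yq \<le> real b" by (rule le[OF qN(2)])
  have 1: "\<bar>bilin c a b ?x ?y - bilin c a b ?pa ?y\<bar> \<le> M1 m1"
    by (rule bilin_increment[OF m1(2,3) _ y M1[OF m1(1)]]) (use le t in auto)
  have 2: "\<bar>bilin c a b ?xq ?y - bilin c a b ?pa ?y\<bar> \<le> M1 m1"
    by (rule bilin_increment[OF m1(4,5) x0(2) y M1[OF m1(1)]])
  have M2': "\<bar>\<Sum>l<j. \<Sum>k<i. c k (b * m2 div N + l)\<bar> \<le> M2 m2" if "j \<le> w2" "i \<le> a" for i j
    using M2[OF m2(1) that(2,1)] by (subst sum.swap) simp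
  have 3: "\<bar>bilin c a b ?xq ?y - bilin c a b ?xq ?pb\<bar> \<le> M2 m2"
    unfolding bilin_swap[of c]
    by (rule bilin_increment[OF m2(2,3) _ x0 M2']) (use le t in auto)
  have 4: "\<bar>bilin c a b ?xq ?yq - bilin c a b ?xq ?pb\<bar> \<le> M2 m2"
    unfolding bilin_swap[of c]
    by (rule bilin_increment[OF m2(4,5) y0 x0 M2'])
  have "\<bar>bilin c a b ?x ?y - bilin c a b ?xq ?yq\<bar> \<le> 2 * M1 m1 + 2 * M2 m2"
    using 1 2 3 4 by linarith
  with m1(1) m2(1) that show thesis by blast
qed

lemma sum_ramp: "0 \<le> x \<Longrightarrow> (\<Sum>k<a. ramp x k) = min x (real a)"
proof (induction a)
  case (Suc a)
  then show ?case by (auto simp: ramp_def min_def max_def)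
qed auto

text \<open>The product of two ramps equals the ramp at the smaller argument except in the one cell
  containing that argument, where the error is at most 1.\<close>

lemma sum_ramp_mult:
  assumes "0 \<le> x" "x \<le> real a" "0 \<le> y" "y \<le> real a"
  shows "\<bar>(\<Sum>k<a. ramp x k * ramp y k) - min x y\<bar> \<le> 1"
proof -
  have *: "\<bar>(\<Sum>k<a. ramp x k * ramp y k) - x\<bar> \<le> 1" if "0 \<le> x" "x \<le> y" "x \<le> real a" for x y
  proof -
    have "x - (\<Sum>k<a. ramp x k * ramp y k) = (\<Sum>k<a. ramp x k * (1 - ramp y k))"
      using sum_ramp[OF that(1), of a] that by (simp add: right_diff_distrib sum_subtractf)
    moreover have "(\<Sum>k<a. ramp x k * (1 - ramp y k)) \<le> (\<Sum>k<a. if k = nat \<lfloor>x\<rfloor> then 1 else 0)"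
    proof (rule sum_mono)
      fix k assume "k \<in> {..<a}"
      show "ramp x k * (1 - ramp y k) \<le> (if k = nat \<lfloor>x\<rfloor> then 1 else 0)"
      proof (cases "k = nat \<lfloor>x\<rfloor>")
        case True
        then show ?thesis by (simp add: mult_le_one)
      next
        case False
        then have "x \<le> real k \<or> real k + 1 \<le> x"
          using that(1) by linarith
        then have "ramp x k = 0 \<or> ramp y k = 1"
          using that by (auto intro: ramp_eq_0 ramp_eq_1)
        then show ?thesis using False by auto
      qed
    qed
    moreover have "(\<Sum>k<a. if k = nat \<lfloor>x\<rfloor> then 1 else 0 :: real) \<le> 1" by simp
    moreover have "0 \<le> (\<Sum>k<a. ramp x k * (1 - ramp y k))"
      by (intro sum_nonneg mult_nonneg_nonneg) auto
    ultimately show ?thesis by linarith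
  qed
  show ?thesis
  proof (cases "x \<le> y")
    case True
    then show ?thesis using *[of x y] assms by simp
  next
    case False
    then show ?thesis using *[of y x] assms by (simp add: mult.commute min_def)
  qed
qed

lemma sum_ramp_mult_tendsto:
  assumes m: "filterlim m at_top sequentially" and st: "0 \<le> s" "s \<le> 1" "0 \<le> t" "t \<le> 1"
  shows "(\<lambda>n. (\<Sum>k<m n. ramp (real (m n) * s) k * ramp (real (m n) * t) k) / real (m n)) \<longlonglongrightarrow> min s t"
proof (rule LIM_zero_cancel, rule Lim_null_comparison)
  have mr: "filterlim (\<lambda>n. real (m n)) at_top sequentially"
    by (rule filterlim_compose[OF filterlim_real_sequentially m])
  show "(\<lambda>n. 1 / real (m n)) \<longlonglongrightarrow> 0"
    by (rule tendsto_divide_0[OF tendsto_const filterlim_at_top_imp_at_infinity[OF mr]])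
  have "eventually (\<lambda>n. 0 < m n) sequentially"
    by (rule eventually_compose_filterlim[OF eventually_gt_at_top m])
  then show "\<forall>\<^sub>F n in sequentially. norm ((\<Sum>k<m n. ramp (real (m n) * s) k * ramp (real (m n) * t) k) / real (m n) - min s t) \<le> 1 / real (m n)"
  proof eventually_elim
    case (elim n)
    let ?A = "\<Sum>k<m n. ramp (real (m n) * s) k * ramp (real (m n) * t) k"
    have "min (real (m n) * s) (real (m n) * t) = real (m n) * min s t"
      by (simp add: min_mult_distrib_left)
    moreover have "\<bar>?A - min (real (m n) * s) (real (m n) * t)\<bar> \<le> 1"
      using st by (intro sum_ramp_mult) (auto simp: mult_left_le)
    moreover have "?A / real (m n) - min s t = (?A - real (m n) * min s t) / real (m n)"
      using elim by (simp add: field_simps)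
    ultimately show ?case by (simp add: abs_divide divide_right_mono)
  qed
qed

section \<open>Continuous paths on the unit square\<close>

abbreviation C_metric :: "(real \<times> real \<Rightarrow> real) metric" where
  "C_metric \<equiv> cfunspace (top_of_set unit_square) euclidean_metric"

lemma C_square_eq: "C_square = mtopology_of C_metric"
  by (simp add: C_square_def)

lemma compact_unit_square: "compact unit_square"
  unfolding unit_square_def by (intro compact_Times compact_Icc)

lemma unit_square_iff: "t \<in> unit_square \<longleftrightarrow> 0 \<le> fst t \<and> fst t \<le> 1 \<and> 0 \<le> snd t \<and> snd t \<le> 1"
  by (auto simp: unit_square_def mem_Times_iff)

text \<open>Compactness of the square makes boundedness automatic.\<close>

lemma C_mspace_iff: "w \<in> mspace C_metric \<longleftrightarrow> w \<in> extensional unit_square \<and> continuous_on unit_square w"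
proof -
  have "compactin (top_of_set unit_square) (topspace (top_of_set unit_square))"
    using compact_unit_square by (simp add: compactin_subtopology)
  from compactin_mspace_cfunspace[OF this, of "euclidean_metric :: real metric"] show ?thesis
    by (simp del: mspace_cfunspace)
qed

lemma restrict_C_mspace: "continuous_on unit_square w \<Longrightarrow> restrict w unit_square \<in> mspace C_metric"
  unfolding C_mspace_iff by (auto simp: restrict_extensional cong: continuous_on_cong)

lemma C_mdist_le:
  assumes "0 \<le> B" "\<And>t. t \<in> unit_square \<Longrightarrow> \<bar>v t - w t\<bar> \<le> B"
  shows "mdist C_metric v w \<le> B"
  by (rule mdist_cfunspace_le) (use assms in \<open>auto simp: dist_real_def\<close>)

lemma C_mdist_ge:
  assumes "v \<in> mspace C_metric" "w \<in> mspace C_metric" "t \<in> unit_square"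
  shows "\<bar>v t - w t\<bar> \<le> mdist C_metric v w"
  using cfunspace_mdist_le[OF assms(1,2), of "mdist C_metric v w"] assms(3)
  by (auto simp: dist_real_def)

text \<open>Normalized paths and grid interpolants are both combinations of finitely many fixed
  continuous functions with random coefficients, so membership, Lipschitz bounds and measurability
  are settled once for this form.\<close>

definition comb :: "'i set \<Rightarrow> ('i \<Rightarrow> real \<times> real \<Rightarrow> real) \<Rightarrow> ('i \<Rightarrow> real) \<Rightarrow> real \<times> real \<Rightarrow> real" where
  "comb I \<psi> x = restrict (\<lambda>t. \<Sum>i\<in>I. x i * \<psi> i t) unit_square"

lemma comb_mspace:
  assumes "\<And>i. i \<in> I \<Longrightarrow> continuous_on unit_square (\<psi> i)"
  shows "comb I \<psi> x \<in> mspace C_metric"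
  unfolding comb_def by (intro restrict_C_mspace continuous_intros assms)

lemma comb_mdist_le:
  assumes "\<And>i t. i \<in> I \<Longrightarrow> t \<in> unit_square \<Longrightarrow> \<bar>\<psi> i t\<bar> \<le> K"
  shows "mdist C_metric (comb I \<psi> x) (comb I \<psi> y) \<le> K * (\<Sum>i\<in>I. \<bar>x i - y i\<bar>)"
proof (rule C_mdist_le)
  have le: "\<bar>comb I \<psi> x t - comb I \<psi> y t\<bar> \<le> K * (\<Sum>i\<in>I. \<bar>x i - y i\<bar>)" if "t \<in> unit_square" for t
  proof -
    have "comb I \<psi> x t - comb I \<psi> y t = (\<Sum>i\<in>I. (x i - y i) * \<psi> i t)"
      using that by (simp add: comb_def left_diff_distrib sum_subtractf)
    also have "\<bar>\<dots>\<bar> \<le> (\<Sum>i\<in>I. K * \<bar>x i - y i\<bar>)"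
    proof (intro order_trans[OF sum_abs] sum_mono)
      fix i assume "i \<in> I"
      show "\<bar>(x i - y i) * \<psi> i t\<bar> \<le> K * \<bar>x i - y i\<bar>"
        unfolding abs_mult mult.commute[of K] using assms[OF \<open>i \<in> I\<close> that] by (intro mult_left_mono) auto
    qed
    finally show ?thesis by (simp add: sum_distrib_left)
  qed
  have "(0, 0) \<in> unit_square" by (simp add: unit_square_iff)
  from order_trans[OF abs_ge_zero le[OF this]] show "0 \<le> K * (\<Sum>i\<in>I. \<bar>x i - y i\<bar>)" .
  show "\<bar>comb I \<psi> x t - comb I \<psi> y t\<bar> \<le> K * (\<Sum>i\<in>I. \<bar>x i - y i\<bar>)" if "t \<in> unit_square" for t
    by (rule le[OF that])
qed

text \<open>The path depends continuously on its coefficient vector, so open sets of paths pull back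
  to open sets of coefficients. The index type is countable so that Borel measurability of the
  vector reduces to its coordinates.\<close>

lemma comb_measurable:
  fixes x :: "'i :: countable \<Rightarrow> 'a \<Rightarrow> real"
  assumes cont: "\<And>i. i \<in> I \<Longrightarrow> continuous_on unit_square (\<psi> i)"
    and K: "\<And>i t. i \<in> I \<Longrightarrow> t \<in> unit_square \<Longrightarrow> \<bar>\<psi> i t\<bar> \<le> K"
    and x: "\<And>i. x i \<in> borel_measurable M"
  shows "(\<lambda>\<omega>. comb I \<psi> (\<lambda>i. x i \<omega>)) \<in> measurable M (borel_of_top C_square)"
proof (rule measurable_borel_of_top)
  interpret C: Metric_space "mspace C_metric" "mdist C_metric" by (rule Metric_space_mspace_mdist)
  show "comb I \<psi> (\<lambda>i. x i \<omega>) \<in> topspace C_square" for \<omega>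
    unfolding C_square_eq topspace_mtopology_of by (rule comb_mspace[OF cont])
  fix U assume U: "openin C_square U"
  have "open {y. comb I \<psi> y \<in> U}"
  proof (subst open_subopen, safe)
    fix y assume "comb I \<psi> y \<in> U"
    then obtain r where r: "0 < r" "C.mball (comb I \<psi> y) r \<subseteq> U"
      using U unfolding C_square_eq mtopology_of_def C.openin_mtopology by blast
    have cont_sum: "continuous_on UNIV (\<lambda>y'. K * (\<Sum>i\<in>I. \<bar>y i - y' i\<bar>))"
      by (intro continuous_on_mult_left continuous_on_sum continuous_on_rabs continuous_on_diff continuous_on_const) simp
    have "open {y'. K * (\<Sum>i\<in>I. \<bar>y i - y' i\<bar>) < r}"
      using open_Collect_less[OF cont_sum continuous_on_const[of UNIV r]] .
    moreover have "{y'. K * (\<Sum>i\<in>I. \<bar>y i - y' i\<bar>) < r} \<subseteq> {y. comb I \<psi> y \<in> U}"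
    proof safe
      fix y' assume "K * (\<Sum>i\<in>I. \<bar>y i - y' i\<bar>) < r"
      then have "mdist C_metric (comb I \<psi> y) (comb I \<psi> y') < r"
        using comb_mdist_le[where x=y and y=y', OF K] by (rule le_less_trans[rotated])
      then have "comb I \<psi> y' \<in> C.mball (comb I \<psi> y) r"
        unfolding C.in_mball by (intro conjI comb_mspace cont)
      then show "comb I \<psi> y' \<in> U" using r(2) by blast
    qed
    moreover have "y \<in> {y'. K * (\<Sum>i\<in>I. \<bar>y i - y' i\<bar>) < r}" using r(1) by simp
    ultimately show "\<exists>T. open T \<and> y \<in> T \<and> T \<subseteq> {y. comb I \<psi> y \<in> U}" by blast
  qed
  then have "{y. comb I \<psi> y \<in> U} \<in> sets borel" by simp
  moreover have "(\<lambda>\<omega>. \<lambda>i. x i \<omega>) \<in> borel_measurable M"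
    by (rule measurable_coordinatewise_then_product) (rule x)
  ultimately have "(\<lambda>\<omega>. \<lambda>i. x i \<omega>) -` {y. comb I \<psi> y \<in> U} \<inter> space M \<in> sets M"
    by (rule measurable_sets[rotated])
  then show "(\<lambda>\<omega>. comb I \<psi> (\<lambda>i. x i \<omega>)) -` U \<inter> space M \<in> sets M"
    by (simp add: vimage_def)
qed

lemma eval_measurable:
  assumes "sets W = sets (borel_of_top C_square)" "t \<in> unit_square"
  shows "(\<lambda>w. w t) \<in> borel_measurable W"
proof -
  have "continuous_map (mtopology_of C_metric) euclideanreal (\<lambda>w. w t)"
    by (rule continuous_map_of_lipschitz[where L=1]) (use C_mdist_ge assms(2) in simp)
  from borel_measurable_continuous_map[OF this] show ?thesis
    by (simp only: C_square_eq[symmetric] measurable_cong_sets[OF assms(1) refl])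
qed

lemma scale_measurable:
  assumes "sets W = sets (borel_of_top C_square)"
  shows "(\<lambda>w. restrict (\<lambda>t. c * w t) unit_square) \<in> measurable W (borel_of_top C_square)"
proof (rule measurable_borel_of_top)
  have sp: "space W = mspace C_metric"
    using sets_eq_imp_space_eq[OF assms] by (simp add: C_square_eq)
  have ms: "restrict (\<lambda>t. c * w t) unit_square \<in> mspace C_metric" if "w \<in> mspace C_metric" for w
    using that by (intro restrict_C_mspace continuous_intros) (simp add: C_mspace_iff)
  then show "restrict (\<lambda>t. c * w t) unit_square \<in> topspace C_square" if "w \<in> space W" for w
    using that by (simp only: sp C_square_eq topspace_mtopology_of)
  fix U assume U: "openin C_square U"
  have "Lipschitz_continuous_map C_metric C_metric (\<lambda>w. restrict (\<lambda>t. c * w t) unit_square)"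
    unfolding Lipschitz_continuous_map_def
  proof (intro conjI exI[of _ "\<bar>c\<bar>"] ballI)
    show "(\<lambda>w. restrict (\<lambda>t. c * w t) unit_square) \<in> mspace C_metric \<rightarrow> mspace C_metric" using ms by blast
    fix v w assume vw: "v \<in> mspace C_metric" "w \<in> mspace C_metric"
    interpret C: Metric_space "mspace C_metric" "mdist C_metric" by (rule Metric_space_mspace_mdist)
    show "mdist C_metric (restrict (\<lambda>t. c * v t) unit_square) (restrict (\<lambda>t. c * w t) unit_square) \<le> \<bar>c\<bar> * mdist C_metric v w"
    proof (rule C_mdist_le)
      show "0 \<le> \<bar>c\<bar> * mdist C_metric v w" by (intro mult_nonneg_nonneg C.nonneg) simp
      show "\<bar>restrict (\<lambda>t. c * v t) unit_square t - restrict (\<lambda>t. c * w t) unit_square t\<bar> \<le> \<bar>c\<bar> * mdist C_metric v w"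
        if "t \<in> unit_square" for t
        using mult_left_mono[OF C_mdist_ge[OF vw that], of "\<bar>c\<bar>"] that
        by (simp flip: right_diff_distrib add: abs_mult)
    qed
  qed
  then have "continuous_map C_square C_square (\<lambda>w. restrict (\<lambda>t. c * w t) unit_square)"
    unfolding C_square_eq by (rule Lipschitz_continuous_imp_continuous_map)
  then have "openin C_square {w \<in> topspace C_square. restrict (\<lambda>t. c * w t) unit_square \<in> U}"
    using U by (rule openin_continuous_map_preimage)
  then have "{w \<in> topspace C_square. restrict (\<lambda>t. c * w t) unit_square \<in> U} \<in> sets W"
    unfolding assms sets_borel_of_top by (simp add: sigma_sets.Basic)
  moreover have "(\<lambda>w. restrict (\<lambda>t. c * w t) unit_square) -` U \<inter> space W
     = {w \<in> topspace C_square. restrict (\<lambda>t. c * w t) unit_square \<in> U}"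
    by (simp only: sp C_square_eq topspace_mtopology_of) auto
  ultimately show "(\<lambda>w. restrict (\<lambda>t. c * w t) unit_square) -` U \<inter> space W \<in> sets W" by simp
qed

section \<open>Interpolation from a grid\<close>

definition grid :: "nat \<Rightarrow> (nat \<times> nat) set" where
  "grid N = {..N} \<times> {..N}"

definition grid_point :: "nat \<Rightarrow> nat \<times> nat \<Rightarrow> real \<times> real" where
  "grid_point N q = (real (fst q) / real N, real (snd q) / real N)"

definition hat :: "nat \<Rightarrow> nat \<times> nat \<Rightarrow> real \<times> real \<Rightarrow> real" where
  "hat N q t = tent (real N * fst t) (fst q) * tent (real N * snd t) (snd q)"

lemma finite_grid [simp]: "finite (grid N)"
  by (simp add: grid_def)

lemma grid_point_mem: "0 < N \<Longrightarrow> q \<in> grid N \<Longrightarrow> grid_point N q \<in> unit_square"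
  by (auto simp: grid_def grid_point_def unit_square_iff)

lemma hat_nonneg: "0 \<le> hat N q t"
  by (simp add: hat_def)

lemma hat_le_1: "\<bar>hat N q t\<bar> \<le> 1"
  unfolding hat_def by (simp add: mult_le_one tent_le_1)

lemma continuous_on_ramp [continuous_intros]:
  "continuous_on A g \<Longrightarrow> continuous_on A (\<lambda>t. ramp (g t) k)"
  unfolding ramp_def by (intro continuous_intros)

lemma hat_continuous: "continuous_on A (hat N q)"
  unfolding hat_def[abs_def] tent_def by (intro continuous_intros)

lemma sum_hat:
  assumes "t \<in> unit_square"
  shows "(\<Sum>q\<in>grid N. hat N q t) = 1"
proof -
  have 1: "(\<Sum>i\<le>N. tent (real N * s) i) = 1" if "0 \<le> s" "s \<le> 1" for s
    using sum_tent[of "real N * s" N] that by (simp add: ramp_eq_0 mult_left_le)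
  have "(\<Sum>q\<in>grid N. hat N q t) = (\<Sum>i\<le>N. \<Sum>j\<le>N. tent (real N * fst t) i * tent (real N * snd t) j)"
    unfolding grid_def hat_def sum.cartesian_product by (simp add: case_prod_unfold)
  also have "\<dots> = (\<Sum>i\<le>N. tent (real N * fst t) i) * (\<Sum>j\<le>N. tent (real N * snd t) j)"
    by (simp add: sum_product)
  finally show ?thesis using 1 assms by (simp add: unit_square_iff)
qed

text \<open>The hats are nonnegative, sum to 1 and vanish when the grid point is more than one mesh
  width away in either coordinate, so the error is an average of differences to neighbouring grid
  values.\<close>

lemma interpolation_error:
  assumes t: "t \<in> unit_square"
    and close: "\<And>q. q \<in> grid N \<Longrightarrow> \<bar>real N * fst t - real (fst q)\<bar> \<le> 1 \<Longrightarrow> \<bar>real N * snd t - real (snd q)\<bar> \<le> 1 \<Longrightarrow>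
      \<bar>v - x q\<bar> \<le> D"
  shows "\<bar>v - comb (grid N) (hat N) x t\<bar> \<le> D"
proof -
  have "v - comb (grid N) (hat N) x t = (\<Sum>q\<in>grid N. v * hat N q t) - (\<Sum>q\<in>grid N. x q * hat N q t)"
    using t sum_hat[OF t, of N] by (simp add: comb_def flip: sum_distrib_left)
  also have "\<dots> = (\<Sum>q\<in>grid N. hat N q t * (v - x q))"
    unfolding sum_subtractf[symmetric] by (intro sum.cong refl) (simp add: algebra_simps)
  also have "\<bar>\<dots>\<bar> \<le> (\<Sum>q\<in>grid N. hat N q t * D)"
  proof (intro order_trans[OF sum_abs] sum_mono)
    fix q assume "q \<in> grid N"
    show "\<bar>hat N q t * (v - x q)\<bar> \<le> hat N q t * D"
    proof (cases "hat N q t = 0")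
      case False
      then have "\<bar>v - x q\<bar> \<le> D"
        using tent_support by (intro close \<open>q \<in> grid N\<close>) (auto simp: hat_def)
      then show ?thesis by (simp add: abs_mult hat_nonneg mult_left_mono)
    qed simp
  qed
  also have "\<dots> = D" using sum_hat[OF t] by (simp flip: sum_distrib_right)
  finally show ?thesis .
qed

text \<open>Uniform continuity of \<open>w\<close> at distances up to twice the mesh width;
  \<open>Suc N\<close> excludes a division by zero in \<open>grid_point\<close>.\<close>

lemma interpolation_tendsto:
  assumes w: "w \<in> mspace C_metric"
  shows "limitin C_square (\<lambda>N. comb (grid (Suc N)) (hat (Suc N)) (\<lambda>q. w (grid_point (Suc N) q))) w sequentially"
proof -
  interpret C: Metric_space "mspace C_metric" "mdist C_metric" by (rule Metric_space_mspace_mdist)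
  have cont: "continuous_on unit_square w" using w by (simp add: C_mspace_iff)
  have uc: "uniformly_continuous_on unit_square w"
    by (rule compact_uniformly_continuous[OF cont compact_unit_square])
  have cm: "comb (grid N) (hat N) x \<in> mspace C_metric" for N x
    by (rule comb_mspace) (rule hat_continuous)
  show ?thesis
    unfolding C_square_eq mtopology_of_def C.limit_metric_sequentially
  proof (intro conjI w allI impI)
    fix e :: real assume "0 < e"
    then obtain d where d: "0 < d" "\<And>s t. s \<in> unit_square \<Longrightarrow> t \<in> unit_square \<Longrightarrow> dist s t < d \<Longrightarrow> dist (w s) (w t) < e / 2"
      using uc half_gt_zero[OF \<open>0 < e\<close>] unfolding uniformly_continuous_on_def by metis
    obtain N0 where N0: "2 / d < real N0" using reals_Archimedean2 by blast
    have "mdist C_metric (comb (grid (Suc N)) (hat (Suc N)) (\<lambda>q. w (grid_point (Suc N) q))) w < e" if "N0 \<le> N" for N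
    proof -
      have "mdist C_metric w (comb (grid (Suc N)) (hat (Suc N)) (\<lambda>q. w (grid_point (Suc N) q))) \<le> e / 2"
      proof (rule C_mdist_le)
        fix t assume t: "t \<in> unit_square"
        show "\<bar>w t - comb (grid (Suc N)) (hat (Suc N)) (\<lambda>q. w (grid_point (Suc N) q)) t\<bar> \<le> e / 2"
        proof (rule interpolation_error[OF t])
          fix q assume q: "q \<in> grid (Suc N)" "\<bar>real (Suc N) * fst t - real (fst q)\<bar> \<le> 1" "\<bar>real (Suc N) * snd t - real (snd q)\<bar> \<le> 1"
          have *: "\<bar>s - r / real (Suc N)\<bar> \<le> 1 / real (Suc N)" if "\<bar>real (Suc N) * s - r\<bar> \<le> 1" for s r
          proof -
            have "s - r / real (Suc N) = (real (Suc N) * s - r) / real (Suc N)"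
              by (simp add: diff_divide_distrib del: of_nat_Suc)
            then show ?thesis using that by (simp add: abs_divide divide_right_mono del: of_nat_Suc)
          qed
          have "dist t (grid_point (Suc N) q) \<le> \<bar>fst t - real (fst q) / real (Suc N)\<bar> + \<bar>snd t - real (snd q) / real (Suc N)\<bar>"
            unfolding dist_prod_def grid_point_def by (simp add: dist_real_def sqrt_sum_squares_le_sum_abs del: of_nat_Suc)
          also have "\<dots> \<le> 1 / real (Suc N) + 1 / real (Suc N)"
            by (intro add_mono * q)
          also have "\<dots> = 2 / real (Suc N)" by simp
          also have "\<dots> < d"
          proof -
            have "2 / d < real (Suc N)" using N0 that by linarith
            then show ?thesis using \<open>0 < d\<close> by (simp add: field_simps)
          qed
          finally show "\<bar>w t - w (grid_point (Suc N) q)\<bar> \<le> e / 2"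
            using d(2)[OF t grid_point_mem[OF _ q(1)]] by (simp add: dist_real_def)
        qed
      qed (use \<open>0 < e\<close> in simp)
      then show ?thesis
        using \<open>0 < e\<close> C.commute[of w "comb (grid (Suc N)) (hat (Suc N)) (\<lambda>q. w (grid_point (Suc N) q))"]
        by linarith
    qed
    then show "\<exists>N. \<forall>n\<ge>N. comb (grid (Suc n)) (hat (Suc n)) (\<lambda>q. w (grid_point (Suc n) q)) \<in> mspace C_metric \<and>
       mdist C_metric (comb (grid (Suc n)) (hat (Suc n)) (\<lambda>q. w (grid_point (Suc n) q))) w < e"
      using cm by blast
  qed
qed

section \<open>The invariance principle\<close>

lemma sum_rect: "(\<Sum>k\<in>rect a b. h k) = (\<Sum>i<a. \<Sum>j<b. h (1 + int i, 1 + int j))"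
proof -
  have "(\<Sum>k\<in>rect a b. h k) = (\<Sum>p\<in>{..<a} \<times> {..<b}. h (1 + int (fst p), 1 + int (snd p)))"
    by (rule sum.reindex_bij_witness[of _ "\<lambda>p. (1 + int (fst p), 1 + int (snd p))" "\<lambda>k. (nat (fst k - 1), nat (snd k - 1))"])
       (auto simp: rect_def)
  then show ?thesis by (simp add: sum.cartesian_product case_prod_unfold)
qed

text \<open>The area of the part of cell \<open>k\<close> inside \<open>rect_upto a b t\<close>, see
  \<open>measure_cell\<close>. Cells are numbered from 1, ramps from 0.\<close>

definition wt :: "nat \<Rightarrow> nat \<Rightarrow> real \<times> real \<Rightarrow> int \<times> int \<Rightarrow> real" where
  "wt a b t k = ramp (real a * fst t) (nat (fst k - 1)) * ramp (real b * snd t) (nat (snd k - 1))"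

lemma wt_bounds: "0 \<le> wt a b t k" "\<bar>wt a b t k\<bar> \<le> 1"
  by (simp_all add: wt_def mult_le_one)

lemma wt_continuous: "continuous_on A (\<lambda>t. wt a b t k)"
  unfolding wt_def by (intro continuous_intros)

lemma emeasure_cell_1D:
  assumes "0 \<le> x" "1 \<le> k"
  shows "emeasure lborel ({0..x} \<inter> {real_of_int k - 1<..real_of_int k}) = ennreal (ramp x (nat (k - 1)))"
proof -
  have k: "real (nat (k - 1)) = real_of_int k - 1" using assms by simp
  have "0 \<le> real_of_int k - 1" using assms by simp
  then have "{0..x} \<inter> {real_of_int k - 1<..real_of_int k} = {real_of_int k - 1<..min x (real_of_int k)}"
    by auto
  moreover have "emeasure lborel {real_of_int k - 1<..min x (real_of_int k)} = ennreal (ramp x (nat (k - 1)))"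
  proof (cases "real_of_int k - 1 \<le> min x (real_of_int k)")
    case True
    then show ?thesis
      by (subst emeasure_lborel_Ioc) (auto simp: ramp_def k min_def max_def intro!: arg_cong[where f=ennreal])
  next
    case False
    then have "x < real_of_int k - 1" by (auto simp: min_def split: if_splits)
    then show ?thesis by (simp add: ramp_def k)
  qed
  ultimately show ?thesis by simp
qed

lemma measure_cell:
  assumes "0 \<le> fst t" "0 \<le> snd t" "1 \<le> k" "1 \<le> l"
  shows "measure lborel (rect_upto a b t \<inter> unit_cell k l) = wt a b t (k, l)"
proof -
  let ?A = "{0..real a * fst t} \<inter> {real_of_int k - 1<..real_of_int k}"
  let ?B = "{0..real b * snd t} \<inter> {real_of_int l - 1<..real_of_int l}"
  have "emeasure lborel (rect_upto a b t \<inter> unit_cell k l) = emeasure (lborel \<Otimes>\<^sub>M lborel) (?A \<times> ?B)"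
    unfolding rect_upto_def unit_cell_def Times_Int_Times lborel_prod ..
  also have "\<dots> = emeasure lborel ?A * emeasure lborel ?B"
    by (rule lborel.emeasure_pair_measure_Times) auto
  also have "\<dots> = ennreal (ramp (real a * fst t) (nat (k - 1))) * ennreal (ramp (real b * snd t) (nat (l - 1)))"
    using assms by (subst (1 2) emeasure_cell_1D) auto
  also have "\<dots> = ennreal (wt a b t (k, l))"
    by (simp add: wt_def ennreal_mult)
  finally show ?thesis by (simp add: measure_def wt_bounds)
qed

lemma sum_wt_mult:
  "(\<Sum>k\<in>rect a b. wt a b s k * wt a b t k) =
    (\<Sum>i<a. ramp (real a * fst s) i * ramp (real a * fst t) i) * (\<Sum>j<b. ramp (real b * snd s) j * ramp (real b * snd t) j)"
  unfolding sum_rect wt_def sum_product by (simp add: mult_ac)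

text \<open>The origin of the sheet's covariance: since the \<open>f \<circ> T\<^sub>k\<close> are
  orthogonal, covariances of \<open>B\<^sub>n\<close> reduce to averaged products of
  weights.\<close>

lemma sum_wt_mult_tendsto:
  assumes m: "filterlim m1 at_top sequentially" "filterlim m2 at_top sequentially"
    and st: "s \<in> unit_square" "t \<in> unit_square"
  shows "(\<lambda>n. (\<Sum>k\<in>rect (m1 n) (m2 n). wt (m1 n) (m2 n) s k * wt (m1 n) (m2 n) t k) / (real (m1 n) * real (m2 n)))
    \<longlonglongrightarrow> min (fst s) (fst t) * min (snd s) (snd t)"
  using tendsto_mult[OF sum_ramp_mult_tendsto[OF m(1), of "fst s" "fst t"] sum_ramp_mult_tendsto[OF m(2), of "snd s" "snd t"]] st
  by (simp add: sum_wt_mult unit_square_iff)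

text \<open>Above the threshold \<open>d\<close> the factor \<open>(y / d)\<^sup>3\<close> is at
  least 1. Applied to the strip of a given point, this allows the unknown strip to be replaced by a
  sum of fourth powers over all strips.\<close>

lemma le_add_fourth_power:
  fixes y d :: real
  assumes "0 \<le> y" "0 < d"
  shows "y \<le> d + y ^ 4 / d ^ 3"
proof (cases "y \<le> d")
  case False
  then have "d ^ 3 \<le> y ^ 3" using assms by (intro power_mono) auto
  then have "y * d ^ 3 \<le> y * y ^ 3" using assms by (intro mult_left_mono) auto
  then have "y \<le> y ^ 4 / d ^ 3"
    using assms by (simp add: pos_le_divide_eq power4_eq_xxxx power3_eq_cube mult.assoc)
  then show ?thesis using assms by linarith
qed (use assms in \<open>simp add: add_increasing2\<close>)

section \<open>Smoothed sums and maxima over blocks\<close>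

context iid_field
begin

lemma smooth_sum_lin:
  assumes t: "t \<in> unit_square"
  shows "smooth_sum a b f t \<omega> = lin a b (wt a b t) f \<omega>"
proof -
  have t': "0 \<le> fst t" "fst t \<le> 1" "0 \<le> snd t" "snd t \<le> 1" using t by (auto simp: unit_square_iff)
  have "smooth_sum a b f t \<omega> = (\<Sum>\<^sub>\<infinity>k\<in>{1..} \<times> {1..}. wt a b t k * f (shift (fst k) (snd k) \<omega>))"
    unfolding smooth_sum_def by (rule infsum_cong) (use measure_cell[OF t'(1,3)] in \<open>auto simp: case_prod_unfold\<close>)
  also have "\<dots> = (\<Sum>\<^sub>\<infinity>k\<in>rect a b. wt a b t k * f (shift (fst k) (snd k) \<omega>))"
  proof (rule infsum_cong_neutral)
    \<comment> \<open>Since \<open>t\<close> is at most 1 in each coordinate, cells beyond the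
      rectangle miss \<open>rect_upto a b t\<close> up to area zero, and the infinite sum becomes
      finite.\<close>
    fix k assume k: "k \<in> {1..} \<times> {1..} - rect a b"
    have ab: "real a * fst t \<le> real a" "real b * snd t \<le> real b" using t' by (simp_all add: mult_left_le)
    from k have "int a \<le> fst k - 1 \<or> int b \<le> snd k - 1" by (auto simp: rect_def)
    then have "real a \<le> real (nat (fst k - 1)) \<or> real b \<le> real (nat (snd k - 1))" by linarith
    then have "wt a b t k = 0"
      unfolding wt_def using ab by (metis mult_eq_0_iff order_trans ramp_eq_0)
    then show "wt a b t k * f (shift (fst k) (snd k) \<omega>) = 0" by simp
  qed (auto simp: rect_def)
  also have "\<dots> = lin a b (wt a b t) f \<omega>" by (simp add: lin_def)
  finally show ?thesis .
qed

lemma lin_wt_bilin: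
  "lin a b (wt a b t) f \<omega> = bilin (\<lambda>i j. f (shift (1 + int i) (1 + int j) \<omega>)) a b (real a * fst t) (real b * snd t)"
  by (simp add: lin_def bilin_def sum_rect wt_def sum_distrib_left mult_ac)

text \<open>Partial sums over blocks that start right after \<open>(p, r)\<close>; corners off the
  origin are needed for the strips. The 1 converts natural indices from 0 into integer indices from
  1.\<close>

definition Sx :: "(config \<Rightarrow> real) \<Rightarrow> nat \<Rightarrow> nat \<Rightarrow> nat \<Rightarrow> nat \<Rightarrow> config \<Rightarrow> real" where
  "Sx h p r i j \<omega> = (\<Sum>i'<i. \<Sum>j'<j. h (shift (1 + int p + int i') (1 + int r + int j') \<omega>))"

lemma orthomart_field:
  fixes p r :: nat
  assumes h: "orthomart h"
  defines "F \<equiv> \<lambda>i. coord_sigma {(a, b). a < 1 + int p + int i}"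
    and "G \<equiv> \<lambda>j. coord_sigma {(a, b). b < 1 + int r + int j}"
    and "X \<equiv> \<lambda>i j \<omega>. h (shift (1 + int p + int i) (1 + int r + int j) \<omega>)"
  shows "orthofield \<Omega> F G X"
proof
  show "subalgebra \<Omega> (F i)" "subalgebra \<Omega> (G j)" for i j
    unfolding F_def G_def by (rule subalgebra_coord_sigma)+
  have d: "dep {(a, b). a \<le> 1 + int p + int i \<and> b \<le> 1 + int r + int j} (X i j)" for i j
    unfolding X_def by (rule orthomart_shift_dep[OF h])
  have m: "X i j \<in> borel_measurable \<Omega>" for i j
    unfolding X_def by (rule orthomart_shift_meas[OF h])
  show "X i j \<in> borel_measurable (F k)" if "i < k" for i j k
  proof -
    have "dep {(a, b). a < 1 + int p + int k} (X i j)"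
      by (rule dep_mono[OF d]) (use that in auto)
    then show ?thesis unfolding F_def coord_sigma_measurable_iff using m by simp
  qed
  show "X i j \<in> borel_measurable (G k)" if "j < k" for i j k
  proof -
    have "dep {(a, b). b < 1 + int r + int k} (X i j)"
      by (rule dep_mono[OF d]) (use that in auto)
    then show ?thesis unfolding G_def coord_sigma_measurable_iff using m by simp
  qed
  show "null_on \<Omega> (F i) (X i j)" "null_on \<Omega> (G j) (X i j)" for i j
    unfolding F_def G_def X_def by (rule orthomart_shift_null[OF h])+
  show "integrable \<Omega> (\<lambda>\<omega>. (X i j \<omega>)\<^sup>2)" for i j
    unfolding X_def by (rule orthomart_shift_L2(1)[OF h])
qed

definition MaxS :: "(config \<Rightarrow> real) \<Rightarrow> nat \<Rightarrow> nat \<Rightarrow> config \<Rightarrow> real" where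
  "MaxS h a b \<omega> = Max ((\<lambda>j. Max ((\<lambda>i. \<bar>Sx h 0 0 i j \<omega>\<bar>) ` {..a})) ` {..b})"

lemma MaxS_ge: "i \<le> a \<Longrightarrow> j \<le> b \<Longrightarrow> \<bar>Sx h 0 0 i j \<omega>\<bar> \<le> MaxS h a b \<omega>"
  unfolding MaxS_def by (intro order_trans[OF _ Max_ge[OF _ imageI[of j]]] Max_ge) auto

text \<open>\<open>4 = sqrt 16\<close> from Cairoli's inequality. The bound does not depend on the
  rectangle, which makes the remainder \<open>f - g\<close> uniformly small in supremum norm from
  second moments alone.\<close>

lemma MaxS_expectation:
  assumes h: "orthomart h" and ab: "0 < a" "0 < b" and h2: "(\<integral>\<omega>. (h \<omega>)\<^sup>2 \<partial>\<Omega>) \<le> \<eta>\<^sup>2" "0 \<le> \<eta>"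
  shows "integrable \<Omega> (MaxS h a b)" "(\<integral>\<omega>. MaxS h a b \<omega> / sqrt (real a * real b) \<partial>\<Omega>) \<le> 4 * \<eta>"
proof -
  interpret O: orthofield \<Omega> "\<lambda>i. coord_sigma {(a, b). a < 1 + int 0 + int i}" "\<lambda>j. coord_sigma {(a, b). b < 1 + int 0 + int j}"
    "\<lambda>i j \<omega>. h (shift (1 + int 0 + int i) (1 + int 0 + int j) \<omega>)"
    by (rule orthomart_field[OF h])
  have S: "O.S = Sx h 0 0" by (intro ext, unfold O.S_def Sx_def, rule refl)
  have [measurable]: "Sx h 0 0 i j \<in> borel_measurable \<Omega>" for i j
    using O.S_meas unfolding S .
  have M2: "integrable \<Omega> (\<lambda>\<omega>. (MaxS h a b \<omega>)\<^sup>2)"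
    unfolding MaxS_def using O.S_L2 unfolding S
    by (intro integrable_Max_L2 borel_measurable_Max) auto
  have [measurable]: "MaxS h a b \<in> borel_measurable \<Omega>"
    unfolding MaxS_def by (intro borel_measurable_Max) auto
  show i: "integrable \<Omega> (MaxS h a b)"
    using integrable_mult_L2[of "\<lambda>_. 1" \<Omega> "MaxS h a b"] M2 by simp
  have "Sx h 0 0 a b = lin a b (\<lambda>_. 1) h"
    by (simp add: fun_eq_iff Sx_def lin_def sum_rect)
  then have "(\<integral>\<omega>. (Sx h 0 0 a b \<omega>)\<^sup>2 \<partial>\<Omega>) = real a * real b * (\<integral>\<omega>. (h \<omega>)\<^sup>2 \<partial>\<Omega>)"
    using lin_second_moment(2)[OF h, of a b "\<lambda>_. 1"] by (simp add: card_rect)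
  moreover have "(\<integral>\<omega>. (MaxS h a b \<omega>)\<^sup>2 \<partial>\<Omega>) \<le> 16 * (\<integral>\<omega>. (Sx h 0 0 a b \<omega>)\<^sup>2 \<partial>\<Omega>)"
    using O.max_S_L2[of a b] unfolding S MaxS_def .
  ultimately have "(\<integral>\<omega>. (MaxS h a b \<omega>)\<^sup>2 \<partial>\<Omega>) \<le> 16 * (real a * real b * (\<integral>\<omega>. (h \<omega>)\<^sup>2 \<partial>\<Omega>))" by simp
  also have "\<dots> \<le> 16 * (real a * real b * \<eta>\<^sup>2)"
    using h2 by (intro mult_left_mono) auto
  also have "\<dots> = (4 * \<eta> * sqrt (real a * real b))\<^sup>2"
    by (simp add: power_mult_distrib)
  finally have le: "(\<integral>\<omega>. (MaxS h a b \<omega>)\<^sup>2 \<partial>\<Omega>) \<le> (4 * \<eta> * sqrt (real a * real b))\<^sup>2" .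
  have "(\<integral>\<omega>. MaxS h a b \<omega> \<partial>\<Omega>) \<le> (\<integral>\<omega>. \<bar>MaxS h a b \<omega>\<bar> \<partial>\<Omega>)"
    using i by (intro integral_mono) auto
  also have "\<dots> \<le> sqrt (\<integral>\<omega>. (MaxS h a b \<omega>)\<^sup>2 \<partial>\<Omega>)"
    by (rule expectation_abs_le_sqrt[OF _ M2]) measurable
  also have "\<dots> \<le> 4 * \<eta> * sqrt (real a * real b)"
    using h2 by (intro real_le_lsqrt le) auto
  finally have "(\<integral>\<omega>. MaxS h a b \<omega> \<partial>\<Omega>) / sqrt (real a * real b) \<le> 4 * \<eta>"
    using ab by (subst pos_divide_le_eq) auto
  then show "(\<integral>\<omega>. MaxS h a b \<omega> / sqrt (real a * real b) \<partial>\<Omega>) \<le> 4 * \<eta>" by simp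
qed

text \<open>Maxima of squares rather than of absolute values, so that the square of
  \<open>MaxQ\<close> is the maximal fourth power of \<open>max_S_L4\<close>.\<close>

definition MaxQ :: "(config \<Rightarrow> real) \<Rightarrow> nat \<Rightarrow> nat \<Rightarrow> nat \<Rightarrow> nat \<Rightarrow> config \<Rightarrow> real" where
  "MaxQ h p r a b \<omega> = Max ((\<lambda>j. Max ((\<lambda>i. (Sx h p r i j \<omega>)\<^sup>2) ` {..a})) ` {..b})"

lemma MaxQ_ge:
  assumes "i \<le> a" "j \<le> b"
  shows "\<bar>Sx h p r i j \<omega>\<bar> \<le> sqrt (MaxQ h p r a b \<omega>)"
proof -
  have "(Sx h p r i j \<omega>)\<^sup>2 \<le> MaxQ h p r a b \<omega>"
    unfolding MaxQ_def using assms by (intro order_trans[OF _ Max_ge[OF _ imageI[of j]]] Max_ge) auto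
  from real_sqrt_le_mono[OF this] show ?thesis by simp
qed

lemma MaxQ_nonneg: "0 \<le> MaxQ h p r a b \<omega>"
  using order_trans[OF abs_ge_zero MaxQ_ge[of 0 a 0 b h p r \<omega>]] by simp

lemma MaxQ_expectation:
  assumes g: "orthomart g" and K: "bdd_meas K g"
  shows "integrable \<Omega> (\<lambda>\<omega>. (MaxQ g p r a b \<omega>)\<^sup>2)"
    "(\<integral>\<omega>. (MaxQ g p r a b \<omega>)\<^sup>2 \<partial>\<Omega>) \<le> 4096 * (real a * real b)\<^sup>2 * K^4"
proof -
  interpret O: orthofield \<Omega> "\<lambda>i. coord_sigma {(a, b). a < 1 + int p + int i}" "\<lambda>j. coord_sigma {(a, b). b < 1 + int r + int j}"
    "\<lambda>i j \<omega>. g (shift (1 + int p + int i) (1 + int r + int j) \<omega>)"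
    by (rule orthomart_field[OF g])
  interpret B: bounded_orthofield \<Omega> "\<lambda>i. coord_sigma {(a, b). a < 1 + int p + int i}" "\<lambda>j. coord_sigma {(a, b). b < 1 + int r + int j}"
    "\<lambda>i j \<omega>. g (shift (1 + int p + int i) (1 + int r + int j) \<omega>)" K
    by unfold_locales (use O.subF O.subG O.XF O.XG O.nullF O.nullG K in \<open>auto simp: bdd_meas_def\<close>)
  have S: "O.S = Sx g p r" by (intro ext, unfold O.S_def Sx_def, rule refl)
  have [measurable]: "Sx g p r i j \<in> borel_measurable \<Omega>" for i j
    using O.S_meas unfolding S .
  have q: "integrable \<Omega> (\<lambda>\<omega>. ((Sx g p r i j \<omega>)\<^sup>2)\<^sup>2)" for i j
    using B.S_bound[of i j] unfolding S
    by (intro B.integrable_bdd[OF _ B.pow_abs_le[OF B.pow_abs_le]]) auto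
  show "integrable \<Omega> (\<lambda>\<omega>. (MaxQ g p r a b \<omega>)\<^sup>2)"
    unfolding MaxQ_def by (intro integrable_Max_L2 borel_measurable_Max q) auto
  show "(\<integral>\<omega>. (MaxQ g p r a b \<omega>)\<^sup>2 \<partial>\<Omega>) \<le> 4096 * (real a * real b)\<^sup>2 * K^4"
    using B.max_S_L4[of a b] unfolding S MaxQ_def .
qed

end

section \<open>Gaussian marginals of the Brownian sheet\<close>

text \<open>Mean zero forces \<open>\<mu> = 0\<close>, so the law is that of \<open>s\<close> times
  a standard normal variable, and everything is read off that law; \<open>s = 0\<close> is
  included.\<close>

lemma gaussian_rv_moments:
  assumes "prob_space W" "gaussian_rv W X" and mean: "integral\<^sup>L W X = 0"
  shows "integrable W X" "integrable W (\<lambda>w. (X w)\<^sup>2)"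
    "(\<integral>w. iexp (X w) \<partial>W) = exp (- ((\<integral>w. (X w)\<^sup>2 \<partial>W) / 2))"
proof -
  interpret N: real_distribution std_normal_distribution by (rule real_dist_normal_dist)
  obtain \<mu> s where X [measurable]: "X \<in> borel_measurable W"
    and d: "distr W borel X = distr std_normal_distribution borel (\<lambda>x. \<mu> + s * x)"
    using assms(2) unfolding gaussian_rv_def by blast
  have tr: "integrable W (\<lambda>w. h (X w)) \<longleftrightarrow> integrable std_normal_distribution (\<lambda>x. h (\<mu> + s * x))"
      "(\<integral>w. h (X w) \<partial>W) = (\<integral>x. h (\<mu> + s * x) \<partial>std_normal_distribution)"
    if [measurable]: "h \<in> borel_measurable borel" for h :: "real \<Rightarrow> 'c :: {banach, second_countable_topology}"
  proof -
    have "integrable W (\<lambda>w. h (X w)) \<longleftrightarrow> integrable (distr W borel X) h"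
      by (rule integrable_distr_eq[symmetric]) measurable
    also have "\<dots> \<longleftrightarrow> integrable std_normal_distribution (\<lambda>x. h (\<mu> + s * x))"
      unfolding d by (rule integrable_distr_eq) measurable
    finally show "integrable W (\<lambda>w. h (X w)) \<longleftrightarrow> integrable std_normal_distribution (\<lambda>x. h (\<mu> + s * x))" .
    have "(\<integral>w. h (X w) \<partial>W) = integral\<^sup>L (distr W borel X) h"
      by (rule integral_distr[symmetric]) measurable
    also have "\<dots> = (\<integral>x. h (\<mu> + s * x) \<partial>std_normal_distribution)"
      unfolding d by (rule integral_distr) measurable
    finally show "(\<integral>w. h (X w) \<partial>W) = (\<integral>x. h (\<mu> + s * x) \<partial>std_normal_distribution)" .
  qed
  have i1: "integrable std_normal_distribution (\<lambda>x. x)" and i2: "integrable std_normal_distribution (\<lambda>x. x\<^sup>2)"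
    using integrable_std_normal_distribution_moment[of 1] integrable_std_normal_distribution_moment[of 2] by simp_all
  have e1: "(\<integral>x. x \<partial>std_normal_distribution) = 0"
    using integral_std_normal_distribution_moment_odd[of 1] by simp
  have e2: "(\<integral>x. x\<^sup>2 \<partial>std_normal_distribution) = 1"
    using std_normal_distribution_even_moments[of 1] by (simp add: has_bochner_integral_iff)
  have m1: "(\<lambda>x :: real. x) \<in> borel_measurable borel" and m2: "(\<lambda>x :: real. x\<^sup>2) \<in> borel_measurable borel"
    and m3: "iexp \<in> borel_measurable borel" by simp_all
  have ic: "integrable std_normal_distribution (\<lambda>x. \<mu>)" by (rule N.integrable_const)
  have is1: "integrable std_normal_distribution (\<lambda>x. s * x)" by (rule integrable_mult_right[OF i1])
  show "integrable W X"
    using tr(1)[OF m1] Bochner_Integration.integrable_add[OF ic is1] by blast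
  have "integral\<^sup>L W X = (\<integral>x. \<mu> + s * x \<partial>std_normal_distribution)"
    by (rule tr(2)[OF m1])
  also have "\<dots> = (\<integral>x. \<mu> \<partial>std_normal_distribution) + (\<integral>x. s * x \<partial>std_normal_distribution)"
    by (rule Bochner_Integration.integral_add[OF ic is1])
  also have "(\<integral>x. s * x \<partial>std_normal_distribution) = s * (\<integral>x. x \<partial>std_normal_distribution)"
    by (rule integral_mult_right_zero)
  also have "(\<integral>x. x \<partial>std_normal_distribution) = 0" by (rule e1)
  also have "(\<integral>x. \<mu> \<partial>std_normal_distribution) = \<mu>"
    unfolding lebesgue_integral_const N.prob_space by simp
  finally have \<mu>: "\<mu> = 0" using mean by simp
  have sq: "(\<lambda>x. (\<mu> + s * x)\<^sup>2) = (\<lambda>x. s\<^sup>2 * x\<^sup>2)"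
    by (simp add: \<mu> power_mult_distrib fun_eq_iff)
  show "integrable W (\<lambda>w. (X w)\<^sup>2)"
    using tr(1)[OF m2] integrable_mult_right[OF i2, of "s\<^sup>2"] unfolding sq by blast
  have "(\<integral>w. (X w)\<^sup>2 \<partial>W) = (\<integral>x. s\<^sup>2 * x\<^sup>2 \<partial>std_normal_distribution)"
    using tr(2)[OF m2] unfolding sq .
  also have "\<dots> = s\<^sup>2 * (\<integral>x. x\<^sup>2 \<partial>std_normal_distribution)" by (rule integral_mult_right_zero)
  also have "\<dots> = s\<^sup>2" unfolding e2 by (rule mult_1_right)
  finally have var: "(\<integral>w. (X w)\<^sup>2 \<partial>W) = s\<^sup>2" .
  have "(\<integral>w. iexp (X w) \<partial>W) = char std_normal_distribution s"
    using tr(2)[OF m3] unfolding char_def \<mu> add_0_left .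
  then show "(\<integral>w. iexp (X w) \<partial>W) = exp (- ((\<integral>w. (X w)\<^sup>2 \<partial>W) / 2))"
    by (simp add: char_std_normal_distribution var)
qed

lemma brownian_sheet_char:
  assumes W: "brownian_sheet_law W" and N: "0 < N"
  shows "\<And>q. q \<in> grid N \<Longrightarrow> integrable W (\<lambda>w. (w (grid_point N q))\<^sup>2)"
    "\<And>q. q \<in> grid N \<Longrightarrow> (\<integral>w. (w (grid_point N q))\<^sup>2 \<partial>W) \<le> 1"
    "(\<integral>w. iexp (\<Sum>q\<in>grid N. c q * w (grid_point N q)) \<partial>W) =
      exp (- ((\<Sum>q\<in>grid N. \<Sum>q'\<in>grid N. c q * c q' *
        (min (fst (grid_point N q)) (fst (grid_point N q')) * min (snd (grid_point N q)) (snd (grid_point N q')))) / 2))"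
proof -
  let ?p = "grid_point N"
  note W' = W[unfolded brownian_sheet_law_def]
  have prob: "prob_space W" using W' by blast
  have mean0: "integral\<^sup>L W (\<lambda>w. w t) = 0" if "t \<in> unit_square" for t using W' that by blast
  have cov: "integral\<^sup>L W (\<lambda>w. w s * w t) = min (fst s) (fst t) * min (snd s) (snd t)"
    if "s \<in> unit_square" "t \<in> unit_square" for s t using W' that by blast
  have gauss: "gaussian_rv W (\<lambda>w. \<Sum>t\<in>I. c t * w t)" if "finite I" "I \<subseteq> unit_square" for I c
    using W' that by blast
  have g1: "gaussian_rv W (\<lambda>w. w t)" if "t \<in> unit_square" for t
    using gauss[of "{t}" "\<lambda>_. 1"] that by simp
  have [measurable]: "(\<lambda>w. w t) \<in> borel_measurable W" if "t \<in> unit_square" for t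
    using g1[OF that] by (simp add: gaussian_rv_def)
  have int1: "integrable W (\<lambda>w. w t)" and int2: "integrable W (\<lambda>w. (w t)\<^sup>2)" if "t \<in> unit_square" for t
    by (rule gaussian_rv_moments[OF prob g1[OF that] mean0[OF that]])+
  have pm: "?p q \<in> unit_square" if "q \<in> grid N" for q by (rule grid_point_mem[OF N that])
  show "integrable W (\<lambda>w. (w (?p q))\<^sup>2)" if "q \<in> grid N" for q by (rule int2[OF pm[OF that]])
  show "(\<integral>w. (w (?p q))\<^sup>2 \<partial>W) \<le> 1" if "q \<in> grid N" for q
    using cov[OF pm[OF that] pm[OF that]] pm[OF that]
    by (simp add: power2_eq_square unit_square_iff mult_le_one)
  have inj: "inj_on ?p (grid N)"
    using N by (auto simp: inj_on_def grid_point_def)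
  define X where "X w = (\<Sum>q\<in>grid N. c q * w (?p q))" for w
  \<comment> \<open>\<open>brownian_sheet_law\<close> speaks of sums indexed by points of the
    square, the grid by pairs of numbers; injectivity of \<open>grid_point\<close> transports the
    coefficients.\<close>
  have "X w = (\<Sum>t\<in>?p ` grid N. c (the_inv_into (grid N) ?p t) * w t)" for w
    unfolding X_def by (simp add: sum.reindex[OF inj] the_inv_into_f_f[OF inj] cong: sum.cong)
  then have gX: "gaussian_rv W X"
    using gauss[of "?p ` grid N" "\<lambda>t. c (the_inv_into (grid N) ?p t)"] pm by (simp add: image_subset_iff X_def[abs_def])
  have mX: "integral\<^sup>L W X = 0"
    unfolding X_def using pm int1 mean0 by (subst Bochner_Integration.integral_sum) auto
  have int12: "integrable W (\<lambda>w. w s * w t)" if "s \<in> unit_square" "t \<in> unit_square" for s t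
    using that by (intro integrable_mult_L2 int2) auto
  have "(\<integral>w. (X w)\<^sup>2 \<partial>W) = (\<integral>w. (\<Sum>q\<in>grid N. \<Sum>q'\<in>grid N. c q * c q' * (w (?p q) * w (?p q'))) \<partial>W)"
    by (simp add: X_def power2_eq_square sum_product mult_ac)
  also have "\<dots> = (\<Sum>q\<in>grid N. \<Sum>q'\<in>grid N. c q * c q' * (\<integral>w. w (?p q) * w (?p q') \<partial>W))"
    using pm int12 by (simp add: Bochner_Integration.integral_sum Bochner_Integration.integrable_sum)
  also have "\<dots> = (\<Sum>q\<in>grid N. \<Sum>q'\<in>grid N. c q * c q' * (min (fst (?p q)) (fst (?p q')) * min (snd (?p q)) (snd (?p q'))))"
    by (intro sum.cong refl) (simp add: cov pm)
  finally show "(\<integral>w. iexp (\<Sum>q\<in>grid N. c q * w (?p q)) \<partial>W) =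
      exp (- ((\<Sum>q\<in>grid N. \<Sum>q'\<in>grid N. c q * c q' *
        (min (fst (?p q)) (fst (?p q')) * min (snd (?p q)) (snd (?p q')))) / 2))"
    using gaussian_rv_moments(3)[OF prob gX mX] unfolding X_def by simp
qed

section \<open>Convergence on a grid and oscillation between grid points\<close>

context iid_field
begin

lemma lin_sum_weights: "(\<Sum>q\<in>I. u q * lin a b (w q) f \<omega>) = lin a b (\<lambda>k. \<Sum>q\<in>I. u q * w q k) f \<omega>"
  unfolding lin_def sum_distrib_left sum_distrib_right by (subst sum.swap) (simp add: mult.assoc)

text \<open>A linear combination of grid values is again a weighted sum \<open>lin\<close>, so the
  one-dimensional theorem determines the joint characteristic functions (Cramer-Wold). The averaged
  squared weights tend to the covariance form of the sheet.\<close>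

lemma grid_char_tendsto:
  fixes m1 m2 :: "nat \<Rightarrow> nat"
  assumes f: "orthomart f" and m: "filterlim m1 at_top sequentially" "filterlim m2 at_top sequentially"
    and W: "brownian_sheet_law W" and N: "0 < N" and \<sigma>: "\<sigma>\<^sup>2 = (\<integral>\<omega>. (f \<omega>)\<^sup>2 \<partial>\<Omega>)"
  shows "(\<lambda>n. \<integral>\<omega>. iexp (\<Sum>q\<in>grid N. u q * (lin (m1 n) (m2 n) (wt (m1 n) (m2 n) (grid_point N q)) f \<omega> / sqrt (real (m1 n) * real (m2 n)))) \<partial>\<Omega>)
    \<longlonglongrightarrow> (\<integral>w. iexp (\<Sum>q\<in>grid N. u q * (\<sigma> * w (grid_point N q))) \<partial>W)"
proof -
  let ?p = "grid_point N"
  define w where "w n k = (\<Sum>q\<in>grid N. u q * wt (m1 n) (m2 n) (?p q) k)" for n k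
  define s where "s = (\<Sum>q\<in>grid N. \<Sum>q'\<in>grid N. u q * u q' * (min (fst (?p q)) (fst (?p q')) * min (snd (?p q)) (snd (?p q'))))"
  have wb: "\<bar>w n k\<bar> \<le> (\<Sum>q\<in>grid N. \<bar>u q\<bar>)" for n k
    unfolding w_def using wt_bounds(2)
    by (intro order_trans[OF sum_abs] sum_mono) (simp add: abs_mult mult_left_le del: abs_of_nonneg)
  have sq: "(\<Sum>k\<in>rect (m1 n) (m2 n). (w n k)\<^sup>2) / (real (m1 n) * real (m2 n)) =
      (\<Sum>q\<in>grid N. \<Sum>q'\<in>grid N. u q * u q' *
       ((\<Sum>k\<in>rect (m1 n) (m2 n). wt (m1 n) (m2 n) (?p q) k * wt (m1 n) (m2 n) (?p q') k) / (real (m1 n) * real (m2 n))))" for n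
  proof -
    have "(\<Sum>k\<in>rect (m1 n) (m2 n). (w n k)\<^sup>2) = (\<Sum>k\<in>rect (m1 n) (m2 n). \<Sum>q\<in>grid N. \<Sum>q'\<in>grid N.
        u q * u q' * (wt (m1 n) (m2 n) (?p q) k * wt (m1 n) (m2 n) (?p q') k))"
      by (simp add: w_def power2_eq_square sum_product mult_ac)
    also have "\<dots> = (\<Sum>q\<in>grid N. \<Sum>q'\<in>grid N. \<Sum>k\<in>rect (m1 n) (m2 n).
        u q * u q' * (wt (m1 n) (m2 n) (?p q) k * wt (m1 n) (m2 n) (?p q') k))"
      by (subst sum.swap) (intro sum.cong refl sum.swap)
    finally show ?thesis by (simp add: sum_divide_distrib sum_distrib_left)
  qed
  have "(\<lambda>n. (\<Sum>k\<in>rect (m1 n) (m2 n). (w n k)\<^sup>2) / (real (m1 n) * real (m2 n))) \<longlonglongrightarrow> s"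
    unfolding sq s_def
    by (intro tendsto_sum tendsto_mult_left sum_wt_mult_tendsto m grid_point_mem N)
  from lin_clt[OF f m wb this, of 1]
  have "(\<lambda>n. \<integral>\<omega>. iexp (lin (m1 n) (m2 n) (w n) f \<omega> / sqrt (real (m1 n) * real (m2 n))) \<partial>\<Omega>) \<longlonglongrightarrow> exp (- (s * \<sigma>\<^sup>2 / 2))"
    by (simp add: \<sigma>)
  moreover have "(\<Sum>q\<in>grid N. u q * (lin (m1 n) (m2 n) (wt (m1 n) (m2 n) (?p q)) f \<omega> / sqrt (real (m1 n) * real (m2 n))))
      = lin (m1 n) (m2 n) (w n) f \<omega> / sqrt (real (m1 n) * real (m2 n))" for n \<omega>
    unfolding w_def lin_sum_weights[symmetric] by (simp add: sum_divide_distrib)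
  moreover have "(\<integral>w. iexp (\<Sum>q\<in>grid N. u q * (\<sigma> * w (?p q))) \<partial>W) = exp (- (s * \<sigma>\<^sup>2 / 2))"
  proof -
    have "(\<Sum>q\<in>grid N. \<Sum>q'\<in>grid N. (u q * \<sigma>) * (u q' * \<sigma>) * (min (fst (?p q)) (fst (?p q')) * min (snd (?p q)) (snd (?p q')))) = s * \<sigma>\<^sup>2"
      by (simp add: s_def sum_distrib_left sum_distrib_right power2_eq_square mult_ac)
    then show ?thesis
      using brownian_sheet_char(3)[OF W N, of "\<lambda>q. u q * \<sigma>"] by (simp add: mult.assoc)
  qed
  ultimately show ?thesis by simp
qed

text \<open>Oscillation of the normalized field between a point and its neighbouring grid points: the
  remainder \<open>f - g\<close> enters through its maximum, the bounded part \<open>g\<close> through maxima over \<open>N\<close> vertical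
  and \<open>N\<close> horizontal strips, linearized by \<open>y \<le> d + y\<^sup>4 / d\<^sup>3\<close>.\<close>

definition osc :: "nat \<Rightarrow> nat \<Rightarrow> nat \<Rightarrow> nat \<Rightarrow> nat \<Rightarrow> real \<Rightarrow> (config \<Rightarrow> real) \<Rightarrow> (config \<Rightarrow> real) \<Rightarrow> config \<Rightarrow> real" where
  "osc a b N w1 w2 d f g \<omega> = 2 * (MaxS (\<lambda>\<omega>. f \<omega> - g \<omega>) a b \<omega> / sqrt (real a * real b)) + 4 * d
    + 2 / d ^ 3 / (real a * real b)\<^sup>2 *
      (\<Sum>m<N. (MaxQ g (a * m div N) 0 w1 b \<omega>)\<^sup>2 + (MaxQ g 0 (b * m div N) a w2 \<omega>)\<^sup>2)"

text \<open>With \<open>f = g + h\<close>, the remainder \<open>h\<close> is bounded separately at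
  both points, hence twice its maximum, while \<open>g\<close> crosses one vertical and one
  horizontal strip.\<close>

lemma osc_bound:
  assumes ab: "0 < a" "0 < b" and N: "0 < N" and w1: "real a / real N + 1 \<le> real w1" and w2: "real b / real N + 1 \<le> real w2"
    and d: "0 < d" and t: "t \<in> unit_square" and q: "q \<in> grid N"
    and near: "\<bar>real N * fst t - real (fst q)\<bar> \<le> 1" "\<bar>real N * snd t - real (snd q)\<bar> \<le> 1"
  shows "\<bar>lin a b (wt a b t) f \<omega> / sqrt (real a * real b) - lin a b (wt a b (grid_point N q)) f \<omega> / sqrt (real a * real b)\<bar>
    \<le> osc a b N w1 w2 d f g \<omega>"
proof -
  let ?r = "sqrt (real a * real b)"
  have r: "0 < ?r" using ab by simp
  have r4: "?r ^ 4 = (real a * real b)\<^sup>2"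
  proof -
    have "?r ^ 4 = (?r\<^sup>2)\<^sup>2" by (simp only: power_mult[symmetric]) simp
    also have "?r\<^sup>2 = real a * real b" by (rule real_sqrt_pow2) simp
    finally show ?thesis .
  qed
  define h where "h \<omega> = f \<omega> - g \<omega>" for \<omega>
  define V1 where "V1 m = (MaxQ g (a * m div N) 0 w1 b \<omega>)\<^sup>2" for m
  define V2 where "V2 m = (MaxQ g 0 (b * m div N) a w2 \<omega>)\<^sup>2" for m
  have t': "0 \<le> fst t" "fst t \<le> 1" "0 \<le> snd t" "snd t \<le> 1" using t by (auto simp: unit_square_iff)
  have pq: "grid_point N q \<in> unit_square" by (rule grid_point_mem[OF N q])
  have q': "fst q \<le> N" "snd q \<le> N" using q by (auto simp: grid_def)
  have hb: "\<bar>lin a b (wt a b s) h \<omega>\<bar> \<le> MaxS h a b \<omega>" if "s \<in> unit_square" for s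
    unfolding lin_wt_bilin
  proof (rule bilin_bound)
    show "\<bar>\<Sum>k<i. \<Sum>l<j. h (shift (1 + int k) (1 + int l) \<omega>)\<bar> \<le> MaxS h a b \<omega>" if "i \<le> a" "j \<le> b" for i j
      using MaxS_ge[OF that, of h \<omega>] by (simp add: Sx_def)
  qed (use that in \<open>auto simp: unit_square_iff mult_left_le\<close>)
  have A1: "\<bar>\<Sum>k<i. \<Sum>l<j. g (shift (1 + int (a * m div N + k)) (1 + int l) \<omega>)\<bar> \<le> sqrt (MaxQ g (a * m div N) 0 w1 b \<omega>)"
    if "i \<le> w1" "j \<le> b" for m i j
    using MaxQ_ge[OF that, of g "a * m div N" 0 \<omega>] unfolding Sx_def by (simp only: of_nat_add of_nat_0 add_0_right add.assoc)
  have A2: "\<bar>\<Sum>k<i. \<Sum>l<j. g (shift (1 + int k) (1 + int (b * m div N + l)) \<omega>)\<bar> \<le> sqrt (MaxQ g 0 (b * m div N) a w2 \<omega>)"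
    if "i \<le> a" "j \<le> w2" for m i j
    using MaxQ_ge[OF that, of g 0 "b * m div N" \<omega>] unfolding Sx_def by (simp only: of_nat_add of_nat_0 add_0_right add.assoc)
  obtain k1 k2 where k: "k1 < N" "k2 < N"
    "\<bar>lin a b (wt a b t) g \<omega> - lin a b (wt a b (grid_point N q)) g \<omega>\<bar>
       \<le> 2 * sqrt (MaxQ g (a * k1 div N) 0 w1 b \<omega>) + 2 * sqrt (MaxQ g 0 (b * k2 div N) a w2 \<omega>)"
    using bilin_grid_modulus[OF N w1 w2 t' q' near, where c="\<lambda>i j. g (shift (1 + int i) (1 + int j) \<omega>)"
        and ?M1.0="\<lambda>m. sqrt (MaxQ g (a * m div N) 0 w1 b \<omega>)" and ?M2.0="\<lambda>m. sqrt (MaxQ g 0 (b * m div N) a w2 \<omega>)", OF A1 A2]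
    unfolding lin_wt_bilin grid_point_def fst_conv snd_conv by blast
  have lf: "lin a b w f \<omega> = lin a b w g \<omega> + lin a b w h \<omega>" for w
    using lin_diff[of a b w f \<omega> g] by (simp add: h_def[abs_def])
  have "\<bar>lin a b (wt a b t) f \<omega> - lin a b (wt a b (grid_point N q)) f \<omega>\<bar>
     \<le> 2 * MaxS h a b \<omega> + 2 * sqrt (MaxQ g (a * k1 div N) 0 w1 b \<omega>) + 2 * sqrt (MaxQ g 0 (b * k2 div N) a w2 \<omega>)"
    using k(3) hb[OF t] hb[OF pq] unfolding lf by linarith
  then have "\<bar>lin a b (wt a b t) f \<omega> - lin a b (wt a b (grid_point N q)) f \<omega>\<bar> / ?r
     \<le> (2 * MaxS h a b \<omega> + 2 * sqrt (MaxQ g (a * k1 div N) 0 w1 b \<omega>) + 2 * sqrt (MaxQ g 0 (b * k2 div N) a w2 \<omega>)) / ?r"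
    using r by (intro divide_right_mono) auto
  also have "\<dots> = 2 * (MaxS h a b \<omega> / ?r) + 2 * (sqrt (MaxQ g (a * k1 div N) 0 w1 b \<omega>) / ?r) + 2 * (sqrt (MaxQ g 0 (b * k2 div N) a w2 \<omega>) / ?r)"
    by (simp add: add_divide_distrib)
  finally have 1: "\<bar>lin a b (wt a b t) f \<omega> - lin a b (wt a b (grid_point N q)) f \<omega>\<bar> / ?r
     \<le> 2 * (MaxS h a b \<omega> / ?r) + 2 * (sqrt (MaxQ g (a * k1 div N) 0 w1 b \<omega>) / ?r) + 2 * (sqrt (MaxQ g 0 (b * k2 div N) a w2 \<omega>) / ?r)" .
  have lam: "sqrt M / ?r \<le> d + M\<^sup>2 / (real a * real b)\<^sup>2 / d ^ 3" if "0 \<le> M" for M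
  proof -
    have "(sqrt M) ^ 4 = ((sqrt M)\<^sup>2)\<^sup>2" by (simp only: power_mult[symmetric]) simp
    then have "(sqrt M / ?r) ^ 4 = M\<^sup>2 / (real a * real b)\<^sup>2"
      using that by (simp only: power_divide r4 real_sqrt_pow2)
    then show ?thesis
      using le_add_fourth_power[of "sqrt M / ?r" d] that r d by simp
  qed
  have V: "V1 k1 \<le> (\<Sum>m<N. V1 m)" "V2 k2 \<le> (\<Sum>m<N. V2 m)"
    using k by (auto intro!: member_le_sum simp: V1_def V2_def)
  have "2 * (sqrt (MaxQ g (a * k1 div N) 0 w1 b \<omega>) / ?r) + 2 * (sqrt (MaxQ g 0 (b * k2 div N) a w2 \<omega>) / ?r)
     \<le> 4 * d + 2 * (V1 k1 / (real a * real b)\<^sup>2 / d ^ 3 + V2 k2 / (real a * real b)\<^sup>2 / d ^ 3)"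
  proof -
    have "2 * x + 2 * y \<le> 4 * d + 2 * (u + v)" if "x \<le> d + u" "y \<le> d + v" for x y u v :: real
      using that by simp
    from this[OF lam[OF MaxQ_nonneg] lam[OF MaxQ_nonneg]] show ?thesis unfolding V1_def V2_def .
  qed
  also have "\<dots> = 4 * d + 2 / d ^ 3 / (real a * real b)\<^sup>2 * (V1 k1 + V2 k2)"
    using d ab by (simp add: field_simps)
  \<comment> \<open>Which strips occur depends on \<open>t\<close> and \<open>q\<close>. Summing
    over all of them removes this dependence, so one random variable bounds all pairs at
    once.\<close>
  also have "\<dots> \<le> 4 * d + 2 / d ^ 3 / (real a * real b)\<^sup>2 * (\<Sum>m<N. V1 m + V2 m)"
    unfolding sum.distrib using V d ab by (intro add_left_mono mult_left_mono add_mono) auto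
  finally have 2: "2 * (sqrt (MaxQ g (a * k1 div N) 0 w1 b \<omega>) / ?r) + 2 * (sqrt (MaxQ g 0 (b * k2 div N) a w2 \<omega>) / ?r)
     \<le> 4 * d + 2 / d ^ 3 / (real a * real b)\<^sup>2 * (\<Sum>m<N. V1 m + V2 m)" .
  have "osc a b N w1 w2 d f g \<omega> = 2 * (MaxS h a b \<omega> / ?r) + (4 * d + 2 / d ^ 3 / (real a * real b)\<^sup>2 * (\<Sum>m<N. V1 m + V2 m))"
    unfolding osc_def V1_def V2_def h_def[abs_def] by (simp only: add.assoc)
  moreover have "z \<le> p + q" if "z \<le> p + x + y" "x + y \<le> q" for z p x y q :: real
    using that by simp
  from this[OF 1 2]
  have "\<bar>lin a b (wt a b t) f \<omega> - lin a b (wt a b (grid_point N q)) f \<omega>\<bar> / ?r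
     \<le> 2 * (MaxS h a b \<omega> / ?r) + (4 * d + 2 / d ^ 3 / (real a * real b)\<^sup>2 * (\<Sum>m<N. V1 m + V2 m))" .
  ultimately have "\<bar>lin a b (wt a b t) f \<omega> - lin a b (wt a b (grid_point N q)) f \<omega>\<bar> / ?r \<le> osc a b N w1 w2 d f g \<omega>"
    by simp
  then show ?thesis using r by (simp only: diff_divide_distrib[symmetric] abs_divide)
qed

text \<open>A strip covers at most a fraction \<open>3 / N\<close> of the rectangle, so its maximal
  fourth moment is at most \<open>36864 = 4096 \<cdot> 9\<close> times
  \<open>K\<^sup>4 (a b)\<^sup>2 / N\<^sup>2\<close>. With \<open>2 N\<close> strips and the
  prefactor 2 this gives \<open>147456 = 4 \<cdot> 36864\<close> and one surviving
  \<open>1 / N\<close>. The term \<open>8 \<eta>\<close> is twice the bound of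
  \<open>MaxS_expectation\<close>.\<close>

lemma osc_expectation:
  assumes f: "orthomart f" and g: "orthomart g" and K: "bdd_meas K g"
    and fg: "(\<integral>\<omega>. (f \<omega> - g \<omega>)\<^sup>2 \<partial>\<Omega>) \<le> \<eta>\<^sup>2" "0 \<le> \<eta>"
    and ab: "0 < a" "0 < b" and N: "0 < N" and d: "0 < d"
    and w1: "real w1 \<le> 3 * real a / real N" and w2: "real w2 \<le> 3 * real b / real N"
  shows "integrable \<Omega> (osc a b N w1 w2 d f g)"
    "(\<integral>\<omega>. osc a b N w1 w2 d f g \<omega> \<partial>\<Omega>) \<le> 8 * \<eta> + 4 * d + 147456 * K^4 / d ^ 3 / real N"
proof -
  note h = orthomart_diff[OF f g]
  note S = MaxS_expectation[OF h ab fg]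
  note Q = MaxQ_expectation[OF g K]
  let ?C = "2 / d ^ 3 / (real a * real b)\<^sup>2"
  have C: "0 \<le> ?C" using d by simp
  show i: "integrable \<Omega> (osc a b N w1 w2 d f g)"
    unfolding osc_def using S(1) Q(1)
    by (intro Bochner_Integration.integrable_add integrable_mult_right integrable_divide Bochner_Integration.integrable_sum) auto
  have strip: "4096 * (x * y)\<^sup>2 * K^4 \<le> 36864 * K^4 * (real a * real b)\<^sup>2 / (real N)\<^sup>2"
    if "0 \<le> x" "0 \<le> y" "x * y \<le> 3 * (real a * real b) / real N" for x y
  proof -
    have "(x * y)\<^sup>2 \<le> (3 * (real a * real b) / real N)\<^sup>2"
      using that by (intro power_mono) auto
    then have "4096 * (x * y)\<^sup>2 * K^4 \<le> 4096 * (3 * (real a * real b) / real N)\<^sup>2 * K^4"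
      by (intro mult_left_mono mult_right_mono) auto
    then show ?thesis by (simp add: power_divide power_mult_distrib mult_ac)
  qed
  have q1: "(\<integral>\<omega>. (MaxQ g p r w1 b \<omega>)\<^sup>2 \<partial>\<Omega>) \<le> 36864 * K^4 * (real a * real b)\<^sup>2 / (real N)\<^sup>2" for p r
    using mult_right_mono[OF w1, of "real b"]
    by (intro order_trans[OF Q(2)] strip) (auto simp: mult_ac)
  have q2: "(\<integral>\<omega>. (MaxQ g p r a w2 \<omega>)\<^sup>2 \<partial>\<Omega>) \<le> 36864 * K^4 * (real a * real b)\<^sup>2 / (real N)\<^sup>2" for p r
    using mult_left_mono[OF w2, of "real a"]
    by (intro order_trans[OF Q(2)] strip) (auto simp: mult_ac)
  have "(\<integral>\<omega>. osc a b N w1 w2 d f g \<omega> \<partial>\<Omega>) = 2 * (\<integral>\<omega>. MaxS (\<lambda>\<omega>. f \<omega> - g \<omega>) a b \<omega> / sqrt (real a * real b) \<partial>\<Omega>) + 4 * d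
    + ?C * (\<Sum>m<N. (\<integral>\<omega>. (MaxQ g (a * m div N) 0 w1 b \<omega>)\<^sup>2 \<partial>\<Omega>) + (\<integral>\<omega>. (MaxQ g 0 (b * m div N) a w2 \<omega>)\<^sup>2 \<partial>\<Omega>))"
    unfolding osc_def using S(1) Q(1)
    by (simp add: Bochner_Integration.integral_sum Bochner_Integration.integrable_sum)
  also have "\<dots> \<le> 2 * (4 * \<eta>) + 4 * d + ?C * (\<Sum>m<N. 36864 * K^4 * (real a * real b)\<^sup>2 / (real N)\<^sup>2 + 36864 * K^4 * (real a * real b)\<^sup>2 / (real N)\<^sup>2)"
    using C by (intro add_mono mult_left_mono sum_mono S(2) q1 q2 order_refl) auto
  also have "\<dots> = 8 * \<eta> + 4 * d + 147456 * K^4 / d ^ 3 / real N"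
    using N d ab by (simp add: field_simps power2_eq_square)
  finally show "(\<integral>\<omega>. osc a b N w1 w2 d f g \<omega> \<partial>\<Omega>) \<le> 8 * \<eta> + 4 * d + 147456 * K^4 / d ^ 3 / real N" .
qed

section \<open>Convergence of the normalized paths\<close>

definition norm_path :: "nat \<Rightarrow> nat \<Rightarrow> (config \<Rightarrow> real) \<Rightarrow> config \<Rightarrow> real \<times> real \<Rightarrow> real" where
  "norm_path a b f \<omega> = restrict (\<lambda>t. smooth_sum a b f t \<omega> / sqrt (real (card (rect a b)))) unit_square"

lemma norm_path_apply: "t \<in> unit_square \<Longrightarrow> norm_path a b f \<omega> t = lin a b (wt a b t) f \<omega> / sqrt (real a * real b)"
  by (simp add: norm_path_def smooth_sum_lin card_rect)

lemma norm_path_comb: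
  "norm_path a b f \<omega> = comb (rect a b) (\<lambda>k t. wt a b t k) (\<lambda>k. f (shift (fst k) (snd k) \<omega>) / sqrt (real a * real b))"
proof
  fix t
  show "norm_path a b f \<omega> t = comb (rect a b) (\<lambda>k t. wt a b t k) (\<lambda>k. f (shift (fst k) (snd k) \<omega>) / sqrt (real a * real b)) t"
  proof (cases "t \<in> unit_square")
    case True
    then show ?thesis
      unfolding norm_path_apply[OF True] by (simp add: comb_def lin_def sum_divide_distrib mult.commute)
  qed (simp add: norm_path_def comb_def)
qed

lemma norm_path_mspace: "norm_path a b f \<omega> \<in> mspace C_metric"
  unfolding norm_path_comb by (rule comb_mspace) (rule wt_continuous)

lemma norm_path_measurable:
  assumes f: "orthomart f"
  shows "norm_path a b f \<in> measurable \<Omega> (borel_of_top C_square)"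
  unfolding norm_path_comb[abs_def]
proof (rule comb_measurable)
  show "\<bar>wt a b t k\<bar> \<le> 1" for t k by (rule wt_bounds)
  show "(\<lambda>\<omega>. f (shift (fst k) (snd k) \<omega>) / sqrt (real a * real b)) \<in> borel_measurable \<Omega>" for k
    using orthomart_shift_meas[OF f] by simp
qed (rule wt_continuous)

text \<open>The path is compared with its grid interpolant by \<open>osc\<close>, the interpolant
  with that of the limit by finite-dimensional convergence, and the latter with the limit path by
  uniform continuity. Each comparison costs at most \<open>e / 4\<close>.\<close>

lemma norm_path_expectation_tendsto:
  fixes m1 m2 :: "nat \<Rightarrow> nat"
  assumes f: "orthomart f" and m: "filterlim m1 at_top sequentially" "filterlim m2 at_top sequentially"
    and W: "brownian_sheet_law W" and \<sigma>: "\<sigma>\<^sup>2 = (\<integral>\<omega>. (f \<omega>)\<^sup>2 \<partial>\<Omega>)"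
    and L: "0 \<le> L" and FB: "\<And>x. x \<in> mspace C_metric \<Longrightarrow> \<bar>F x\<bar> \<le> B"
    and FL: "\<And>x y. x \<in> mspace C_metric \<Longrightarrow> y \<in> mspace C_metric \<Longrightarrow> \<bar>F x - F y\<bar> \<le> L * mdist C_metric x y"
  shows "(\<lambda>n. \<integral>\<omega>. F (norm_path (m1 n) (m2 n) f \<omega>) \<partial>\<Omega>) \<longlonglongrightarrow> (\<integral>w. F (restrict (\<lambda>t. \<sigma> * w t) unit_square) \<partial>W)"
proof (rule tendstoI)
  fix e :: real assume "0 < e"
  interpret C: Metric_space "mspace C_metric" "mdist C_metric" by (rule Metric_space_mspace_mdist)
  have prob: "prob_space W" and setsW: "sets W = sets (borel_of_top C_square)"
    using W unfolding brownian_sheet_law_def by blast+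
  interpret W: prob_space W by (rule prob)
  have spW: "space W = mspace C_metric"
    using sets_eq_imp_space_eq[OF setsW] by (simp add: C_square_eq)
  have FM: "F \<in> borel_measurable (borel_of_top C_square)"
    unfolding C_square_eq by (rule borel_measurable_continuous_map[OF continuous_map_of_lipschitz[OF FL]])
  define V where "V w = restrict (\<lambda>t. \<sigma> * w t) unit_square" for w :: "real \<times> real \<Rightarrow> real"
  have VM: "V \<in> measurable W (borel_of_top C_square)"
    unfolding V_def by (rule scale_measurable[OF setsW])
  have Vms: "V w \<in> mspace C_metric" if "w \<in> space W" for w
    using measurable_space[OF VM that] by (simp only: space_borel_of_top C_square_eq topspace_mtopology_of)
  \<comment> \<open>Zero off the grid, because \<open>multivariate_levy\<close> asks for
    measurability at every index while \<open>grid_point\<close> may leave the square there.\<close>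
  define Y where "Y N w q = (if q \<in> grid N then \<sigma> * w (grid_point N q) else 0)" for N w q
  define X where "X N n \<omega> q = lin (m1 n) (m2 n) (wt (m1 n) (m2 n) (grid_point N q)) f \<omega> / sqrt (real (m1 n) * real (m2 n))" for N n \<omega> q
  define \<Phi> where "\<Phi> N x = F (comb (grid N) (hat N) x)" for N x
  have cms: "comb (grid N) (hat N) x \<in> mspace C_metric" for N x
    by (rule comb_mspace) (rule hat_continuous)
  have \<Phi>B: "\<bar>\<Phi> N x\<bar> \<le> B" for N x
    unfolding \<Phi>_def by (rule FB[OF cms])
  have \<Phi>L: "\<bar>\<Phi> N x - \<Phi> N y\<bar> \<le> L * (\<Sum>q\<in>grid N. \<bar>x q - y q\<bar>)" for N x y
  proof -
    have "\<bar>\<Phi> N x - \<Phi> N y\<bar> \<le> L * mdist C_metric (comb (grid N) (hat N) x) (comb (grid N) (hat N) y)"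
      unfolding \<Phi>_def by (rule FL[OF cms cms])
    also have "\<dots> \<le> L * (1 * (\<Sum>q\<in>grid N. \<bar>x q - y q\<bar>))"
      by (intro mult_left_mono comb_mdist_le hat_le_1 L)
    finally show ?thesis by simp
  qed
  have XM: "(\<lambda>\<omega>. X N n \<omega> q) \<in> borel_measurable \<Omega>" for N n q
    unfolding X_def using lin_measurable[OF f] by simp
  have YM: "(\<lambda>w. Y N w q) \<in> borel_measurable W" if "0 < N" for N q
    unfolding Y_def using eval_measurable[OF setsW grid_point_mem[OF that]] by (cases "q \<in> grid N") auto
  have \<Phi>Xm: "(\<lambda>\<omega>. \<Phi> N (X N n \<omega>)) \<in> borel_measurable \<Omega>" for N n
    unfolding \<Phi>_def
    by (rule measurable_compose[OF comb_measurable[where x="\<lambda>q \<omega>. X N n \<omega> q", OF hat_continuous hat_le_1 XM] FM])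
  have \<Phi>Ym: "(\<lambda>w. \<Phi> N (Y N w)) \<in> borel_measurable W" if "0 < N" for N
    unfolding \<Phi>_def
    by (rule measurable_compose[OF comb_measurable[where x="\<lambda>q w. Y N w q", OF hat_continuous hat_le_1 YM[OF that]] FM])

  \<comment> \<open>Every path in the support space of \<open>W\<close> is continuous, so its
    interpolants converge in \<open>C_square\<close>, and \<open>\<bar>F\<bar> \<le> B\<close> gives
    the limit of the integrals.\<close>
  have "(\<lambda>N. \<integral>w. \<Phi> (Suc N) (Y (Suc N) w) \<partial>W) \<longlonglongrightarrow> (\<integral>w. F (V w) \<partial>W)"
  proof (rule integral_dominated_convergence[where w="\<lambda>_. B"])
    show "AE w in W. (\<lambda>N. \<Phi> (Suc N) (Y (Suc N) w)) \<longlonglongrightarrow> F (V w)"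
    proof (rule AE_I2)
      fix w assume w: "w \<in> space W"
      have "comb (grid (Suc N)) (hat (Suc N)) (\<lambda>q. V w (grid_point (Suc N) q)) = comb (grid (Suc N)) (hat (Suc N)) (Y (Suc N) w)" for N
        unfolding comb_def using grid_point_mem[of "Suc N"]
        by (intro restrict_ext sum.cong refl) (simp add: Y_def V_def)
      with interpolation_tendsto[OF Vms[OF w]]
      have "limitin C.mtopology (\<lambda>N. comb (grid (Suc N)) (hat (Suc N)) (Y (Suc N) w)) (V w) sequentially"
        unfolding C_square_eq mtopology_of_def by simp
      then have lim: "(\<lambda>N. mdist C_metric (comb (grid (Suc N)) (hat (Suc N)) (Y (Suc N) w)) (V w)) \<longlonglongrightarrow> 0"
        by (simp only: C.limitin_metric_dist_null)
      show "(\<lambda>N. \<Phi> (Suc N) (Y (Suc N) w)) \<longlonglongrightarrow> F (V w)"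
      proof (rule LIM_zero_cancel, rule Lim_null_comparison)
        show "(\<lambda>N. L * mdist C_metric (comb (grid (Suc N)) (hat (Suc N)) (Y (Suc N) w)) (V w)) \<longlonglongrightarrow> 0"
          using tendsto_mult_right_zero[OF lim] .
        show "\<forall>\<^sub>F N in sequentially. norm (\<Phi> (Suc N) (Y (Suc N) w) - F (V w))
           \<le> L * mdist C_metric (comb (grid (Suc N)) (hat (Suc N)) (Y (Suc N) w)) (V w)"
          unfolding \<Phi>_def real_norm_def by (intro always_eventually allI FL[OF cms Vms[OF w]])
      qed
    qed
    show "(\<lambda>w. F (V w)) \<in> borel_measurable W" by (rule measurable_compose[OF VM FM])
    show "(\<lambda>w. \<Phi> (Suc N) (Y (Suc N) w)) \<in> borel_measurable W" for N by (rule \<Phi>Ym) simp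
  qed (use \<Phi>B in \<open>auto intro: W.integrable_const\<close>)
  then have evN1: "\<forall>\<^sub>F N in sequentially. dist (\<integral>w. \<Phi> (Suc N) (Y (Suc N) w) \<partial>W) (\<integral>w. F (V w) \<partial>W) < e / 4"
    by (rule tendstoD) (use \<open>0 < e\<close> in simp)

  \<comment> \<open>\<open>96 = 8 \<cdot> 12\<close>: \<open>osc\<close> is used with threshold
    \<open>d = \<eta>\<close> and then costs \<open>8 \<eta> + 4 \<eta>\<close>, which after
    multiplication by \<open>L\<close> has to stay within \<open>e / 8\<close>.\<close>
  define \<eta> where "\<eta> = e / (96 * (L + 1))"
  have \<eta>: "0 < \<eta>" "L * (12 * \<eta>) \<le> e / 8"
  proof -
    show "0 < \<eta>" using \<open>0 < e\<close> L by (simp add: \<eta>_def)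
    have "L * (12 * \<eta>) \<le> (L + 1) * (12 * \<eta>)" using \<open>0 < \<eta>\<close> by (intro mult_right_mono) auto
    also have "\<dots> = e / 8" using L by (simp add: \<eta>_def field_simps)
    finally show "L * (12 * \<eta>) \<le> e / 8" .
  qed
  obtain J K g where g: "finite J" "bdd_meas K g" "dep J g" "orthomart g" "(\<integral>\<omega>. (f \<omega> - g \<omega>)\<^sup>2 \<partial>\<Omega>) \<le> \<eta>\<^sup>2"
    using orthomart_approx[OF f \<eta>(1)] by blast
  \<comment> \<open>The other part of the bound on \<open>osc\<close>. Here \<open>K\<close> is
    already fixed by \<eta>, and a large \<open>N\<close> makes the term small.\<close>
  define A where "A = L * (147456 * K^4 / \<eta> ^ 3)"
  have "(\<lambda>N. A / real (Suc N)) \<longlonglongrightarrow> 0"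
    by (intro tendsto_divide_0[OF tendsto_const] filterlim_at_top_imp_at_infinity
        filterlim_compose[OF filterlim_real_sequentially filterlim_Suc])
  then have "\<forall>\<^sub>F N in sequentially. A / real (Suc N) < e / 8"
    by (rule order_tendstoD) (use \<open>0 < e\<close> in simp)
  with evN1 have "\<forall>\<^sub>F N in sequentially. dist (\<integral>w. \<Phi> (Suc N) (Y (Suc N) w) \<partial>W) (\<integral>w. F (V w) \<partial>W) < e / 4 \<and> A / real (Suc N) < e / 8"
    by (rule eventually_conj)
  then obtain N' where N': "dist (\<integral>w. \<Phi> (Suc N') (Y (Suc N') w) \<partial>W) (\<integral>w. F (V w) \<partial>W) < e / 4" "A / real (Suc N') < e / 8"
    by (auto simp: eventually_sequentially)
  define N where "N = Suc N'"
  have N: "0 < N" by (simp add: N_def)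

  have "(\<lambda>n. \<integral>\<omega>. \<Phi> N (X N n \<omega>) \<partial>\<Omega>) \<longlonglongrightarrow> (\<integral>w. \<Phi> N (Y N w) \<partial>W)"
  proof (rule multivariate_levy[where X="X N" and Y="Y N" and \<Phi>="\<Phi> N" and I="grid N" and C="\<sigma>\<^sup>2" and B=B and L=L])
    show "(\<lambda>n. \<integral>\<omega>. iexp (\<Sum>q\<in>grid N. u q * X N n \<omega> q) \<partial>\<Omega>) \<longlonglongrightarrow> (\<integral>w. iexp (\<Sum>q\<in>grid N. u q * Y N w q) \<partial>W)" for u
    proof -
      have "(\<Sum>q\<in>grid N. u q * Y N w q) = (\<Sum>q\<in>grid N. u q * (\<sigma> * w (grid_point N q)))" for w
        by (intro sum.cong) (auto simp: Y_def)
      then show ?thesis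
        using grid_char_tendsto[OF f m W N \<sigma>, of u] by (simp only: X_def)
    qed
    show "integrable \<Omega> (\<lambda>\<omega>. (X N n \<omega> q)\<^sup>2)" for n q
      unfolding X_def power_divide using lin_second_moment(1)[OF f] by simp
    show "(\<integral>\<omega>. (X N n \<omega> q)\<^sup>2 \<partial>\<Omega>) \<le> \<sigma>\<^sup>2" for n q
    proof -
      let ?R = "real (m1 n) * real (m2 n)"
      have "(\<Sum>k\<in>rect (m1 n) (m2 n). (wt (m1 n) (m2 n) (grid_point N q) k)\<^sup>2) \<le> (\<Sum>k\<in>rect (m1 n) (m2 n). 1)"
        using wt_bounds by (intro sum_mono power_le_one) (auto simp: wt_def mult_le_one)
      then have le: "(\<Sum>k\<in>rect (m1 n) (m2 n). (wt (m1 n) (m2 n) (grid_point N q) k)\<^sup>2) \<le> ?R"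
        by (simp add: card_rect)
      have "(\<integral>\<omega>. (X N n \<omega> q)\<^sup>2 \<partial>\<Omega>) = (\<integral>\<omega>. (lin (m1 n) (m2 n) (wt (m1 n) (m2 n) (grid_point N q)) f \<omega>)\<^sup>2 \<partial>\<Omega>) / ?R"
        unfolding X_def power_divide by simp
      also have "\<dots> = (\<Sum>k\<in>rect (m1 n) (m2 n). (wt (m1 n) (m2 n) (grid_point N q) k)\<^sup>2) * \<sigma>\<^sup>2 / ?R"
        by (simp only: lin_second_moment(2)[OF f] \<sigma>)
      also have "\<dots> \<le> ?R * \<sigma>\<^sup>2 / ?R"
        by (intro divide_right_mono mult_right_mono le) auto
      also have "\<dots> \<le> \<sigma>\<^sup>2" by (cases "?R = 0") auto
      finally show ?thesis .
    qed
    show "integrable W (\<lambda>w. (Y N w q)\<^sup>2)" if "q \<in> grid N" for q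
      using brownian_sheet_char(1)[OF W N that] that by (simp add: Y_def power_mult_distrib)
    show "(\<integral>w. (Y N w q)\<^sup>2 \<partial>W) \<le> \<sigma>\<^sup>2" if "q \<in> grid N" for q
      using brownian_sheet_char(2)[OF W N that] that by (simp add: Y_def power_mult_distrib mult_left_le)
  qed (fact prob_space_axioms prob finite_grid XM YM[OF N] \<Phi>B \<Phi>L L)+
  then have ev1: "\<forall>\<^sub>F n in sequentially. dist (\<integral>\<omega>. \<Phi> N (X N n \<omega>) \<partial>\<Omega>) (\<integral>w. \<Phi> N (Y N w) \<partial>W) < e / 4"
    by (rule tendstoD) (use \<open>0 < e\<close> in simp)
  have ev2: "\<forall>\<^sub>F n in sequentially. N < m1 n" "\<forall>\<^sub>F n in sequentially. N < m2 n"
    using m by (auto dest: eventually_compose_filterlim[OF eventually_gt_at_top])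
  show "\<forall>\<^sub>F n in sequentially. dist (\<integral>\<omega>. F (norm_path (m1 n) (m2 n) f \<omega>) \<partial>\<Omega>) (\<integral>w. F (restrict (\<lambda>t. \<sigma> * w t) unit_square) \<partial>W) < e"
    using ev1 ev2
  proof eventually_elim
    case (elim n)
    let ?a = "m1 n" and ?b = "m2 n"
    \<comment> \<open>At least \<open>a / N + 1\<close>, as \<open>osc_bound\<close> demands, and at
      most \<open>a / N + 2 \<le> 3 a / N\<close> because \<open>N < a\<close>, as
      \<open>osc_expectation\<close> demands.\<close>
    define w1 where "w1 = nat \<lceil>real ?a / real N\<rceil> + 1"
    define w2 where "w2 = nat \<lceil>real ?b / real N\<rceil> + 1"
    have strip: "real c / real N + 1 \<le> real (nat \<lceil>real c / real N\<rceil> + 1)" "real (nat \<lceil>real c / real N\<rceil> + 1) \<le> 3 * real c / real N"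
      if "N < c" for c
    proof -
      have "1 \<le> real c / real N" using that N by simp
      moreover have "real (nat \<lceil>real c / real N\<rceil>) \<le> real c / real N + 1" "real c / real N \<le> real (nat \<lceil>real c / real N\<rceil>)"
        using \<open>1 \<le> real c / real N\<close> ceiling_correct[of "real c / real N"] by auto
      moreover have "3 * real c / real N = 3 * (real c / real N)" by simp
      ultimately show "real c / real N + 1 \<le> real (nat \<lceil>real c / real N\<rceil> + 1)" "real (nat \<lceil>real c / real N\<rceil> + 1) \<le> 3 * real c / real N"
        unfolding of_nat_add of_nat_1 by linarith+
    qed
    note s1 = strip[OF elim(2), folded w1_def] and s2 = strip[OF elim(3), folded w2_def]
    have ab: "0 < ?a" "0 < ?b" using elim by auto
    let ?osc = "osc ?a ?b N w1 w2 \<eta> f g"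
    note O = osc_expectation[OF f g(4,2,5) less_imp_le[OF \<eta>(1)] ab N \<eta>(1) s1(2) s2(2)]
    have pw: "\<bar>F (norm_path ?a ?b f \<omega>) - \<Phi> N (X N n \<omega>)\<bar> \<le> L * ?osc \<omega>" for \<omega>
    proof -
      have near: "\<bar>norm_path ?a ?b f \<omega> t - comb (grid N) (hat N) (X N n \<omega>) t\<bar> \<le> ?osc \<omega>" if t: "t \<in> unit_square" for t
        unfolding norm_path_apply[OF t] X_def
        by (rule interpolation_error[OF t]) (rule osc_bound[OF ab N s1(1) s2(1) \<eta>(1) t])
      have "(0, 0) \<in> unit_square" by (simp add: unit_square_iff)
      then have "0 \<le> ?osc \<omega>" using near by (meson abs_ge_zero order_trans)
      then have "mdist C_metric (norm_path ?a ?b f \<omega>) (comb (grid N) (hat N) (X N n \<omega>)) \<le> ?osc \<omega>"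
        by (rule C_mdist_le) (rule near)
      then show ?thesis
        unfolding \<Phi>_def by (intro order_trans[OF FL[OF norm_path_mspace cms]] mult_left_mono L)
    qed
    have i1: "integrable \<Omega> (\<lambda>\<omega>. F (norm_path ?a ?b f \<omega>))"
      by (rule integrable_const_bound[where B=B])
         (use FB[OF norm_path_mspace] measurable_compose[OF norm_path_measurable[OF f] FM] in auto)
    have i2: "integrable \<Omega> (\<lambda>\<omega>. \<Phi> N (X N n \<omega>))"
      by (rule integrable_const_bound[where B=B]) (use \<Phi>B \<Phi>Xm in auto)
    have "\<bar>(\<integral>\<omega>. F (norm_path ?a ?b f \<omega>) \<partial>\<Omega>) - (\<integral>\<omega>. \<Phi> N (X N n \<omega>) \<partial>\<Omega>)\<bar> = \<bar>\<integral>\<omega>. F (norm_path ?a ?b f \<omega>) - \<Phi> N (X N n \<omega>) \<partial>\<Omega>\<bar>"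
      using i1 i2 by simp
    also have "\<dots> \<le> (\<integral>\<omega>. \<bar>F (norm_path ?a ?b f \<omega>) - \<Phi> N (X N n \<omega>)\<bar> \<partial>\<Omega>)"
      by (rule integral_abs_bound)
    also have "\<dots> \<le> (\<integral>\<omega>. L * ?osc \<omega> \<partial>\<Omega>)"
      by (intro integral_mono pw integrable_abs Bochner_Integration.integrable_diff i1 i2 integrable_mult_right O(1))
    also have "\<dots> = L * (\<integral>\<omega>. ?osc \<omega> \<partial>\<Omega>)" by simp
    also have "\<dots> \<le> L * (8 * \<eta> + 4 * \<eta> + 147456 * K^4 / \<eta> ^ 3 / real N)"
      by (intro mult_left_mono O(2) L)
    also have "\<dots> = L * (12 * \<eta>) + A / real N"
      by (simp add: A_def algebra_simps)
    also have "\<dots> \<le> e / 4"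
      using \<eta>(2) N'(2) unfolding N_def by linarith
    finally have "dist (\<integral>\<omega>. F (norm_path ?a ?b f \<omega>) \<partial>\<Omega>) (\<integral>\<omega>. \<Phi> N (X N n \<omega>) \<partial>\<Omega>) \<le> e / 4"
      unfolding dist_real_def .
    moreover have "dist (\<integral>w. \<Phi> N (Y N w) \<partial>W) (\<integral>w. F (V w) \<partial>W) < e / 4"
      using N'(1) unfolding N_def .
    ultimately have "dist (\<integral>\<omega>. F (norm_path ?a ?b f \<omega>) \<partial>\<Omega>) (\<integral>w. F (V w) \<partial>W) < e"
      using elim(1) \<open>0 < e\<close> unfolding dist_real_def by linarith
    then show ?case unfolding V_def .
  qed
qed

lemma invariance_principle:
  fixes m1 m2 :: "nat \<Rightarrow> nat"
  assumes f: "orthomart f" and m: "filterlim m1 at_top sequentially" "filterlim m2 at_top sequentially"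
    and W: "brownian_sheet_law W" and \<sigma>: "\<sigma>\<^sup>2 = (\<integral>\<omega>. (f \<omega>)\<^sup>2 \<partial>\<Omega>)"
  shows "weak_conv_top C_square
     (\<lambda>n. path_law \<Omega> (\<lambda>\<omega> t. smooth_sum (m1 n) (m2 n) f t \<omega> / sqrt (real (card (rect (m1 n) (m2 n))))))
     (path_law W (\<lambda>w t. \<sigma> * w t))"
proof -
  have prob: "prob_space W" and setsW: "sets W = sets (borel_of_top C_square)"
    using W unfolding brownian_sheet_law_def by blast+
  interpret W: prob_space W by (rule prob)
  have law: "path_law \<Omega> (\<lambda>\<omega> t. smooth_sum (m1 n) (m2 n) f t \<omega> / sqrt (real (card (rect (m1 n) (m2 n)))))
      = distr \<Omega> (borel_of_top C_square) (norm_path (m1 n) (m2 n) f)" for n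
    unfolding path_law_def norm_path_def[abs_def] ..
  have lawW: "path_law W (\<lambda>w t. \<sigma> * w t) = distr W (borel_of_top C_square) (\<lambda>w. restrict (\<lambda>t. \<sigma> * w t) unit_square)"
    unfolding path_law_def ..
  note pm = norm_path_measurable[OF f] and sm = scale_measurable[OF setsW, of \<sigma>]
  show ?thesis
    unfolding law lawW C_square_eq
  proof (rule weak_conv_top_lipschitz)
    show "prob_space (distr \<Omega> (borel_of_top (mtopology_of C_metric)) (norm_path (m1 n) (m2 n) f))" for n
      using prob_space_distr[OF pm] by (simp only: C_square_eq)
    show "prob_space (distr W (borel_of_top (mtopology_of C_metric)) (\<lambda>w. restrict (\<lambda>t. \<sigma> * w t) unit_square))"
      using W.prob_space_distr[OF sm] by (simp only: C_square_eq)
    fix F B L assume L: "0 \<le> L" and FB: "\<And>x. x \<in> mspace C_metric \<Longrightarrow> \<bar>F x\<bar> \<le> B"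
      and FL: "\<And>x y. x \<in> mspace C_metric \<Longrightarrow> y \<in> mspace C_metric \<Longrightarrow> \<bar>F x - F y\<bar> \<le> L * mdist C_metric x y"
    have FM: "F \<in> borel_measurable (borel_of_top C_square)"
      unfolding C_square_eq by (rule borel_measurable_continuous_map[OF continuous_map_of_lipschitz[OF FL]])
    show "(\<lambda>n. integral\<^sup>L (distr \<Omega> (borel_of_top (mtopology_of C_metric)) (norm_path (m1 n) (m2 n) f)) F)
        \<longlonglongrightarrow> integral\<^sup>L (distr W (borel_of_top (mtopology_of C_metric)) (\<lambda>w. restrict (\<lambda>t. \<sigma> * w t) unit_square)) F"
      unfolding C_square_eq[symmetric] integral_distr[OF pm FM] integral_distr[OF sm FM]
      by (rule norm_path_expectation_tendsto[OF f m W \<sigma> L FB FL])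
  qed simp_all
qed

section \<open>From the hypotheses to the theorem\<close>

lemma orthomart_of_orthomartingale_differences:
  assumes "f \<in> L0 P 2" "f \<in> borel_measurable (filt 0 0)" "orthomartingale_differences P f"
  shows "orthomart f"
  using L0_2D[OF assms(1)] orthomartingale_null_on[OF assms(1,3)] assms(2)
  by (simp add: orthomart_def filt_def coord_sigma_measurable_iff)

end

theorem theorem5p3:
  fixes P :: "real measure"
    and m1 m2 :: "nat \<Rightarrow> nat"
    and f :: "config \<Rightarrow> real"
  assumes "prob_space P" and "sets P = sets borel"
    and "incseq m1" and "filterlim m1 at_top sequentially"
    and "incseq m2" and "filterlim m2 at_top sequentially"
    and "f \<in> L0 P 2"
    and "f \<in> borel_measurable (filt 0 0)"
    and "orthomartingale_differences P f"
  shows "\<exists>\<sigma>\<ge>0.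
      (\<lambda>n. integral\<^sup>L (prodspace P) (\<lambda>\<omega>. (partial_sum (m1 n) (m2 n) f \<omega>)\<^sup>2)
             / real (card (rect (m1 n) (m2 n)))) \<longlonglongrightarrow> \<sigma>\<^sup>2
    \<and> weak_conv_m
        (\<lambda>n. distr (prodspace P) borel
               (\<lambda>\<omega>. partial_sum (m1 n) (m2 n) f \<omega> / sqrt (real (card (rect (m1 n) (m2 n))))))
        (distr std_normal_distribution borel (\<lambda>x. \<sigma> * x))
    \<and> ((\<exists>p>2. f \<in> L0 P p) \<longrightarrow>
        (\<forall>W. brownian_sheet_law W \<longrightarrow>
           weak_conv_top C_square
             (\<lambda>n. path_law (prodspace P)
                    (\<lambda>\<omega> t. smooth_sum (m1 n) (m2 n) f t \<omega>
                             / sqrt (real (card (rect (m1 n) (m2 n))))))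
             (path_law W (\<lambda>w t. \<sigma> * w t))))"
proof -
  interpret iid_field P using assms(1,2) by (rule iid_field.intro)
  have f: "orthomart f" by (rule orthomart_of_orthomartingale_differences) fact+
  \<comment> \<open>The L2 norm of \<open>f\<close>: by orthogonality its square is the normalized
    second moment over every nonempty rectangle.\<close>
  define \<sigma> where "\<sigma> = sqrt (integral\<^sup>L (prodspace P) (\<lambda>\<omega>. (f \<omega>)\<^sup>2))"
  have \<sigma>: "0 \<le> \<sigma>" "\<sigma>\<^sup>2 = integral\<^sup>L (prodspace P) (\<lambda>\<omega>. (f \<omega>)\<^sup>2)"
    unfolding \<sigma>_def by (simp_all add: Bochner_Integration.integral_nonneg)
  show ?thesis
  proof (intro exI[of _ \<sigma>] conjI impI allI \<sigma>(1))
    show "(\<lambda>n. integral\<^sup>L (prodspace P) (\<lambda>\<omega>. (partial_sum (m1 n) (m2 n) f \<omega>)\<^sup>2)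
             / real (card (rect (m1 n) (m2 n)))) \<longlonglongrightarrow> \<sigma>\<^sup>2"
      unfolding \<sigma>(2) by (rule variance_limit[OF f assms(4,6)])
    show "weak_conv_m
        (\<lambda>n. distr (prodspace P) borel
               (\<lambda>\<omega>. partial_sum (m1 n) (m2 n) f \<omega> / sqrt (real (card (rect (m1 n) (m2 n))))))
        (distr std_normal_distribution borel (\<lambda>x. \<sigma> * x))"
      unfolding \<sigma>_def by (rule partial_sum_clt[OF f assms(4,6)])
  qed (rule invariance_principle[OF f assms(4,6) _ \<sigma>(2)])
qed

end
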